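(* Let $\Lambda$ be a lattice spanning the $s$-dimensional real vector space $V$ and $X$ a finite ordered list of nonzero vectors in $\Lambda$ spanning $V$. For every point $e^\phi\in P(X)$ and every no broken basis $\underline b$ extracted from $X_\phi$, $$\mathfrak q_{\underline b,\phi}(-y)=\det(\underline b)\,\mathrm{res}_{\underline b,\phi}\left(\frac{e^{\langle y\mid z\rangle}}{\prod_{a\in X}\big(1-e^{-a(z)-\langle\phi\mid a\rangle}\big)}\right),$$ where the function on the right is expanded as a power series in $y$ and the residue is taken coefficientwise.
   Context: $U=V^*$, $U_{\mathbb C}=\mathrm{Hom}_{\mathbb R}(V,\mathbb C)$. Fix a basis of $\Lambda$, giving linear coordinates $z=(z_1,\dots,z_s)$ on $U_{\mathbb C}$ and dual coordinates $y=(y_1,\dots,y_s)$ on $V$, $\langle y\mid z\rangle=\sum y_iz_i$; $a\in V$ is viewed as a linear function $a(z)$. $\mathbb C[\Lambda]$ is the group algebra with basis $e^a$ (functions on $U_{\mathbb C}$, and on $T=\mathrm{Hom}(\Lambda,\mathbb C^* )$, where $\phi\in U_{\mathbb C}$ gives the point $e^\phi$ with $e^a(e^\phi)=e^{\langle\phi\mid a\rangle}$). $P(X)\subset T$ is the finite set of points $e^\phi$ for which some basis $\underline b$ of $V$ extracted from $X$ satisfies $e^{\langle\phi\mid a\rangle}=1$ for all $a\in\underline b$; one representative $\phi\in U_{\mathbb C}$ is fixed for each point. $X_\phi:=\{a\in X\mid e^{\langle\phi\mid a\rangle}=1\}$, a sublist with the order induced from $X$. For an ordered list $Z=(a_1,\dots,a_M)$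 spanning $V$, a basis $\underline b=(a_{i_1},\dots,a_{i_s})$, $i_1<\dots<i_s$, extracted from $Z$ is broken by $a_i$ if there is $e$ with $i\le i_e$ and $a_i$ in the span of $a_{i_e},\dots,a_{i_s}$; $\underline b$ is no broken if exactly $s$ elements of $Z$ (by index) break it; $\mathcal{NB}_Z$ is the set of no broken bases. $S_X:=\mathbb C[\Lambda][\prod_{a\in X}(1-e^{-a})^{-1}]$; $S_{X,s-1}$ is the span of the fractions $f/\prod_i(1-e^{-a_i})^{h_i}$, $f\in\mathbb C[\Lambda]$, such that the vectors $a_i\in X$ with $h_i>0$ do not span $V$; $\Pi_X:=S_X/S_{X,s-1}$. Polynomials $q$ on $V$ act on $S_X$ and $\Pi_X$ as constant coefficient differential operators $q(\partial)$ on $U$ ($\psi\in U$ acting as the derivation with $e^v\mapsto\langle\psi\mid v\rangle e^v$). For $\underline b\in\mathcal{NB}_{X_\phi}$ let $\Lambda_{\underline b}$ be the lattice spanned by $\underline b$, $R_{\underline b}=\{\lambda\in\Lambda\mid\lambda=\sum_{a\in\underline b}p_aa,\ 0\le p_a<1\}$, $|\det(\underline b)|=[\Lambda:\Lambda_{\underline b}]$, $e(\phi):=|\det(\underline b)|^{-1}\sum_{\lambda\in R_{\underline b}}e^{-\langle\phi\mid\lambda\rangle}e^\lambda$, and $\omega_{\underline b,\phi}:=\big[e(\phi)/\prod_{a\in\underline b}(1-e^{-a})\big]\in\Pi_X$. The polynomials $\mathfrak q_{\underline b,\phi}$ on $V$ are the unique ones with $$\Big[\prod_{a\in X}(1-e^{-a})^{-1}\Big]=\sum_{e^\phi\in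 P(X)}\ \sum_{\underline b\in\mathcal{NB}_{X_\phi}}\mathfrak q_{\underline b,\phi}(\partial)\,\omega_{\underline b,\phi}\quad\text{in }\Pi_X.$$ Residue: $z$ are coordinates centered at $\phi$ (points near $\phi$ are $\phi+z$). For $\underline b=(b_1,\dots,b_s)$ in the order of $X_\phi$, $\det(\underline b)$ is defined by $db_1\wedge\dots\wedge db_s=\det(\underline b)dz_1\wedge\dots\wedge dz_s$. For a meromorphic germ $f(z)$ at $z=0$ with poles on the hyperplanes $a(z)=0$, $a\in X_\phi$, $\mathrm{res}_{\underline b,\phi}(f)$ is the coefficient of $(u_1\cdots u_s)^{-1}du_1\wedge\dots\wedge du_s$ in the expansion, in $\mathbb C[[u_1,\dots,u_s]][(u_1\cdots u_s)^{-1}]$, of $f\,dz_1\wedge\dots\wedge dz_s$ after the substitution $b_i(z)=u_1u_2\cdots u_i$, $i=1,\dots,s$. *)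

theory Defs
  imports "HOL-Analysis.Analysis" "HOL-Library.Poly_Mapping"
begin

text \<open>
  The dimension $s$ is the cardinality of an index type of sort finite and linorder; its
  linear order is the order of the coordinates and of the members of an ordered basis.
  The real vector space $V$ is an arbitrary type of class \<open>real_vector\<close>, and
  \<open>\<beta>\<close> is the fixed basis of the lattice.  Points of $U_{\mathbb C}$ are given by
  their coordinates $z$ with respect to \<open>\<beta>\<close>.
\<close>

section \<open>Lattices and coordinates\<close>

definition int_span :: "('s::finite \<Rightarrow> 'v::real_vector) \<Rightarrow> 'v set" where
  "int_span c = range (\<lambda>n :: 's \<Rightarrow> int. \<Sum>i\<in>UNIV. real_of_int (n i) *\<^sub>R c i)"

definition family_basis :: "('s::finite \<Rightarrow> 'v::real_vector) \<Rightarrow> bool" where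
  "family_basis c \<longleftrightarrow> inj c \<and> independent (range c) \<and> span (range c) = UNIV"

definition lattice_basis :: "'v set \<Rightarrow> ('s::finite \<Rightarrow> 'v::real_vector) \<Rightarrow> bool" where
  "lattice_basis \<Lambda> \<beta> \<longleftrightarrow> family_basis \<beta> \<and> \<Lambda> = int_span \<beta>"

definition coord :: "('s::finite \<Rightarrow> 'v::real_vector) \<Rightarrow> 'v \<Rightarrow> 's \<Rightarrow> real" where
  "coord \<beta> v i = representation (range \<beta>) v (\<beta> i)"

text \<open>\<open>pairing \<beta> z v\<close> is $\langle z \mid v\rangle$, that is, $v(z)$ for $v\in V$
  viewed as a linear function on $U_{\mathbb C}$.\<close>

definition pairing :: "('s::finite \<Rightarrow> 'v::real_vector) \<Rightarrow> (complex, 's) vec \<Rightarrow> 'v \<Rightarrow> complex" where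
  "pairing \<beta> z v = (\<Sum>i\<in>UNIV. of_real (coord \<beta> v i) * z $ i)"


section \<open>Bases extracted from a list, no broken bases\<close>

text \<open>An extracted basis is recorded by the strictly increasing family of its positions.\<close>

definition extracted :: "'v list \<Rightarrow> ('s \<Rightarrow> nat) \<Rightarrow> 's \<Rightarrow> 'v" where
  "extracted Z b i = Z ! b i"

definition bases :: "'v::real_vector list \<Rightarrow> ('s::{finite,linorder} \<Rightarrow> nat) set" where
  "bases Z = {b. strict_mono b \<and> (\<forall>i. b i < length Z) \<and> family_basis (extracted Z b)}"

definition broken_by :: "'v::real_vector list \<Rightarrow> ('s::{finite,linorder} \<Rightarrow> nat) \<Rightarrow> nat \<Rightarrow> bool" where
  "broken_by Z b i \<longleftrightarrow> (\<exists>e. i \<le> b e \<and> Z ! i \<in> span (extracted Z b ` {e..}))"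

definition no_broken_bases :: "'v::real_vector list \<Rightarrow> ('s::{finite,linorder} \<Rightarrow> nat) set" where
  "no_broken_bases Z = {b \<in> bases Z. card {i. i < length Z \<and> broken_by Z b i} = CARD('s)}"


section \<open>The points of the arrangement\<close>

definition torus_point ::
    "'v set \<Rightarrow> ('s::finite \<Rightarrow> 'v::real_vector) \<Rightarrow> (complex, 's) vec \<Rightarrow> 'v \<Rightarrow> complex" where
  "torus_point \<Lambda> \<beta> \<phi> = restrict (\<lambda>l. exp (pairing \<beta> \<phi> l)) \<Lambda>"

definition arrangement_points ::
    "'v set \<Rightarrow> ('s::{finite,linorder} \<Rightarrow> 'v::real_vector) \<Rightarrow> 'v list \<Rightarrow> ('v \<Rightarrow> complex) set" where
  "arrangement_points \<Lambda> \<beta> X = {torus_point \<Lambda> \<beta> \<phi> | \<phi>.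
     \<exists>b :: 's \<Rightarrow> nat. b \<in> bases X \<and> (\<forall>i. exp (pairing \<beta> \<phi> (extracted X b i)) = 1)}"

definition sublist_at ::
    "('s::finite \<Rightarrow> 'v::real_vector) \<Rightarrow> 'v list \<Rightarrow> (complex, 's) vec \<Rightarrow> 'v list" where
  "sublist_at \<beta> X \<phi> = filter (\<lambda>a. exp (pairing \<beta> \<phi> a) = 1) X"


section \<open>Polynomials and differential operators\<close>

text \<open>A polynomial on $V$ in the coordinates $y$; the keys are the exponent vectors.\<close>

type_synonym 's polynomial = "('s \<Rightarrow> nat) \<Rightarrow>\<^sub>0 complex"

definition eval_polynomial :: "'s::finite polynomial \<Rightarrow> (complex, 's) vec \<Rightarrow> complex" where
  "eval_polynomial q y =
     (\<Sum>\<alpha>\<in>Poly_Mapping.keys q. Poly_Mapping.lookup q \<alpha> * (\<Prod>i\<in>UNIV. (y $ i) ^ \<alpha> i))"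

definition partial ::
    "'s::finite \<Rightarrow> ((complex, 's) vec \<Rightarrow> complex) \<Rightarrow> (complex, 's) vec \<Rightarrow> complex" where
  "partial i F z = deriv (\<lambda>t. F (z + axis i t)) 0"

definition partials ::
    "('s::{finite,linorder} \<Rightarrow> nat) \<Rightarrow> ((complex, 's) vec \<Rightarrow> complex) \<Rightarrow> (complex, 's) vec \<Rightarrow> complex" where
  "partials \<alpha> F = fold (\<lambda>i. partial i ^^ \<alpha> i) (sorted_list_of_set UNIV) F"

text \<open>The coordinate $y_i$, an element of $U$, acts by $e^v \mapsto v_i e^v$,
  i.e. as $\partial/\partial z_i$.\<close>

definition diff_op :: "'s::{finite,linorder} polynomial \<Rightarrow>
    ((complex, 's) vec \<Rightarrow> complex) \<Rightarrow> (complex, 's) vec \<Rightarrow> complex" where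
  "diff_op q F z =
     (\<Sum>\<alpha>\<in>Poly_Mapping.keys q. Poly_Mapping.lookup q \<alpha> * partials \<alpha> F z)"

definition taylor_coeff ::
    "('s::{finite,linorder} \<Rightarrow> nat) \<Rightarrow> ((complex, 's) vec \<Rightarrow> complex) \<Rightarrow> complex" where
  "taylor_coeff \<alpha> F = partials \<alpha> F 0 / (\<Prod>i\<in>UNIV. fact (\<alpha> i))"


section \<open>The module $\Pi_X$\<close>

text \<open>
  Elements of $\mathbb C[\Lambda]$ and of $S_X$ are functions on $U_{\mathbb C}$; the latter
  matter only on the open dense set where no denominator vanishes.
\<close>

definition group_algebra ::
    "'v set \<Rightarrow> ('s::finite \<Rightarrow> 'v::real_vector) \<Rightarrow> ((complex, 's) vec \<Rightarrow> complex) set" where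
  "group_algebra \<Lambda> \<beta> = {\<lambda>z. \<Sum>l\<in>A. c l * exp (pairing \<beta> z l) | A c. finite A \<and> A \<subseteq> \<Lambda>}"

definition regular_points ::
    "('s::finite \<Rightarrow> 'v::real_vector) \<Rightarrow> 'v list \<Rightarrow> (complex, 's) vec set" where
  "regular_points \<beta> X = {z. \<forall>a\<in>set X. exp (- pairing \<beta> z a) \<noteq> 1}"

text \<open>$S_{X,s-1}$; the scalars of the linear combination are absorbed in the numerators.\<close>

definition S_lower ::
    "'v set \<Rightarrow> ('s::finite \<Rightarrow> 'v::real_vector) \<Rightarrow> 'v list \<Rightarrow> ((complex, 's) vec \<Rightarrow> complex) set" where
  "S_lower \<Lambda> \<beta> X = {F. \<exists>(n::nat) g (h :: nat \<Rightarrow> nat \<Rightarrow> nat).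
     (\<forall>k<n. g k \<in> group_algebra \<Lambda> \<beta> \<and>
            span {X ! i | i. i < length X \<and> 0 < h k i} \<noteq> UNIV) \<and>
     (\<forall>z\<in>regular_points \<beta> X.
        F z = (\<Sum>k<n. g k z / (\<Prod>i<length X. (1 - exp (- pairing \<beta> z (X ! i))) ^ h k i)))}"

definition equal_in_Pi :: "'v set \<Rightarrow> ('s::finite \<Rightarrow> 'v::real_vector) \<Rightarrow> 'v list \<Rightarrow>
    ((complex, 's) vec \<Rightarrow> complex) \<Rightarrow> ((complex, 's) vec \<Rightarrow> complex) \<Rightarrow> bool" where
  "equal_in_Pi \<Lambda> \<beta> X F G \<longleftrightarrow> (\<lambda>z. F z - G z) \<in> S_lower \<Lambda> \<beta> X"


section \<open>The polynomials $\mathfrak q_{\underline b,\phi}$\<close>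

text \<open>In this section \<open>c\<close> is the family of vectors of an extracted basis.\<close>

definition lattice_index :: "'v set \<Rightarrow> ('s::finite \<Rightarrow> 'v::real_vector) \<Rightarrow> nat" where
  "lattice_index \<Lambda> c = card ((\<lambda>l. (\<lambda>m. l + m) ` int_span c) ` \<Lambda>)"

definition box_points :: "'v set \<Rightarrow> ('s::finite \<Rightarrow> 'v::real_vector) \<Rightarrow> 'v set" where
  "box_points \<Lambda> c = {l \<in> \<Lambda>. \<exists>p :: 's \<Rightarrow> real.
     (\<forall>i. 0 \<le> p i \<and> p i < 1) \<and> l = (\<Sum>i\<in>UNIV. p i *\<^sub>R c i)}"

definition e_phi :: "'v set \<Rightarrow> ('s::finite \<Rightarrow> 'v::real_vector) \<Rightarrow> ('s \<Rightarrow> 'v) \<Rightarrow>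
    (complex, 's) vec \<Rightarrow> (complex, 's) vec \<Rightarrow> complex" where
  "e_phi \<Lambda> \<beta> c \<phi> z = inverse (of_nat (lattice_index \<Lambda> c)) *
     (\<Sum>l\<in>box_points \<Lambda> c. exp (- pairing \<beta> \<phi> l) * exp (pairing \<beta> z l))"

definition omega :: "'v set \<Rightarrow> ('s::finite \<Rightarrow> 'v::real_vector) \<Rightarrow> ('s \<Rightarrow> 'v) \<Rightarrow>
    (complex, 's) vec \<Rightarrow> (complex, 's) vec \<Rightarrow> complex" where
  "omega \<Lambda> \<beta> c \<phi> z = e_phi \<Lambda> \<beta> c \<phi> z / (\<Prod>i\<in>UNIV. 1 - exp (- pairing \<beta> z (c i)))"

text \<open>The defining property of the family $\mathfrak q$, for a set \<open>\<Phi>\<close> of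
  representatives of the points of the arrangement.  Only the values \<open>q b \<phi>\<close> with
  \<open>\<phi> \<in> \<Phi>\<close> and \<open>b\<close> a no broken basis of $X_\phi$ matter; those are unique.\<close>

definition is_q_family :: "'v set \<Rightarrow> ('s::{finite,linorder} \<Rightarrow> 'v::real_vector) \<Rightarrow> 'v list \<Rightarrow>
    (complex, 's) vec set \<Rightarrow> (('s \<Rightarrow> nat) \<Rightarrow> (complex, 's) vec \<Rightarrow> 's polynomial) \<Rightarrow> bool" where
  "is_q_family \<Lambda> \<beta> X \<Phi> q \<longleftrightarrow>
     equal_in_Pi \<Lambda> \<beta> X
       (\<lambda>z. inverse (\<Prod>a\<leftarrow>X. 1 - exp (- pairing \<beta> z a)))
       (\<lambda>z. \<Sum>\<phi>\<in>\<Phi>. \<Sum>b\<in>no_broken_bases (sublist_at \<beta> X \<phi>).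
              diff_op (q b \<phi>) (omega \<Lambda> \<beta> (extracted (sublist_at \<beta> X \<phi>) b) \<phi>) z)"


section \<open>Residues\<close>

definition basis_det :: "('s::finite \<Rightarrow> 'v::real_vector) \<Rightarrow> ('s \<Rightarrow> 'v) \<Rightarrow> real" where
  "basis_det \<beta> c = det (\<chi> i j. coord \<beta> (c i) j)"

definition substitution ::
    "('s::{finite,linorder} \<Rightarrow> 'v::real_vector) \<Rightarrow> ('s \<Rightarrow> 'v) \<Rightarrow> (complex, 's) vec \<Rightarrow> (complex, 's) vec" where
  "substitution \<beta> c u = (THE z. \<forall>i. pairing \<beta> z (c i) = (\<Prod>j\<in>{..i}. u $ j))"

text \<open>The function $G$ with $f\,dz_1\wedge\dots\wedge dz_s = G\,du_1\wedge\dots\wedge du_s$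
  after the substitution.\<close>

definition pullback :: "('s::{finite,linorder} \<Rightarrow> 'v::real_vector) \<Rightarrow> ('s \<Rightarrow> 'v) \<Rightarrow>
    ((complex, 's) vec \<Rightarrow> complex) \<Rightarrow> (complex, 's) vec \<Rightarrow> complex" where
  "pullback \<beta> c f u = f (substitution \<beta> c u) *
     det (\<chi> i j. partial j (\<lambda>w. substitution \<beta> c w $ i) u)"

text \<open>$G(u) = (u_1\cdots u_s)^{-N}\sum_\alpha k_\alpha u^\alpha$ for all small $u$ with
  nonzero coordinates: the expansion of $G$ in $\mathbb C[[u]][(u_1\cdots u_s)^{-1}]$,
  which converges because $f$ is a meromorphic germ.\<close>

definition has_expansion ::
    "((complex, 's::finite) vec \<Rightarrow> complex) \<Rightarrow> nat \<Rightarrow> (('s \<Rightarrow> nat) \<Rightarrow> complex) \<Rightarrow> bool" where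
  "has_expansion G N k \<longleftrightarrow> (\<exists>\<epsilon>>0. \<forall>u. (\<forall>i. 0 < norm (u $ i) \<and> norm (u $ i) < \<epsilon>) \<longrightarrow>
     ((\<lambda>\<alpha>. k \<alpha> * (\<Prod>i\<in>UNIV. (u $ i) ^ \<alpha> i)) has_sum (\<Prod>i\<in>UNIV. u $ i) ^ N * G u) UNIV)"

definition res :: "('s::{finite,linorder} \<Rightarrow> 'v::real_vector) \<Rightarrow> ('s \<Rightarrow> 'v) \<Rightarrow>
    ((complex, 's) vec \<Rightarrow> complex) \<Rightarrow> complex" where
  "res \<beta> c f = (THE r. \<exists>N k. has_expansion (pullback \<beta> c f) (Suc N) k \<and> r = k (\<lambda>_. N))"

end

(*
  Expand in w_i = b_i(z), in the region |w_1| >> |w_2| >> ... >> |w_s|; up to the determinant the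
  residue is the coefficient of 1/(w_1 ... w_s).  A linear form a(z) is dominated there by its
  first nonzero term, so 1/a(z) contributes negative powers of a single w_i, and a function whose
  poles do not involve all of w_1, ..., w_s in this way has residue zero.  Such functions are
  closed under differentiation and contain the germ at phi of S_{X,s-1}, of all omega_{b',phi}
  with b' different from b (by the no broken circuit property), and of all omega_{b',phi'} with
  phi' different from phi: either a pole of 1/prod(1 - e^{-a}) is lost at phi, or the leading
  coefficient of e(phi') is the mean of a nontrivial character of Lambda/Lambda_b'.  Modulo such
  functions omega_{b,phi} is 1/(w_1 ... w_s), and integration by parts moves q(d) onto e^<y|z>.
*)

theory Submission
  imports Defs "HOL-Complex_Analysis.Cauchy_Integral_Formula"
begin

section \<open>Multivariate Laurent expansions\<close>

text \<open>Both sides are compared at one power of y. The coefficient of y^\<alpha> in e^<y|z> is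
  z^\<alpha>/\<alpha>!, so the claim becomes that the residue of z^\<alpha>/\<alpha>! times the
  shifted fraction is (-1)^|\<alpha>| times one coefficient of q, divided by det. The argument -y
  absorbs the signs of |\<alpha>| integrations by parts. One obstacle is that vanishing is visible
  in the exponents of the b_i, whereas the residue is defined by exponents of the u_j. In b the
  exponents are not bounded below, since all powers of b_2/b_1 = u_2 may occur; in u they are.
  Expansions are therefore indexed by exponents of b, with the bound imposed on those of u. Another
  obstacle is that differentiation is the analytic derivative of a function, meaningful only where
  that function is differentiable. Vanishing is therefore propagated through a class of functions
  known to be differentiable near the origin off the hyperplanes, and infinite series are never
  differentiated term by term.\<close>

lemma has_sum_regroup:
  fixes c :: "'i \<Rightarrow> complex" and M :: "'e \<Rightarrow> 'x \<Rightarrow> complex"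
  assumes sum: "\<And>u. u \<in> P \<Longrightarrow> ((\<lambda>x. c x * M (\<mu> x) u) has_sum F u) I"
    and nz: "\<And>u m. u \<in> P \<Longrightarrow> M m u \<noteq> 0" and u: "u \<in> P"
  shows "((\<lambda>m. infsum c {x\<in>I. \<mu> x = m} * M m u) has_sum F u) UNIV"
proof -
  \<comment> \<open>One point \<open>u\<close> suffices: on a fibre of \<open>\<mu>\<close> the
    monomial is a constant nonzero factor, so the regrouped coefficients converge and do not depend
    on \<open>u\<close>.\<close>
  have summ: "c summable_on {x\<in>I. \<mu> x = m}" for m
  proof -
    have "(\<lambda>x. c x * M (\<mu> x) u) summable_on {x\<in>I. \<mu> x = m}"
      by (rule summable_on_subset_banach[OF has_sum_imp_summable[OF sum[OF u]]]) auto
    then have "(\<lambda>x. c x * M m u) summable_on {x\<in>I. \<mu> x = m}"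
      by (rule summable_on_cong[THEN iffD1, rotated]) auto
    then show ?thesis
      using nz[OF u] by (simp add: summable_on_cmult_left')
  qed
  have bij: "bij_betw (\<lambda>x. (\<mu> x, x)) I (Sigma UNIV (\<lambda>m. {x\<in>I. \<mu> x = m}))"
    by (auto simp: bij_betw_def inj_on_def)
  have "((\<lambda>(m, x). c x * M m u) has_sum F u) (Sigma UNIV (\<lambda>m. {x\<in>I. \<mu> x = m}))"
    using has_sum_reindex_bij_betw[OF bij, of "\<lambda>(m, x). c x * M m u" "F u"] sum[OF u] by simp
  then show ?thesis
    by (rule has_sum_SigmaD) (auto intro!: has_sum_cmult_left has_sum_infsum summ)
qed

definition wcoord :: "(complex, 's::{finite,linorder}) vec \<Rightarrow> 's \<Rightarrow> complex" where
  "wcoord u i = (\<Prod>j\<in>{..i}. u $ j)"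

text \<open>\<open>wcoord u i\<close> is $b_i(z) = u_1\cdots u_i$.  Expansions are indexed by the exponents \<open>m\<close> of
  the $b_i$; the exponent of $u_j$ is then \<open>tail m j\<close>.  Since
  $db_1\wedge\dots\wedge db_s/\prod b_i = du_1\wedge\dots\wedge du_s/\prod u_i$, the residue is, up to
  the determinant, the coefficient at the constant exponent $-1$.\<close>

definition lmon :: "('s::{finite,linorder} \<Rightarrow> int) \<Rightarrow> (complex, 's) vec \<Rightarrow> complex" where
  "lmon m u = (\<Prod>i\<in>UNIV. wcoord u i powi m i)"

definition tail :: "('s::{finite,linorder} \<Rightarrow> int) \<Rightarrow> 's \<Rightarrow> int" where
  "tail m j = (\<Sum>i\<in>{j..}. m i)"

definition punct :: "real \<Rightarrow> (complex, 's::finite) vec set" where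
  "punct \<epsilon> = {u. \<forall>i. 0 < norm (u $ i) \<and> norm (u $ i) < \<epsilon>}"

text \<open>Membership in the ring C[[u]][1/(u_1...u_s)], with convergence on a punctured polydisc.
  The lower bound concerns \<open>tail m\<close>, the exponents of the u_j; the entries of
  \<open>m\<close> itself may be arbitrarily negative.\<close>

definition lexp :: "(('s::{finite,linorder} \<Rightarrow> int) \<Rightarrow> complex) \<Rightarrow> ((complex, 's) vec \<Rightarrow> complex) \<Rightarrow> bool" where
  "lexp k F \<longleftrightarrow> (\<exists>\<epsilon>>0. \<exists>N::nat. (\<forall>m. k m \<noteq> 0 \<longrightarrow> (\<forall>j. - int N \<le> tail m j)) \<and>
     (\<forall>u\<in>punct \<epsilon>. ((\<lambda>m. k m * lmon m u) has_sum F u) UNIV))"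

lemma punct_mono: "\<delta> \<le> \<epsilon> \<Longrightarrow> punct \<delta> \<subseteq> punct \<epsilon>"
  unfolding punct_def by (auto intro: less_le_trans)

lemma punct_nonzero: "u \<in> punct \<epsilon> \<Longrightarrow> u $ i \<noteq> 0"
  unfolding punct_def by force

lemma power_int_sum_exp: "finite A \<Longrightarrow> (x::complex) \<noteq> 0 \<Longrightarrow> x powi (\<Sum>i\<in>A. f i) = (\<Prod>i\<in>A. x powi f i)"
  by (induction A rule: finite_induct) (auto simp: power_int_add)

lemma power_int_prod_base: "(\<Prod>i\<in>A. f i :: complex) powi n = (\<Prod>i\<in>A. f i powi n)"
  by (induction A rule: infinite_finite_induct) (auto simp: power_int_mult_distrib)

lemma lmon_tail:
  fixes u :: "(complex, 's::{finite,linorder}) vec"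
  assumes "\<And>j. u $ j \<noteq> 0"
  shows "lmon m u = (\<Prod>j\<in>UNIV. u $ j powi tail m j)"
proof -
  have "lmon m u = (\<Prod>i\<in>UNIV. \<Prod>j\<in>{j\<in>UNIV. j \<le> i}. u $ j powi m i)"
    by (simp add: lmon_def wcoord_def power_int_prod_base atMost_def)
  also have "\<dots> = (\<Prod>j\<in>UNIV. \<Prod>i\<in>{i\<in>UNIV. j \<le> i}. u $ j powi m i)"
    by (rule prod.swap_restrict) auto
  also have "\<dots> = (\<Prod>j\<in>UNIV. u $ j powi tail m j)"
    by (simp add: tail_def power_int_sum_exp assms atLeast_def)
  finally show ?thesis .
qed

lemma wcoord_nonzero: "u \<in> punct \<epsilon> \<Longrightarrow> wcoord u i \<noteq> 0"
  by (auto simp: wcoord_def punct_nonzero)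

lemma lmon_nonzero: "u \<in> punct \<epsilon> \<Longrightarrow> lmon m u \<noteq> 0"
  by (auto simp: lmon_def wcoord_nonzero)

lemma lmon_add: "u \<in> punct \<epsilon> \<Longrightarrow> lmon (\<lambda>i. m i + n i) u = lmon m u * lmon n u"
  by (simp add: lmon_def power_int_add wcoord_nonzero prod.distrib)

lemma tail_zero [simp]: "tail (\<lambda>_. 0) j = 0"
  by (simp add: tail_def)

lemma lmon_zero [simp]: "lmon (\<lambda>_. 0) u = 1"
  by (simp add: lmon_def)

lemma tail_add: "tail (\<lambda>i. m i + n i) j = tail m j + tail n j"
  by (simp add: tail_def sum.distrib)

text \<open>Such a monomial has no negative power of any u_j and a positive power of one of them.
  This smallness makes power series in the ratios b_i/b_e with i > e converge.\<close>

lemma norm_lmon_le: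
  fixes u :: "(complex, 's::{finite,linorder}) vec"
  assumes u: "u \<in> punct \<epsilon>" and \<epsilon>: "\<epsilon> \<le> 1" and nn: "\<And>j. 0 \<le> tail m j" and pos: "0 < tail m j"
  shows "norm (lmon m u) \<le> \<epsilon>"
proof -
  have le1: "norm (u $ i powi tail m i) \<le> 1" for i
  proof -
    have "norm (u $ i) < \<epsilon>" using u by (simp add: punct_def)
    then have "norm (u $ i) \<le> 1" using \<epsilon> by linarith
    then show ?thesis
      using nn[of i] by (simp add: power_int_def power_le_one Real_Vector_Spaces.norm_power)
  qed
  have "norm (u $ j powi tail m j) = norm (u $ j) ^ nat (tail m j)"
    using nn[of j] by (simp add: power_int_def Real_Vector_Spaces.norm_power)
  also have "\<dots> \<le> norm (u $ j) ^ 1"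
    by (rule power_decreasing) (use u \<epsilon> pos in \<open>auto simp: punct_def intro: less_imp_le less_le_trans\<close>)
  also have "\<dots> \<le> \<epsilon>"
    using u by (auto simp: punct_def intro: less_imp_le)
  finally have *: "norm (u $ j powi tail m j) \<le> \<epsilon>" .
  have "norm (lmon m u) = norm (u $ j powi tail m j) * (\<Prod>i\<in>UNIV-{j}. norm (u $ i powi tail m i))"
    using punct_nonzero[OF u] by (simp add: lmon_tail prod.remove[of UNIV j] norm_mult prod_norm)
  also have "\<dots> \<le> \<epsilon> * 1"
    by (intro mult_mono * prod_le_1) (use le1 order_trans[OF norm_ge_zero *] in \<open>auto intro: prod_nonneg\<close>)
  finally show ?thesis by simp
qed

text \<open>The second conjunct is what later controls signs of exponents: although fibres of
  \<open>\<mu>\<close> may be infinite, regrouping creates no exponent that was not present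
  before.\<close>

lemma lexp_regroup:
  fixes \<mu> :: "'i \<Rightarrow> 's::{finite,linorder} \<Rightarrow> int"
  assumes "\<epsilon> > 0"
    and sum: "\<And>u. u \<in> punct \<epsilon> \<Longrightarrow> ((\<lambda>x. c x * lmon (\<mu> x) u) has_sum F u) I"
    and N: "\<And>x j. x \<in> I \<Longrightarrow> c x \<noteq> 0 \<Longrightarrow> - int N \<le> tail (\<mu> x) j"
  shows "\<exists>k. lexp k F \<and> (\<forall>m. k m \<noteq> 0 \<longrightarrow> (\<exists>x\<in>I. \<mu> x = m \<and> c x \<noteq> 0))"
proof -
  define k where "k m = infsum c {x\<in>I. \<mu> x = m}" for m
  have k: "\<exists>x\<in>I. \<mu> x = m \<and> c x \<noteq> 0" if "k m \<noteq> 0" for m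
    using that infsum_0[of "{x\<in>I. \<mu> x = m}" c] unfolding k_def by blast
  have "lexp k F"
    unfolding lexp_def
  proof (intro exI[of _ \<epsilon>] exI[of _ N] conjI allI impI ballI)
    show "- int N \<le> tail m j" if "k m \<noteq> 0" for m j
      using k[OF that] N by auto
    show "((\<lambda>m. k m * lmon m u) has_sum F u) UNIV" if "u \<in> punct \<epsilon>" for u
      unfolding k_def by (rule has_sum_regroup[where P = "punct \<epsilon>"]) (use that sum lmon_nonzero in auto)
  qed (rule assms)
  then show ?thesis using k by blast
qed

lemma lexp_cong:
  assumes "lexp k F" and "\<delta> > 0" and "\<And>u. u \<in> punct \<delta> \<Longrightarrow> F u = G u"
  shows "lexp k G"
proof -
  from assms(1) obtain \<epsilon> N where "\<epsilon> > 0" and N: "\<forall>m. k m \<noteq> 0 \<longrightarrow> (\<forall>j. - int N \<le> tail m j)"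
    and h: "\<forall>u\<in>punct \<epsilon>. ((\<lambda>m. k m * lmon m u) has_sum F u) UNIV"
    unfolding lexp_def by auto
  show ?thesis unfolding lexp_def
    apply (rule exI[of _ "min \<epsilon> \<delta>"])
    using h assms(2,3) \<open>\<epsilon> > 0\<close> punct_mono[of "min \<epsilon> \<delta>"] N
    by (metis (no_types, lifting) min.cobounded1 min.cobounded2 min_less_iff_conj subset_iff)
qed

lemma lexp_add:
  assumes "lexp k F" and "lexp l G"
  shows "lexp (\<lambda>m. k m + l m) (\<lambda>u. F u + G u)"
proof -
  from assms(1) obtain \<epsilon> N where "\<epsilon> > 0" and N: "\<forall>m. k m \<noteq> 0 \<longrightarrow> (\<forall>j. - int N \<le> tail m j)"
    and h: "\<forall>u\<in>punct \<epsilon>. ((\<lambda>m. k m * lmon m u) has_sum F u) UNIV"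
    unfolding lexp_def by auto
  from assms(2) obtain \<delta> N' where "\<delta> > 0" and N': "\<forall>m. l m \<noteq> 0 \<longrightarrow> (\<forall>j. - int N' \<le> tail m j)"
    and h': "\<forall>u\<in>punct \<delta>. ((\<lambda>m. l m * lmon m u) has_sum G u) UNIV"
    unfolding lexp_def by auto
  show ?thesis unfolding lexp_def
  proof (intro exI[of _ "min \<epsilon> \<delta>"] exI[of _ "max N N'"] conjI allI impI ballI)
    show "min \<epsilon> \<delta> > 0" using \<open>\<epsilon> > 0\<close> \<open>\<delta> > 0\<close> by simp
    show "- int (max N N') \<le> tail m j" if "k m + l m \<noteq> 0" for m j
    proof -
      have "- int N \<le> tail m j \<or> - int N' \<le> tail m j"
        using that N N' by (cases "k m = 0") auto
      then show ?thesis by auto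
    qed
    show "((\<lambda>m. (k m + l m) * lmon m u) has_sum (F u + G u)) UNIV" if "u \<in> punct (min \<epsilon> \<delta>)" for u
      using has_sum_add[OF h[rule_format, of u] h'[rule_format, of u]] that
        punct_mono[of "min \<epsilon> \<delta>" \<epsilon>] punct_mono[of "min \<epsilon> \<delta>" \<delta>] by (auto simp: ring_distribs)
  qed
qed

lemma lexp_cmult:
  assumes "lexp k F"
  shows "lexp (\<lambda>m. c * k m) (\<lambda>u. c * F u)"
proof -
  from assms(1) obtain \<epsilon> N where "\<epsilon> > 0" and N: "\<forall>m. k m \<noteq> 0 \<longrightarrow> (\<forall>j. - int N \<le> tail m j)"
    and h: "\<forall>u\<in>punct \<epsilon>. ((\<lambda>m. k m * lmon m u) has_sum F u) UNIV"
    unfolding lexp_def by auto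
  show ?thesis unfolding lexp_def
    by (intro exI[of _ \<epsilon>] exI[of _ N] conjI)
       (use \<open>\<epsilon> > 0\<close> N has_sum_cmult_right[OF h[rule_format], of _ c] in \<open>auto simp: mult.assoc\<close>)
qed

lemma lexp_zero: "lexp (\<lambda>_. 0) (\<lambda>_. 0)"
  unfolding lexp_def by (auto intro!: exI[of _ 1])

text \<open>Unordered sums of complex numbers converge absolutely, so the double series does too and
  may be regrouped by the sum of the exponents. The conclusion keeps the support of the product,
  which is enough to track signs of exponents.\<close>

lemma lexp_mult:
  fixes F G :: "(complex, 's::{finite,linorder}) vec \<Rightarrow> complex"
  assumes "lexp k F" and "lexp l G"
  shows "\<exists>q. lexp q (\<lambda>u. F u * G u) \<and>
     (\<forall>m. q m \<noteq> 0 \<longrightarrow> (\<exists>m1 m2. m = (\<lambda>i. m1 i + m2 i) \<and> k m1 \<noteq> 0 \<and> l m2 \<noteq> 0))"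
proof -
  from assms(1) obtain \<epsilon> N where "\<epsilon> > 0" and N: "\<And>m j. k m \<noteq> 0 \<Longrightarrow> - int N \<le> tail m j"
    and h: "\<And>u. u\<in>punct \<epsilon> \<Longrightarrow> ((\<lambda>m. k m * lmon m u) has_sum F u) UNIV"
    unfolding lexp_def by blast
  from assms(2) obtain \<delta> N' where "\<delta> > 0" and N': "\<And>m j. l m \<noteq> 0 \<Longrightarrow> - int N' \<le> tail m j"
    and h': "\<And>u. u\<in>punct \<delta> \<Longrightarrow> ((\<lambda>m. l m * lmon m u) has_sum G u) UNIV"
    unfolding lexp_def by blast
  let ?c = "\<lambda>(m, n). k m * l n" and ?\<mu> = "\<lambda>(m, n) i. (m i + n i :: int)"
  have "\<exists>q. lexp q (\<lambda>u. F u * G u) \<and> (\<forall>m. q m \<noteq> 0 \<longrightarrow> (\<exists>x\<in>UNIV \<times> UNIV. ?\<mu> x = m \<and> ?c x \<noteq> 0))"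
  proof (rule lexp_regroup[of "min \<epsilon> \<delta>" ?c ?\<mu> _ _ "N + N'"])
    fix x :: "('s \<Rightarrow> int) \<times> ('s \<Rightarrow> int)" and j
    assume "?c x \<noteq> 0"
    then show "- int (N + N') \<le> tail (?\<mu> x) j"
      using N[of "fst x" j] N'[of "snd x" j] by (auto simp: tail_add case_prod_unfold)
  next
    fix u :: "(complex, 's) vec" assume u: "u \<in> punct (min \<epsilon> \<delta>)"
    then have u1: "u \<in> punct \<epsilon>" and u2: "u \<in> punct \<delta>"
      using punct_mono[of "min \<epsilon> \<delta>" \<epsilon>] punct_mono[of "min \<epsilon> \<delta>" \<delta>] by auto
    let ?f = "\<lambda>m. k m * lmon m u" and ?g = "\<lambda>m. l m * lmon m u"
    have "(\<lambda>m. norm (?f m)) summable_on UNIV" "(\<lambda>m. norm (?g m)) summable_on UNIV"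
      using h[OF u1] h'[OF u2] by (auto simp flip: summable_on_iff_abs_summable_on_complex intro: has_sum_imp_summable)
    then have "(\<lambda>p. norm (case p of (m, n) \<Rightarrow> ?f m * ?g n)) summable_on UNIV \<times> UNIV"
      by (intro summable_on_SigmaI[where g = "\<lambda>m. norm (?f m) * infsum (\<lambda>n. norm (?g n)) UNIV"]
            summable_on_cmult_left)
         (auto simp: norm_mult simp del: norm_lmon_le intro!: has_sum_cmult_right has_sum_infsum)
    then have "(\<lambda>(m, n). ?f m * ?g n) summable_on UNIV \<times> UNIV"
      by (rule abs_summable_summable)
    moreover have "((\<lambda>n. (case (m, n) of (m, n) \<Rightarrow> ?f m * ?g n)) has_sum ?f m * G u) UNIV" for m
      using has_sum_cmult_right[OF h'[OF u2]] by simp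
    ultimately have "((\<lambda>(m, n). ?f m * ?g n) has_sum F u * G u) (UNIV \<times> UNIV)"
      by (intro has_sum_SigmaI[where g = "\<lambda>m. ?f m * G u"] has_sum_cmult_left h u1)
    then show "((\<lambda>x. ?c x * lmon (?\<mu> x) u) has_sum F u * G u) (UNIV \<times> UNIV)"
      by (simp add: case_prod_unfold lmon_add[OF u1] mult_ac)
  qed (use \<open>\<epsilon> > 0\<close> \<open>\<delta> > 0\<close> in auto)
  then show ?thesis
    by (simp add: case_prod_unfold) (metis (no_types, lifting))
qed

section \<open>Substituting a small sum of monomials into a power series\<close>

lemma sum_prod_lists:
  fixes y :: "'s::finite \<Rightarrow> 'a::comm_semiring_1"
  shows "(\<Sum>xs | length xs = n. prod_list (map y xs)) = (\<Sum>i\<in>UNIV. y i) ^ n"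
proof (induction n)
  case (Suc n)
  have eq: "{xs::'s list. length xs = Suc n} = (\<lambda>(x, xs). x # xs) ` (UNIV \<times> {xs. length xs = n})"
    by (force simp: length_Suc_conv)
  have "(\<Sum>xs | length xs = Suc n. prod_list (map y xs)) =
      (\<Sum>(x, xs)\<in>UNIV \<times> {xs. length xs = n}. y x * prod_list (map y xs))"
    unfolding eq by (subst sum.reindex) (auto simp: inj_on_def case_prod_unfold)
  also have "\<dots> = (\<Sum>i\<in>UNIV. y i) * (\<Sum>xs | length xs = n. prod_list (map y xs))"
    by (simp add: sum_product sum.cartesian_product)
  finally show ?case using Suc by simp
qed simp

lemma finite_lists_length [simp]: "finite {xs::'s::finite list. length xs = n}"
  using finite_lists_length_eq[of "UNIV::'s set" n] by simp

text \<open>Words replace multi-indices, so that powers of a sum expand without multinomial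
  coefficients. Equal monomials coming from different words are merged later by regrouping.\<close>

lemma has_sum_lists:
  fixes y :: "'s::finite \<Rightarrow> complex" and a :: "nat \<Rightarrow> complex"
  assumes ps: "\<And>t. norm t < R \<Longrightarrow> (\<lambda>n. a n * t ^ n) sums g t"
    and y: "(\<Sum>i\<in>UNIV. norm (y i)) < R"
  shows "((\<lambda>xs. a (length xs) * prod_list (map y xs)) has_sum g (\<Sum>i\<in>UNIV. y i)) UNIV"
proof -
  let ?Y = "\<Sum>i\<in>UNIV. norm (y i)"
  let ?f = "\<lambda>(n, xs). a n * prod_list (map y xs)"
  \<comment> \<open>A radius strictly between the two gives absolute convergence at
    \<open>?Y\<close>, and the series there dominates the sum over words.\<close>
  obtain r where r: "?Y < r" "r < R" using y dense by blast
  have Y0: "0 \<le> ?Y" by (simp add: sum_nonneg)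
  have "summable (\<lambda>n. a n * of_real r ^ n)"
    using ps[of "of_real r"] r Y0 by (auto simp: sums_iff)
  from powser_insidea[OF this, of "of_real ?Y"] r Y0
  have sm: "summable (\<lambda>n. norm (a n) * ?Y ^ n)"
    by (simp add: norm_mult norm_power del: of_real_sum)
  have nprod: "norm (prod_list (map y xs)) = prod_list (map (\<lambda>i. norm (y i)) xs)" for xs
    by (induction xs) (auto simp: norm_mult)
  have inner: "((\<lambda>xs. norm (?f (n, xs))) has_sum norm (a n) * ?Y ^ n) {xs. length xs = n}" for n
    by (rule has_sum_finiteI) (auto simp: norm_mult nprod sum_prod_lists simp flip: sum_distrib_left)
  have "(\<lambda>p. norm (?f p)) summable_on Sigma UNIV (\<lambda>n. {xs. length xs = n})"
  proof (rule summable_on_SigmaI[where g = "\<lambda>n. norm (a n) * ?Y ^ n"])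
    show "(\<lambda>n. norm (a n) * ?Y ^ n) summable_on UNIV"
      by (rule norm_summable_imp_summable_on) (use sm Y0 in \<open>simp add: abs_mult\<close>)
  qed (use inner in auto)
  then have summ: "?f summable_on Sigma UNIV (\<lambda>n. {xs. length xs = n})"
    by (rule abs_summable_summable)
  have "norm (\<Sum>i\<in>UNIV. y i) \<le> ?Y" by (rule norm_sum)
  then have lt: "norm (\<Sum>i\<in>UNIV. y i) < R" using y by simp
  have "((\<lambda>n. a n * (\<Sum>i\<in>UNIV. y i) ^ n) has_sum g (\<Sum>i\<in>UNIV. y i)) UNIV"
  proof (rule norm_summable_imp_has_sum)
    show "summable (\<lambda>n. norm (a n * (\<Sum>i\<in>UNIV. y i) ^ n))"
      by (rule summable_comparison_test'[OF sm])
         (auto simp: norm_mult norm_power intro!: mult_left_mono power_mono norm_sum)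
  qed (rule ps[OF lt])
  then have "(?f has_sum g (\<Sum>i\<in>UNIV. y i)) (Sigma UNIV (\<lambda>n. {xs. length xs = n}))"
    by (intro has_sum_SigmaI[OF _ _ summ, where g = "\<lambda>n. a n * (\<Sum>i\<in>UNIV. y i) ^ n"])
       (auto intro!: has_sum_finiteI simp: sum_prod_lists simp flip: sum_distrib_left)
  moreover have "bij_betw (\<lambda>xs. (length xs, xs)) UNIV (Sigma UNIV (\<lambda>n. {xs. length xs = n}))"
    by (auto simp: bij_betw_def inj_on_def)
  ultimately show ?thesis
    using has_sum_reindex_bij_betw[of "\<lambda>xs. (length xs, xs)" UNIV _ ?f] by auto
qed

text \<open>Each monomial that occurs has a positive power of some u_j, so on a small polydisc the
  substituted sum stays in the disc of convergence. The exponent of a word is the sum of the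
  exponents of its letters, which gives the sign statement.\<close>

lemma lexp_compose:
  fixes c :: "'s::{finite,linorder} \<Rightarrow> complex" and \<mu> :: "'s \<Rightarrow> 's \<Rightarrow> int" and a :: "nat \<Rightarrow> complex"
  assumes ps: "\<And>t. norm t < R \<Longrightarrow> (\<lambda>n. a n * t ^ n) sums g t" and "R > 0"
    and nn: "\<And>i j. c i \<noteq> 0 \<Longrightarrow> 0 \<le> tail (\<mu> i) j"
    and pos: "\<And>i. c i \<noteq> 0 \<Longrightarrow> \<exists>j. 0 < tail (\<mu> i) j"
  shows "\<exists>k. lexp k (\<lambda>u. g (\<Sum>i\<in>UNIV. c i * lmon (\<mu> i) u)) \<and>
     (\<forall>m j. k m \<noteq> 0 \<longrightarrow> (\<forall>i. c i \<noteq> 0 \<longrightarrow> 0 \<le> \<mu> i j) \<longrightarrow> 0 \<le> m j)"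
proof -
  \<comment> \<open>The summand 1 keeps \<open>C\<close> positive even if all \<open>c i\<close>
    vanish; the factor 2 in \<open>\<epsilon>\<close> makes the final inequality strict.\<close>
  define C where "C = (\<Sum>i\<in>UNIV. norm (c i)) + 1"
  have C: "C > 0" unfolding C_def by (simp add: add_nonneg_pos sum_nonneg)
  define \<epsilon> where "\<epsilon> = min 1 (R / (2 * C))"
  have e: "\<epsilon> > 0" "\<epsilon> \<le> 1" "\<epsilon> * C < R"
  proof -
    show "\<epsilon> > 0" "\<epsilon> \<le> 1" using C \<open>R > 0\<close> by (auto simp: \<epsilon>_def)
    have "\<epsilon> * C \<le> R / (2 * C) * C" by (intro mult_right_mono) (use C in \<open>auto simp: \<epsilon>_def\<close>)
    then show "\<epsilon> * C < R" using C \<open>R > 0\<close> by simp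
  qed
  define L where "L xs = (\<lambda>j. \<Sum>i\<leftarrow>xs. \<mu> i j)" for xs
  have Lcons: "L (i # xs) = (\<lambda>j. \<mu> i j + L xs j)" for i xs by (auto simp: L_def)
  define d where "d xs = a (length xs) * prod_list (map c xs)" for xs
  have prodc: "prod_list (map c xs) \<noteq> 0 \<longleftrightarrow> (\<forall>i\<in>set xs. c i \<noteq> 0)" for xs
    by (induction xs) auto
  have "\<exists>k. lexp k (\<lambda>u. g (\<Sum>i\<in>UNIV. c i * lmon (\<mu> i) u)) \<and>
     (\<forall>m. k m \<noteq> 0 \<longrightarrow> (\<exists>xs\<in>UNIV. L xs = m \<and> d xs \<noteq> 0))"
  proof (rule lexp_regroup[OF e(1), where N = 0])
    fix u :: "(complex, 's) vec" assume u: "u \<in> punct \<epsilon>"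
    have le: "norm (c i * lmon (\<mu> i) u) \<le> norm (c i) * \<epsilon>" for i
    proof (cases "c i = 0")
      case False
      then obtain j where "0 < tail (\<mu> i) j" using pos by blast
      then show ?thesis
        using norm_lmon_le[OF u e(2) nn[OF False], of j] by (simp add: norm_mult mult_left_mono)
    qed simp
    have "(\<Sum>i\<in>UNIV. norm (c i * lmon (\<mu> i) u)) \<le> (\<Sum>i\<in>UNIV. norm (c i) * \<epsilon>)"
      by (intro sum_mono le)
    also have "\<dots> \<le> \<epsilon> * C"
      using e(1) by (simp add: C_def sum_distrib_left[symmetric] mult.commute[of _ \<epsilon>])
    finally have "(\<Sum>i\<in>UNIV. norm (c i * lmon (\<mu> i) u)) < R" using e(3) by simp
    from has_sum_lists[OF ps this]
    have "((\<lambda>xs. a (length xs) * prod_list (map (\<lambda>i. c i * lmon (\<mu> i) u) xs)) has_sum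
       g (\<Sum>i\<in>UNIV. c i * lmon (\<mu> i) u)) UNIV" .
    moreover have "prod_list (map (\<lambda>i. c i * lmon (\<mu> i) u) xs) = prod_list (map c xs) * lmon (L xs) u" for xs
      by (induction xs) (simp_all add: Lcons lmon_add[OF u], simp add: L_def)
    ultimately show "((\<lambda>xs. d xs * lmon (L xs) u) has_sum g (\<Sum>i\<in>UNIV. c i * lmon (\<mu> i) u)) UNIV"
      by (simp add: d_def mult.assoc)
  next
    fix xs j assume "d xs \<noteq> 0"
    then have "\<forall>i\<in>set xs. c i \<noteq> 0" using prodc by (auto simp: d_def)
    then have "0 \<le> tail (L xs) j"
    proof (induction xs)
      case Nil
      then show ?case by (simp add: L_def)
    next
      case (Cons i xs)
      then show ?case using nn[of i j] by (simp add: Lcons tail_add)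
    qed
    then show "- int 0 \<le> tail (L xs) j" by simp
  qed
  then obtain k where k: "lexp k (\<lambda>u. g (\<Sum>i\<in>UNIV. c i * lmon (\<mu> i) u))"
    "\<And>m. k m \<noteq> 0 \<Longrightarrow> \<exists>xs. L xs = m \<and> d xs \<noteq> 0" by auto
  have "0 \<le> m j" if "k m \<noteq> 0" "\<forall>i. c i \<noteq> 0 \<longrightarrow> 0 \<le> \<mu> i j" for m j
  proof -
    from k(2)[OF that(1)] obtain xs where xs: "L xs = m" "d xs \<noteq> 0" by blast
    then have "\<forall>i\<in>set xs. c i \<noteq> 0" using prodc by (auto simp: d_def)
    then have "0 \<le> L xs j" unfolding L_def using that(2) by (auto intro!: sum_list_nonneg)
    then show ?thesis using xs by simp
  qed
  then show ?thesis using k(1) by blast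
qed

section \<open>Uniqueness of coefficients of convergent power series\<close>

lemma power_series_zero:
  fixes a :: "nat \<Rightarrow> complex"
  assumes "r > 0" and z: "\<And>x. x \<noteq> 0 \<Longrightarrow> norm x < r \<Longrightarrow> (\<lambda>n. a n * x ^ n) sums 0"
  shows "a n = 0"
proof (induction n rule: less_induct)
  case (less n)
  \<comment> \<open>Once the lower coefficients vanish, division by x^n leaves a series whose limit
    at 0 is \<open>a n\<close>.\<close>
  have "(\<lambda>m. a (m + n) * x ^ m) sums 0" if "x \<noteq> 0" "norm x < r" for x
  proof -
    have "(\<lambda>m. a (m + n) * x ^ (m + n)) sums 0"
      using z[OF that] less by (subst sums_zero_iff_shift) auto
    from sums_mult[OF this, of "inverse (x ^ n)"] that show ?thesis
      by (simp add: power_add field_simps)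
  qed
  then have "((\<lambda>x::complex. 0) \<longlongrightarrow> a (0 + n)) (at 0)"
    using powser_limit_0_strong[OF \<open>r > 0\<close>, of "\<lambda>m. a (m + n)" "\<lambda>_. 0 :: complex"] by simp
  then show ?case
    by (simp add: tendsto_const_iff)
qed

abbreviation umon :: "('s::finite \<Rightarrow> nat) \<Rightarrow> (complex, 's) vec \<Rightarrow> complex" where
  "umon \<alpha> u \<equiv> \<Prod>i\<in>UNIV. (u $ i) ^ \<alpha> i"

text \<open>Convergence is given only where all coordinates are nonzero, so coefficients cannot be
  read off at 0. Instead the exponents are fixed one variable at a time, by rescaling a single
  coordinate; when all are fixed, one term remains.\<close>

lemma multi_power_series_zero:
  fixes k :: "('s::finite \<Rightarrow> nat) \<Rightarrow> complex"
  assumes "\<epsilon> > 0"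
    and z: "\<And>u. u \<in> punct \<epsilon> \<Longrightarrow> ((\<lambda>\<alpha>. k \<alpha> * umon \<alpha> u) has_sum 0) UNIV"
  shows "k \<alpha> = 0"
proof -
  have "((\<lambda>\<alpha>. k \<alpha> * umon \<alpha> u) has_sum 0) {\<alpha>. \<forall>i\<in>A. \<alpha> i = n i}"
    if "finite A" "u \<in> punct \<epsilon>" for A and n :: "'s \<Rightarrow> nat" and u
    using that
  proof (induction A arbitrary: n u rule: finite_induct)
    case empty
    then show ?case using z by simp
  next
    case (insert a A)
    let ?t = "\<lambda>u \<alpha>. k \<alpha> * umon \<alpha> u"
    let ?B = "\<lambda>p. {\<alpha>. (\<forall>i\<in>A. \<alpha> i = n i) \<and> \<alpha> a = p}"
    have summ: "?t u summable_on ?B p" for p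
      by (rule summable_on_subset_banach[OF has_sum_imp_summable[OF insert.IH[OF insert.prems]]]) auto
    \<comment> \<open>Scaling coordinate \<open>a\<close> by \<open>x\<close> multiplies the terms
      with \<alpha>_a = p by x^p, so these fibre sums are the coefficients of a power series in
      \<open>x\<close>.\<close>
    define s where "s p = infsum (?t u) (?B p)" for p
    have ua: "u $ a \<noteq> 0" using insert.prems punct_nonzero by blast
    have "(\<lambda>p. s p * x ^ p) sums 0" if "x \<noteq> 0" "norm x < \<epsilon> / norm (u $ a)" for x
    proof -
      define v where "v = (\<chi> i. if i = a then x * u $ a else u $ i)"
      have v: "v \<in> punct \<epsilon>"
        using insert.prems that ua by (auto simp: punct_def v_def norm_mult field_simps)
      have tv: "?t v \<alpha> = ?t u \<alpha> * x ^ \<alpha> a" for \<alpha>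
      proof -
        have "umon \<alpha> v = (x * u $ a) ^ \<alpha> a * (\<Prod>i\<in>UNIV-{a}. (u $ i) ^ \<alpha> i)"
          by (subst prod.remove[of _ a]) (auto simp: v_def)
        also have "\<dots> = x ^ \<alpha> a * umon \<alpha> u"
          by (subst (2) prod.remove[of _ a]) (auto simp: power_mult_distrib)
        finally show ?thesis by simp
      qed
      have bij: "bij_betw (\<lambda>\<alpha>. (\<alpha> a, \<alpha>)) {\<alpha>. \<forall>i\<in>A. \<alpha> i = n i} (Sigma UNIV ?B)"
        by (auto simp: bij_betw_def inj_on_def)
      have "((\<lambda>(p, \<alpha>). ?t v \<alpha>) has_sum 0) (Sigma UNIV ?B)"
        using has_sum_reindex_bij_betw[OF bij, of "\<lambda>(p, \<alpha>). ?t v \<alpha>" 0] insert.IH[OF v, of n] by simp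
      moreover have "((\<lambda>\<alpha>. ?t v \<alpha>) has_sum s p * x ^ p) (?B p)" for p
      proof -
        have "((\<lambda>\<alpha>. ?t u \<alpha> * x ^ p) has_sum s p * x ^ p) (?B p)"
          unfolding s_def by (intro has_sum_cmult_left has_sum_infsum summ)
        then show ?thesis by (rule has_sum_cong[THEN iffD1, rotated]) (simp add: tv)
      qed
      ultimately have "((\<lambda>p. s p * x ^ p) has_sum 0) UNIV"
        by (intro has_sum_SigmaD[where f = "\<lambda>(p, \<alpha>). ?t v \<alpha>" and B = ?B]) simp_all
      then show ?thesis by (rule has_sum_imp_sums)
    qed
    then have "s (n a) = 0"
      using \<open>\<epsilon> > 0\<close> ua by (intro power_series_zero[of "\<epsilon> / norm (u $ a)" s]) simp_all
    moreover have "?B (n a) = {\<alpha>. \<forall>i\<in>insert a A. \<alpha> i = n i}" by auto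
    ultimately show ?case
      using has_sum_infsum[OF summ[of "n a"]] by (simp add: s_def)
  qed
  from this[of UNIV "\<chi> i. of_real (\<epsilon> / 2)" \<alpha>] \<open>\<epsilon> > 0\<close>
  have "((\<lambda>\<alpha>. k \<alpha> * (\<Prod>i\<in>UNIV. (of_real (\<epsilon> / 2)) ^ \<alpha> i)) has_sum 0) {\<alpha>}"
    by (simp add: punct_def fun_eq_iff[symmetric])
  moreover have "((\<lambda>\<alpha>. k \<alpha> * (\<Prod>i\<in>UNIV. (of_real (\<epsilon> / 2)) ^ \<alpha> i)) has_sum
     k \<alpha> * (\<Prod>i\<in>UNIV. (of_real (\<epsilon> / 2)) ^ \<alpha> i)) {\<alpha>}"
    by (rule has_sum_finiteI) auto
  ultimately have "k \<alpha> * (\<Prod>i\<in>UNIV. (of_real (\<epsilon> / 2)) ^ \<alpha> i) = 0"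
    by (rule has_sum_unique[symmetric])
  then show ?thesis using \<open>\<epsilon> > 0\<close> by simp
qed

section \<open>Coordinates and germs with poles on hyperplanes\<close>

lemma
  assumes "family_basis c"
  shows coord_add: "coord c (v + w) i = coord c v i + coord c w i"
    and coord_scale: "coord c (r *\<^sub>R v) i = r * coord c v i"
    and coord_basis: "coord c (c j) i = (if i = j then 1 else 0)"
  using assms
  by (auto simp: coord_def family_basis_def representation_add representation_scale
      representation_basis inj_eq)

lemma coord_zero [simp]: "coord c 0 i = 0"
  by (simp add: coord_def representation_zero)

lemma coord_minus: "family_basis c \<Longrightarrow> coord c (- v) i = - coord c v i"
  using coord_scale[of c "-1" v i] by simp

lemma coord_sum:
  assumes "family_basis c"
  shows "coord c (\<Sum>x\<in>A. f x) i = (\<Sum>x\<in>A. coord c (f x) i)"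
  by (induction A rule: infinite_finite_induct) (simp_all add: coord_add[OF assms])

lemma family_basis_expand:
  fixes c :: "'s::finite \<Rightarrow> 'v::real_vector"
  assumes "family_basis c"
  shows "(\<Sum>i\<in>UNIV. coord c v i *\<^sub>R c i) = v"
proof -
  have "(\<Sum>b\<in>range c. representation (range c) v b *\<^sub>R b) = v"
    using assms by (intro sum_representation_eq) (auto simp: family_basis_def)
  then show ?thesis
    using assms by (simp add: coord_def family_basis_def sum.reindex)
qed

lemma coord_combination:
  assumes "family_basis c"
  shows "coord c (\<Sum>j\<in>UNIV. x j *\<^sub>R c j) i = x i"
  by (simp add: coord_sum coord_scale coord_basis assms if_distrib cong: if_cong)

lemma
  assumes "family_basis \<beta>"
  shows pairing_add: "pairing \<beta> z (v + w) = pairing \<beta> z v + pairing \<beta> z w"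
    and pairing_scale: "pairing \<beta> z (r *\<^sub>R v) = of_real r * pairing \<beta> z v"
    and pairing_basis: "pairing \<beta> z (\<beta> i) = z $ i"
  by (simp_all add: pairing_def coord_add coord_scale coord_basis assms ring_distribs sum.distrib
      sum_distrib_left mult_ac if_distrib if_distribR cong: if_cong)

lemma pairing_sum:
  assumes "family_basis \<beta>"
  shows "pairing \<beta> z (\<Sum>x\<in>A. f x) = (\<Sum>x\<in>A. pairing \<beta> z (f x))"
proof (induction A rule: infinite_finite_induct)
  case empty
  then show ?case by (simp add: pairing_def)
next
  case (infinite A)
  then show ?case by (simp add: pairing_def)
qed (simp add: pairing_add[OF assms])

lemma pairing_add_left: "pairing \<beta> (z + z') v = pairing \<beta> z v + pairing \<beta> z' v"
  by (simp add: pairing_def ring_distribs sum.distrib)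

lemma pairing_axis: "pairing \<beta> (axis i t) v = of_real (coord \<beta> v i) * t"
  by (simp add: pairing_def axis_def if_distrib cong: if_cong)

lemma pairing_expand:
  assumes "family_basis \<beta>" and "family_basis c"
  shows "pairing \<beta> z v = (\<Sum>i\<in>UNIV. of_real (coord c v i) * pairing \<beta> z (c i))"
proof -
  have "pairing \<beta> z v = pairing \<beta> z (\<Sum>i\<in>UNIV. coord c v i *\<^sub>R c i)"
    by (simp add: family_basis_expand[OF assms(2)])
  then show ?thesis
    by (simp add: pairing_sum pairing_scale assms)
qed

context
  fixes \<beta> c :: "'s::{finite,linorder} \<Rightarrow> 'v::real_vector"
  assumes \<beta>: "family_basis \<beta>" and c: "family_basis c"
begin

text \<open>The coordinate matrices between the two bases are inverse to each other; this solves the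
  linear system that defines \<open>substitution\<close>.\<close>

lemma pairing_of_coordinates:
  fixes w :: "'s \<Rightarrow> complex"
  shows "pairing \<beta> (\<chi> j. \<Sum>i\<in>UNIV. of_real (coord c (\<beta> j) i) * w i) (c k) = w k" (is "?lhs = _")
proof -
  have "?lhs = (\<Sum>i\<in>UNIV. of_real (coord c (\<Sum>j\<in>UNIV. coord \<beta> (c k) j *\<^sub>R \<beta> j) i) * w i)"
    by (simp add: pairing_def coord_sum[OF c] coord_scale[OF c] sum_distrib_left sum_distrib_right
        mult_ac) (subst sum.swap, simp)
  also have "\<dots> = w k"
    by (simp add: family_basis_expand[OF \<beta>] coord_basis[OF c] if_distrib if_distribR cong: if_cong)
  finally show ?thesis .
qed

lemma substitution_eq:
  shows "substitution \<beta> c u = (\<chi> j. \<Sum>i\<in>UNIV. of_real (coord c (\<beta> j) i) * wcoord u i)"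
  unfolding substitution_def wcoord_def[symmetric]
proof (intro the_equality allI)
  show "z = (\<chi> j. \<Sum>i\<in>UNIV. of_real (coord c (\<beta> j) i) * wcoord u i)"
    if "\<forall>i. pairing \<beta> z (c i) = wcoord u i" for z
    using pairing_expand[OF \<beta> c, of z "\<beta> _"] that by (simp add: vec_eq_iff pairing_basis[OF \<beta>])
qed (rule pairing_of_coordinates)

lemma pairing_substitution_basis:
  shows "pairing \<beta> (substitution \<beta> c u) (c k) = wcoord u k"
  by (simp add: substitution_eq pairing_of_coordinates)

lemma pairing_substitution:
  shows "pairing \<beta> (substitution \<beta> c u) a = (\<Sum>i\<in>UNIV. of_real (coord c a i) * wcoord u i)"
  by (simp add: pairing_expand[OF \<beta> c, of _ a] pairing_substitution_basis)

end

section \<open>Germs at the origin and their derivatives\<close>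

definition pole_free :: "('s::finite \<Rightarrow> 'v::real_vector) \<Rightarrow> 'v set \<Rightarrow> real \<Rightarrow> (complex, 's) vec set" where
  "pole_free \<beta> S r = {z. norm z < r \<and> (\<forall>a\<in>S. pairing \<beta> z a \<noteq> 0)}"

lemma pole_free_mono: "r \<le> r' \<Longrightarrow> S' \<subseteq> S \<Longrightarrow> pole_free \<beta> S r \<subseteq> pole_free \<beta> S' r'"
  by (auto simp: pole_free_def)

text \<open>A class of germs at the origin that contains all the functions occurring below and is
  visibly closed under differentiation.\<close>

inductive germ :: "('s::finite \<Rightarrow> 'v::real_vector) \<Rightarrow> 'v set \<Rightarrow> ((complex, 's) vec \<Rightarrow> complex) \<Rightarrow> bool"
  for \<beta> S where
  germ_comp: "0 < R \<Longrightarrow> g holomorphic_on ball 0 R \<Longrightarrow> germ \<beta> S (\<lambda>z. g (\<Sum>i\<in>UNIV. d i * z $ i))"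
| germ_inverse: "a \<in> S \<Longrightarrow> germ \<beta> S (\<lambda>z. inverse (pairing \<beta> z a))"
| germ_add: "germ \<beta> S F \<Longrightarrow> germ \<beta> S G \<Longrightarrow> germ \<beta> S (\<lambda>z. F z + G z)"
| germ_mult: "germ \<beta> S F \<Longrightarrow> germ \<beta> S G \<Longrightarrow> germ \<beta> S (\<lambda>z. F z * G z)"
| germ_cong: "germ \<beta> S F \<Longrightarrow> 0 < r \<Longrightarrow> (\<And>z. z \<in> pole_free \<beta> S r \<Longrightarrow> F z = G z) \<Longrightarrow> germ \<beta> S G"

lemma germ_mono: "germ \<beta> S F \<Longrightarrow> S \<subseteq> T \<Longrightarrow> germ \<beta> T F"
proof (induction rule: germ.induct)
  case (germ_cong F r G)
  then show ?case
    using pole_free_mono[of r r S T \<beta>] by (intro germ.germ_cong[of \<beta> T F r G]) auto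
qed (auto intro: germ.intros)

lemma germ_const: "germ \<beta> S (\<lambda>_. x)"
  using germ_comp[of 1 "\<lambda>_. x"] by simp

lemma germ_pairing_comp: "0 < R \<Longrightarrow> g holomorphic_on ball 0 R \<Longrightarrow> germ \<beta> S (\<lambda>z. g (pairing \<beta> z a))"
  unfolding pairing_def by (rule germ_comp)

lemma germ_coordinate: "germ \<beta> S (\<lambda>z. z $ i)"
  using germ_comp[of 1 "\<lambda>t. t" \<beta> S "\<lambda>j. if j = i then 1 else 0"]
  by (simp add: if_distrib if_distribR cong: if_cong)

lemma germ_cmult: "germ \<beta> S F \<Longrightarrow> germ \<beta> S (\<lambda>z. x * F z)"
  by (intro germ_mult germ_const)

lemma germ_sum: "(\<And>x. x \<in> A \<Longrightarrow> germ \<beta> S (F x)) \<Longrightarrow> germ \<beta> S (\<lambda>z. \<Sum>x\<in>A. F x z)"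
  by (induction A rule: infinite_finite_induct) (auto intro: germ_const germ_add)

lemma germ_prod: "(\<And>x. x \<in> A \<Longrightarrow> germ \<beta> S (F x)) \<Longrightarrow> germ \<beta> S (\<lambda>z. \<Prod>x\<in>A. F x z)"
  by (induction A rule: infinite_finite_induct) (auto intro: germ_const germ_mult)

lemma germ_power: "germ \<beta> S F \<Longrightarrow> germ \<beta> S (\<lambda>z. F z ^ n)"
  by (induction n) (auto intro: germ_const germ_mult)

lemma axis_0 [simp]: "axis i 0 = 0"
  by (simp add: axis_def vec_eq_iff)

lemma tendsto_add_axis: "((\<lambda>t. z + axis i t) \<longlongrightarrow> z) (at (0::complex))"
proof (rule vec_tendstoI)
  fix j
  have "((\<lambda>t. z $ j + (if j = i then t else 0)) \<longlongrightarrow> z $ j + (if j = i then 0 else 0)) (at 0)"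
    by (cases "j = i") (auto intro: tendsto_add[OF tendsto_const tendsto_ident_at, of "z $ i" 0, simplified])
  then show "((\<lambda>t. (z + axis i t) $ j) \<longlongrightarrow> z $ j) (at 0)"
    by (simp add: axis_def)
qed

lemma continuous_on_pairing: "continuous_on A (\<lambda>z. pairing \<beta> z a)"
  unfolding pairing_def by (intro continuous_intros)

lemma open_pole_free: "finite S \<Longrightarrow> open (pole_free \<beta> S r)"
proof -
  assume "finite S"
  have "pole_free \<beta> S r = ball 0 r \<inter> (\<Inter>a\<in>S. {z. pairing \<beta> z a \<noteq> 0})"
    by (auto simp: pole_free_def)
  moreover have "open {z. pairing \<beta> z a \<noteq> 0}" for a
    by (intro open_Collect_neq continuous_on_pairing continuous_intros)
  ultimately show ?thesis using \<open>finite S\<close> by (simp add: open_Int open_INT)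
qed

lemma eventually_pole_free:
  assumes "finite S" and "z \<in> pole_free \<beta> S r"
  shows "eventually (\<lambda>t. z + axis i t \<in> pole_free \<beta> S r) (nhds (0::complex))"
proof -
  have "eventually (\<lambda>t. z + axis i t \<in> pole_free \<beta> S r) (at (0::complex))"
    by (rule topological_tendstoD[OF tendsto_add_axis open_pole_free]) (use assms in auto)
  moreover have "z + axis i 0 \<in> pole_free \<beta> S r"
    using assms by simp
  ultimately show ?thesis by (simp add: eventually_nhds_conv_at)
qed

abbreviation has_partial :: "'s::finite \<Rightarrow> ((complex, 's) vec \<Rightarrow> complex) \<Rightarrow> complex \<Rightarrow> (complex, 's) vec \<Rightarrow> bool"
  where "has_partial i F d z \<equiv> ((\<lambda>t. F (z + axis i t)) has_field_derivative d) (at 0)"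

text \<open>Differentiability and closure of the class are proved together, because
  \<open>partial\<close> is defined by \<open>deriv\<close> and has a meaningful value only where
  the function is differentiable. Finiteness of \<open>S\<close> makes the domain open, so that in
  the congruence case the two functions agree near each of its points.\<close>

lemma germ_has_derivative:
  assumes "germ \<beta> S F" and "finite S"
  shows "\<exists>r>0. \<exists>F'. germ \<beta> S F' \<and>
     (\<forall>z\<in>pole_free \<beta> S r. has_partial i F (F' z) z)"
  using assms(1)
proof (induction rule: germ.induct)
  case (germ_comp R g d)
  \<comment> \<open>On the ball of radius \<open>R / C\<close> the linear form stays in the disc of
    \<open>g\<close>; the summand 1 avoids division by 0.\<close>
  define C where "C = (\<Sum>i\<in>UNIV. norm (d i)) + 1"
  have C: "C > 0" by (simp add: C_def add_nonneg_pos sum_nonneg)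
  let ?F' = "\<lambda>z. d i * deriv g (\<Sum>j\<in>UNIV. d j * z $ j)"
  have "germ \<beta> S ?F'"
    by (intro germ_cmult germ.germ_comp[OF germ_comp(1)] holomorphic_deriv germ_comp) auto
  moreover have "((\<lambda>t. g (\<Sum>j\<in>UNIV. d j * (z + axis i t) $ j)) has_field_derivative ?F' z) (at 0)"
    if "z \<in> pole_free \<beta> S (R / C)" for z
  proof -
    let ?s = "\<Sum>j\<in>UNIV. d j * z $ j"
    have eq: "(\<Sum>j\<in>UNIV. d j * (z + axis i t) $ j) = ?s + d i * t" for t
    proof -
      have "(\<Sum>j\<in>UNIV. d j * axis i t $ j) = d i * t"
        by (simp add: axis_def if_distrib cong: if_cong)
      then show ?thesis by (simp add: ring_distribs sum.distrib)
    qed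
    have "norm ?s \<le> (\<Sum>j\<in>UNIV. norm (d j) * norm z)"
      by (rule order_trans[OF norm_sum]) (auto simp: norm_mult intro!: sum_mono mult_left_mono Finite_Cartesian_Product.norm_nth_le)
    also have "\<dots> \<le> C * norm z"
      by (simp add: C_def sum_distrib_right[symmetric] mult_right_mono)
    also have "\<dots> < R"
      using that C by (simp add: pole_free_def field_simps)
    finally have "(g has_field_derivative deriv g ?s) (at ?s)"
      using germ_comp by (intro holomorphic_derivI[of g "ball 0 R"]) auto
    then have "(g has_field_derivative deriv g ?s) (at (?s + d i * 0))"
      by simp
    moreover have "((\<lambda>t. ?s + d i * t) has_field_derivative d i) (at 0)"
      by (auto intro!: derivative_eq_intros)
    ultimately have "((\<lambda>t. g (?s + d i * t)) has_field_derivative deriv g ?s * d i) (at 0)"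
      by (rule DERIV_chain'[rotated])
    then show ?thesis by (simp only: eq mult.commute[of "d i"])
  qed
  moreover have "R / C > 0" using C germ_comp(1) by simp
  ultimately show ?case by blast
next
  case (germ_inverse a)
  let ?F' = "\<lambda>z. (- of_real (coord \<beta> a i)) * (inverse (pairing \<beta> z a) * inverse (pairing \<beta> z a))"
  have "germ \<beta> S ?F'"
    by (intro germ_cmult germ_mult germ.germ_inverse germ_inverse)
  moreover have "((\<lambda>t. inverse (pairing \<beta> (z + axis i t) a)) has_field_derivative ?F' z) (at 0)"
    if "z \<in> pole_free \<beta> S 1" for z
    using that germ_inverse
    by (auto simp: pairing_add_left pairing_axis pole_free_def field_simps intro!: derivative_eq_intros)
  ultimately show ?case by (intro exI[of _ 1]) auto
next
  case (germ_add F G)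
  then obtain r F' r' G' where *: "r > 0" "r' > 0" "germ \<beta> S F'" "germ \<beta> S G'"
    "\<forall>z\<in>pole_free \<beta> S r. has_partial i F (F' z) z"
    "\<forall>z\<in>pole_free \<beta> S r'. has_partial i G (G' z) z"
    by blast
  show ?case
    by (intro exI[of _ "min r r'"] exI[of _ "\<lambda>z. F' z + G' z"] conjI germ.germ_add ballI DERIV_add)
       (use * in \<open>auto simp: pole_free_def\<close>)
next
  case (germ_mult F G)
  then obtain r F' r' G' where *: "r > 0" "r' > 0" "germ \<beta> S F'" "germ \<beta> S G'"
    "\<forall>z\<in>pole_free \<beta> S r. has_partial i F (F' z) z"
    "\<forall>z\<in>pole_free \<beta> S r'. has_partial i G (G' z) z"
    by blast
  show ?case
  proof (intro exI[of _ "min r r'"] exI[of _ "\<lambda>z. F' z * G z + G' z * F z"] conjI ballI)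
    show "germ \<beta> S (\<lambda>z. F' z * G z + G' z * F z)"
      by (intro germ.germ_add germ.germ_mult * germ_mult)
    fix z assume "z \<in> pole_free \<beta> S (min r r')"
    then have "z \<in> pole_free \<beta> S r" "z \<in> pole_free \<beta> S r'" by (auto simp: pole_free_def)
    from DERIV_mult[OF *(5)[rule_format, OF this(1)] *(6)[rule_format, OF this(2)]]
    show "((\<lambda>t. F (z + axis i t) * G (z + axis i t)) has_field_derivative F' z * G z + G' z * F z) (at 0)"
      by simp
  qed (use * in auto)
next
  case (germ_cong F r G)
  then obtain r' F' where *: "r' > 0" "germ \<beta> S F'"
    "\<forall>z\<in>pole_free \<beta> S r'. has_partial i F (F' z) z"
    by blast
  show ?case
  proof (intro exI[of _ "min r r'"] exI[of _ F'] conjI ballI)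
    fix z assume z: "z \<in> pole_free \<beta> S (min r r')"
    have "eventually (\<lambda>t. F (z + axis i t) = G (z + axis i t)) (nhds 0)"
      using eventually_pole_free[OF \<open>finite S\<close> z, of i]
      by eventually_elim (use germ_cong in \<open>auto simp: pole_free_def\<close>)
    moreover have "has_partial i F (F' z) z"
      using *(3) z by (auto simp: pole_free_def)
    ultimately show "has_partial i G (F' z) z"
      by (subst (asm) DERIV_cong_ev[OF refl _ refl]) auto
  qed (use * germ_cong in auto)
qed

lemma germ_partial:
  assumes "germ \<beta> S F" and "finite S"
  shows "germ \<beta> S (partial i F)"
proof -
  from germ_has_derivative[OF assms, of i] obtain r F' where *: "r > 0" "germ \<beta> S F'"
    "\<forall>z\<in>pole_free \<beta> S r. has_partial i F (F' z) z"
    by blast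
  show ?thesis
    by (rule germ_cong[OF *(2,1)]) (use *(3) in \<open>auto simp: partial_def DERIV_imp_deriv\<close>)
qed

lemma germ_partial_deriv:
  assumes "germ \<beta> S F" and "finite S"
  shows "\<exists>r>0. \<forall>z\<in>pole_free \<beta> S r. has_partial i F (partial i F z) z"
  using germ_has_derivative[OF assms, of i] by (metis DERIV_imp_deriv partial_def)

lemma partial_cong:
  assumes "finite S" and "z \<in> pole_free \<beta> S r" and "\<And>z. z \<in> pole_free \<beta> S r \<Longrightarrow> F z = G z"
  shows "partial i F z = partial i G z"
  unfolding partial_def
  by (rule deriv_cong_ev[OF eventually_mono[OF eventually_pole_free[OF assms(1,2)]] refl]) (rule assms(3))

text \<open>The least index occurring in \<open>a\<close>: the linear form \<open>a\<close> becomes $u_1\cdots u_{\mathrm{lead}}$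
  times a unit, so inverting it makes only the exponent of $b_{\mathrm{lead}}$ negative.\<close>

definition lead :: "('s::{finite,linorder} \<Rightarrow> 'v::real_vector) \<Rightarrow> 'v \<Rightarrow> 's" where
  "lead c a = Min {i. coord c a i \<noteq> 0}"

lemma
  assumes "family_basis c" and "a \<noteq> 0"
  shows coord_lead: "coord c a (lead c a) \<noteq> 0"
    and coord_below_lead: "i < lead c a \<Longrightarrow> coord c a i = 0"
proof -
  have ne: "{i. coord c a i \<noteq> 0} \<noteq> {}"
  proof
    assume "{i. coord c a i \<noteq> 0} = {}"
    then have "(\<Sum>i\<in>UNIV. coord c a i *\<^sub>R c i) = 0" by simp
    then show False using family_basis_expand[OF assms(1), of a] assms(2) by simp
  qed
  from Min_in[OF _ ne] show "coord c a (lead c a) \<noteq> 0" by (simp add: lead_def)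
  show "coord c a i = 0" if "i < lead c a"
  proof (rule ccontr)
    assume "coord c a i \<noteq> 0"
    then have "lead c a \<le> i" unfolding lead_def by (intro Min_le) auto
    then show False using that by simp
  qed
qed

definition unit_exp :: "'s \<Rightarrow> 's \<Rightarrow> int" where
  "unit_exp i j = (if j = i then 1 else 0)"

lemma lmon_unit: "lmon (unit_exp i) u = wcoord u i"
  unfolding lmon_def unit_exp_def by (subst prod.remove[of _ i]) auto

lemma tail_unit: "tail (unit_exp i) j = (if j \<le> i then 1 else 0)"
  by (simp add: tail_def unit_exp_def)

lemma wcoord_le:
  assumes "u \<in> punct \<epsilon>" and "\<epsilon> \<le> 1"
  shows "norm (wcoord u i) \<le> \<epsilon>"
  using norm_lmon_le[OF assms, of "unit_exp i" i] by (simp add: tail_unit lmon_unit)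

context
  fixes \<beta> c :: "'s::{finite,linorder} \<Rightarrow> 'v::real_vector"
  assumes \<beta>: "family_basis \<beta>" and c: "family_basis c"
begin

text \<open>On the punctured polydisc the ratios of later to earlier coordinates are small, so that a
  linear form is dominated by its leading term.\<close>

lemma linear_form_factor:
  assumes a: "a \<noteq> 0"
  shows "\<exists>(q :: 's \<Rightarrow> complex) (\<mu> :: 's \<Rightarrow> 's \<Rightarrow> int).
    (\<forall>i. q i \<noteq> 0 \<longrightarrow> (\<forall>j. 0 \<le> tail (\<mu> i) j) \<and> (\<exists>j. 0 < tail (\<mu> i) j) \<and>
      (\<forall>j. j \<noteq> lead c a \<longrightarrow> 0 \<le> \<mu> i j)) \<and>
    (\<forall>u \<epsilon>. u \<in> punct \<epsilon> \<longrightarrow> pairing \<beta> (substitution \<beta> c u) a =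
      of_real (coord c a (lead c a)) * wcoord u (lead c a) * (1 + (\<Sum>i\<in>UNIV. q i * lmon (\<mu> i) u)))"
proof -
  let ?e = "lead c a"
  define q :: "'s \<Rightarrow> complex" where "q i = (if ?e < i then of_real (coord c a i / coord c a ?e) else 0)" for i
  \<comment> \<open>The exponent of b_i/b_e. For i > e this ratio is the product of the u_j with e <
    j \<le> i, hence small.\<close>
  define \<mu> where "\<mu> i j = unit_exp i j + - unit_exp ?e j" for i j
  have tl: "tail (\<mu> i) j = (if j \<le> i then 1 else 0) - (if j \<le> ?e then 1 else 0)" for i j
  proof -
    have "tail (\<mu> i) j = tail (unit_exp i) j + tail (\<lambda>j. - unit_exp ?e j) j"
      unfolding \<mu>_def by (rule tail_add)
    also have "tail (\<lambda>j. - unit_exp ?e j) j = - tail (unit_exp ?e) j"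
      by (simp add: tail_def sum_negf)
    finally show ?thesis by (simp add: tail_unit)
  qed
  show ?thesis
  proof (intro exI[of _ q] exI[of _ \<mu>] conjI allI impI)
    fix i assume "q i \<noteq> 0"
    then have "?e < i" by (auto simp: q_def split: if_splits)
    then show "0 \<le> tail (\<mu> i) j" and "\<exists>j. 0 < tail (\<mu> i) j" and "j \<noteq> ?e \<Longrightarrow> 0 \<le> \<mu> i j" for j
      by (auto simp: tl \<mu>_def unit_exp_def intro!: exI[of _ i])
  next
    fix u :: "(complex, 's) vec" and \<epsilon> assume u: "u \<in> punct \<epsilon>"
    have "lmon (\<mu> i) u * wcoord u ?e = wcoord u i" for i
    proof -
      have "lmon (\<lambda>j. \<mu> i j + unit_exp ?e j) u = lmon (\<mu> i) u * wcoord u ?e"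
        by (simp add: lmon_add[OF u] lmon_unit)
      moreover have "(\<lambda>j. \<mu> i j + unit_exp ?e j) = unit_exp i" by (simp add: \<mu>_def)
      ultimately show ?thesis by (simp add: lmon_unit)
    qed
    then have "of_real (coord c a ?e) * wcoord u ?e * (q i * lmon (\<mu> i) u) =
        of_real (coord c a ?e) * q i * wcoord u i" for i
      by (metis mult.assoc mult.commute)
    then have "of_real (coord c a ?e) * wcoord u ?e * (\<Sum>i\<in>UNIV. q i * lmon (\<mu> i) u) =
        (\<Sum>i\<in>UNIV. of_real (coord c a ?e) * q i * wcoord u i)"
      unfolding sum_distrib_left by (intro sum.cong refl)
    also have "\<dots> = (\<Sum>i\<in>UNIV-{?e}. of_real (coord c a i) * wcoord u i)"
    proof -
      have "of_real (coord c a ?e) * q i = of_real (coord c a i)" if "i \<noteq> ?e" for i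
        using that coord_lead[OF c a] coord_below_lead[OF c a, of i] by (auto simp: q_def)
      then show ?thesis
        by (subst sum.remove[of _ ?e]) (auto simp: q_def)
    qed
    finally show "pairing \<beta> (substitution \<beta> c u) a =
        of_real (coord c a ?e) * wcoord u ?e * (1 + (\<Sum>i\<in>UNIV. q i * lmon (\<mu> i) u))"
      by (simp add: pairing_substitution[OF \<beta> c] sum.remove[of _ ?e] ring_distribs)
  qed
qed

text \<open>In the factored form the leading monomial is nonzero, and radius \<open>1 / C\<close>
  bounds the correction to the unit by (C - 1)/C < 1.\<close>

lemma pairing_substitution_nonzero:
  assumes a: "a \<noteq> 0"
  shows "\<exists>\<delta>>0. \<forall>u\<in>punct \<delta>. pairing \<beta> (substitution \<beta> c u) a \<noteq> 0"
proof -
  obtain q :: "'s \<Rightarrow> complex" and \<mu> :: "'s \<Rightarrow> 's \<Rightarrow> int" where q0: "\<forall>i. q i \<noteq> 0 \<longrightarrow> (\<forall>j. 0 \<le> tail (\<mu> i) j) \<and> (\<exists>j. 0 < tail (\<mu> i) j) \<and>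
      (\<forall>j. j \<noteq> lead c a \<longrightarrow> 0 \<le> \<mu> i j)"
    and f0: "\<forall>u \<epsilon>. u \<in> punct \<epsilon> \<longrightarrow> pairing \<beta> (substitution \<beta> c u) a =
      of_real (coord c a (lead c a)) * wcoord u (lead c a) * (1 + (\<Sum>i\<in>UNIV. q i * lmon (\<mu> i) u))"
    using linear_form_factor[OF a] by blast
  note q = q0[rule_format] and f = f0[rule_format]
  define C where "C = (\<Sum>i\<in>UNIV. norm (q i)) + 1"
  have C: "C \<ge> 1" by (simp add: C_def sum_nonneg)
  show ?thesis
  proof (intro exI[of _ "1 / C"] conjI ballI)
    fix u :: "(complex, 's) vec" assume u: "u \<in> punct (1 / C)"
    have "norm (q i * lmon (\<mu> i) u) \<le> norm (q i) * (1 / C)" for i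
    proof (cases "q i = 0")
      case False
      then obtain j where "0 < tail (\<mu> i) j" using q by blast
      then have "norm (lmon (\<mu> i) u) \<le> 1 / C"
        using norm_lmon_le[OF u, of "\<mu> i" j] q[OF False] C by simp
      then show ?thesis unfolding norm_mult by (rule mult_left_mono) simp
    qed simp
    then have "norm (\<Sum>i\<in>UNIV. q i * lmon (\<mu> i) u) \<le> (\<Sum>i\<in>UNIV. norm (q i) * (1 / C))"
      by (rule sum_norm_le)
    also have "\<dots> = (C - 1) / C" by (simp add: C_def sum_divide_distrib)
    also have "\<dots> < 1" using C by simp
    finally have "1 + (\<Sum>i\<in>UNIV. q i * lmon (\<mu> i) u) \<noteq> 0"
      by (metis add_eq_0_iff less_irrefl norm_minus_cancel norm_one)
    then show "pairing \<beta> (substitution \<beta> c u) a \<noteq> 0"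
      using coord_lead[OF c a] wcoord_nonzero[OF u] by (simp add: f[OF u])
  qed (use C in auto)
qed

text \<open>Carries identities valid near the origin off the hyperplanes over to a punctured
  polydisc in u.\<close>

lemma substitution_pole_free:
  assumes S: "finite S" "0 \<notin> S" and r: "r > 0"
  shows "\<exists>\<delta>>0. \<forall>u\<in>punct \<delta>. substitution \<beta> c u \<in> pole_free \<beta> S r"
proof -
  have "\<exists>\<delta>>0. \<forall>u\<in>punct \<delta>. \<forall>a\<in>S. pairing \<beta> (substitution \<beta> c u) a \<noteq> 0"
    using S
  proof (induction S rule: finite_induct)
    case empty
    then show ?case by (auto intro: exI[of _ 1])
  next
    case (insert a S)
    obtain \<delta> where 1: "\<delta> > 0" "\<forall>u\<in>punct \<delta>. \<forall>a\<in>S. pairing \<beta> (substitution \<beta> c u) a \<noteq> 0"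
      using insert by auto
    obtain \<delta>' where 2: "\<delta>' > 0" "\<forall>u\<in>punct \<delta>'. pairing \<beta> (substitution \<beta> c u) a \<noteq> 0"
      using pairing_substitution_nonzero[of a] insert by auto
    show ?case
      by (rule exI[of _ "min \<delta> \<delta>'"])
         (use 1 2 punct_mono[of "min \<delta> \<delta>'" \<delta>] punct_mono[of "min \<delta> \<delta>'" \<delta>'] in auto)
  qed
  then obtain \<delta> where \<delta>: "\<delta> > 0" "\<forall>u\<in>punct \<delta>. \<forall>a\<in>S. pairing \<beta> (substitution \<beta> c u) a \<noteq> 0"
    by blast
  define C where "C = (\<Sum>j\<in>UNIV. \<Sum>i\<in>UNIV. \<bar>coord c (\<beta> j) i\<bar>) + 1"
  have C: "C > 0" by (simp add: C_def add_nonneg_pos sum_nonneg)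
  define \<epsilon> where "\<epsilon> = min \<delta> (min 1 (r / (2 * C)))"
  show ?thesis
  proof (intro exI[of _ \<epsilon>] conjI ballI)
    show "\<epsilon> > 0" using \<delta> r C by (simp add: \<epsilon>_def)
    fix u :: "(complex, 's) vec" assume u: "u \<in> punct \<epsilon>"
    have e1: "\<epsilon> \<le> 1" by (simp add: \<epsilon>_def)
    have "norm (substitution \<beta> c u) \<le> (\<Sum>j\<in>UNIV. norm (substitution \<beta> c u $ j))"
      by (simp add: norm_vec_def L2_set_le_sum)
    also have "\<dots> \<le> (\<Sum>j\<in>UNIV. \<Sum>i\<in>UNIV. \<bar>coord c (\<beta> j) i\<bar> * \<epsilon>)"
      by (auto simp: substitution_eq[OF \<beta> c] norm_mult intro!: sum_mono sum_norm_le mult_left_mono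
          wcoord_le[OF u e1])
    also have "\<dots> \<le> C * \<epsilon>"
      using \<open>\<epsilon> > 0\<close> by (simp add: C_def sum_distrib_right[symmetric])
    also have "\<dots> \<le> C * (r / (2 * C))"
      using C by (intro mult_left_mono) (auto simp: \<epsilon>_def)
    also have "\<dots> < r" using C r by simp
    finally show "substitution \<beta> c u \<in> pole_free \<beta> S r"
      using \<delta>(2) u punct_mono[of \<epsilon> \<delta>] by (auto simp: pole_free_def \<epsilon>_def)
  qed
qed

text \<open>An inverse linear form contributes negative powers of b_i only for its own leading index
  i, and holomorphic functions of linear forms contribute none. Sums and products preserve a
  nonnegative exponent at \<open>j\<close>.\<close>

lemma germ_lexp:
  assumes S: "finite S" "0 \<notin> S"
    and j: "\<And>a. a \<in> S \<Longrightarrow> lead c a \<noteq> j" and F: "germ \<beta> S F"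
  shows "\<exists>k. lexp k (\<lambda>u. F (substitution \<beta> c u)) \<and> (\<forall>m. k m \<noteq> 0 \<longrightarrow> 0 \<le> m j)"
  using F
proof (induction rule: germ.induct)
  case (germ_comp R g d)
  define d' where "d' i = (\<Sum>j\<in>UNIV. d j * of_real (coord c (\<beta> j) i))" for i
  have eq: "(\<Sum>j\<in>UNIV. d j * substitution \<beta> c u $ j) = (\<Sum>i\<in>UNIV. d' i * lmon (unit_exp i) u)" for u
    by (simp add: substitution_eq[OF \<beta> c] lmon_unit d'_def sum_distrib_left sum_distrib_right mult_ac)
       (subst sum.swap, simp)
  have "\<exists>k. lexp k (\<lambda>u. g (\<Sum>i\<in>UNIV. d' i * lmon (unit_exp i) u)) \<and>
     (\<forall>m j. k m \<noteq> 0 \<longrightarrow> (\<forall>i. d' i \<noteq> 0 \<longrightarrow> 0 \<le> unit_exp i j) \<longrightarrow> 0 \<le> m j)"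
  proof (rule lexp_compose[OF _ germ_comp(1)])
    show "(\<lambda>n. (deriv ^^ n) g 0 / fact n * t ^ n) sums g t" if "norm t < R" for t
      using holomorphic_power_series[OF germ_comp(2), of t] that by simp
  qed (auto simp: tail_unit)
  then show ?case unfolding eq by (auto simp: unit_exp_def)
next
  case (germ_inverse a)
  then have a: "a \<noteq> 0" using S by auto
  let ?e = "lead c a"
  obtain q :: "'s \<Rightarrow> complex" and \<mu> :: "'s \<Rightarrow> 's \<Rightarrow> int"
    where q0: "\<forall>i. q i \<noteq> 0 \<longrightarrow> (\<forall>j. 0 \<le> tail (\<mu> i) j) \<and> (\<exists>j. 0 < tail (\<mu> i) j) \<and>
      (\<forall>j. j \<noteq> lead c a \<longrightarrow> 0 \<le> \<mu> i j)"
    and f0: "\<forall>u \<epsilon>. u \<in> punct \<epsilon> \<longrightarrow> pairing \<beta> (substitution \<beta> c u) a =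
      of_real (coord c a (lead c a)) * wcoord u (lead c a) * (1 + (\<Sum>i\<in>UNIV. q i * lmon (\<mu> i) u))"
    using linear_form_factor[OF a] by blast
  note q = q0[rule_format] and f = f0[rule_format]
  \<comment> \<open>The unit factor is inverted by the geometric series; the ratios in it have a
    negative exponent only at the leading index, which differs from \<open>j\<close>.\<close>
  have "\<exists>k. lexp k (\<lambda>u. inverse (1 + (\<Sum>i\<in>UNIV. q i * lmon (\<mu> i) u))) \<and>
     (\<forall>m j. k m \<noteq> 0 \<longrightarrow> (\<forall>i. q i \<noteq> 0 \<longrightarrow> 0 \<le> \<mu> i j) \<longrightarrow> 0 \<le> m j)"
  proof (rule lexp_compose[where R = 1 and g = "\<lambda>t. inverse (1 + t)" and a = "\<lambda>n. (-1) ^ n"])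
    show "(\<lambda>n. (-1) ^ n * t ^ n) sums inverse (1 + t)" if "norm t < 1" for t :: complex
      using geometric_sums[of "- t"] that by (simp add: power_minus' divide_inverse)

  qed (use q in auto)
  then obtain k where k1: "lexp k (\<lambda>u. inverse (1 + (\<Sum>i\<in>UNIV. q i * lmon (\<mu> i) u)))"
    and k2: "\<forall>m j. k m \<noteq> 0 \<longrightarrow> (\<forall>i. q i \<noteq> 0 \<longrightarrow> 0 \<le> \<mu> i j) \<longrightarrow> 0 \<le> m j"
    by blast
  have nn: "0 \<le> \<mu> i j" if "q i \<noteq> 0" for i
    using q[OF that] j[OF germ_inverse] by simp
  have "0 \<le> m j" if "k m \<noteq> 0" for m
    using k2[rule_format, OF that nn] .
  note k = k1 this
  \<comment> \<open>The inverse of the leading monomial, as an expansion with a single term.\<close>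
  define l where "l m = (if m = (\<lambda>i. - unit_exp ?e i) then of_real (inverse (coord c a ?e)) else 0 :: complex)"
    for m
  have l: "lexp l (\<lambda>u. inverse (of_real (coord c a ?e) * wcoord u ?e))"
    unfolding lexp_def
  proof (intro exI[of _ 1] conjI allI impI ballI)
    show "- int 1 \<le> tail m j" if "l m \<noteq> 0" for m j
      using that tail_unit[of ?e j] by (auto simp: l_def tail_def sum_negf split: if_splits)
    fix u :: "(complex, 's) vec" assume u: "u \<in> punct 1"
    have "lmon (\<lambda>i. - unit_exp ?e i) u * wcoord u ?e = 1"
      using lmon_add[OF u, of "\<lambda>i. - unit_exp ?e i" "unit_exp ?e"] by (simp add: lmon_unit)
    then have "lmon (\<lambda>i. - unit_exp ?e i) u = inverse (wcoord u ?e)"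
      by (metis inverse_unique mult.commute)
    then show "((\<lambda>m. l m * lmon m u) has_sum inverse (of_real (coord c a ?e) * wcoord u ?e)) UNIV"
      by (intro has_sum_finite_neutralI[of "{\<lambda>i. - unit_exp ?e i}"]) (auto simp: l_def)
  qed auto
  obtain p where p: "lexp p (\<lambda>u. inverse (of_real (coord c a ?e) * wcoord u ?e) *
        inverse (1 + (\<Sum>i\<in>UNIV. q i * lmon (\<mu> i) u)))"
    "\<And>m. p m \<noteq> 0 \<Longrightarrow> \<exists>m1 m2. m = (\<lambda>i. m1 i + m2 i) \<and> l m1 \<noteq> 0 \<and> k m2 \<noteq> 0"
    using lexp_mult[OF l k(1)] by blast
  have "lexp p (\<lambda>u. inverse (pairing \<beta> (substitution \<beta> c u) a))"
    by (rule lexp_cong[OF p(1), of 1]) (simp_all add: f)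
  moreover have "0 \<le> m j" if "p m \<noteq> 0" for m
    using p(2)[OF that] k(2) j[OF germ_inverse] by (auto simp: l_def unit_exp_def split: if_splits)
  ultimately show ?case by blast
next
  case (germ_add F G)
  then obtain k l where *: "lexp k (\<lambda>u. F (substitution \<beta> c u))" "lexp l (\<lambda>u. G (substitution \<beta> c u))"
    "\<And>m. k m \<noteq> 0 \<Longrightarrow> 0 \<le> m j" "\<And>m. l m \<noteq> 0 \<Longrightarrow> 0 \<le> m j"
    by blast
  have "0 \<le> m j" if "k m + l m \<noteq> 0" for m
    using that *(3,4)[of m] by (cases "k m = 0") auto
  then show ?case using lexp_add[OF *(1,2)] by blast
next
  case (germ_mult F G)
  then obtain k l where *: "lexp k (\<lambda>u. F (substitution \<beta> c u))" "lexp l (\<lambda>u. G (substitution \<beta> c u))"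
    "\<And>m. k m \<noteq> 0 \<Longrightarrow> 0 \<le> m j" "\<And>m. l m \<noteq> 0 \<Longrightarrow> 0 \<le> m j"
    by blast
  from lexp_mult[OF *(1,2)] obtain q where q: "lexp q (\<lambda>u. F (substitution \<beta> c u) * G (substitution \<beta> c u))"
    "\<And>m. q m \<noteq> 0 \<Longrightarrow> \<exists>m1 m2. m = (\<lambda>i. m1 i + m2 i) \<and> k m1 \<noteq> 0 \<and> l m2 \<noteq> 0"
    by blast
  have "0 \<le> m j" if "q m \<noteq> 0" for m
    using q(2)[OF that] *(3,4) by fastforce
  then show ?case using q(1) by blast
next
  case (germ_cong F r G)
  then obtain k where k: "lexp k (\<lambda>u. F (substitution \<beta> c u))" "\<forall>m. k m \<noteq> 0 \<longrightarrow> 0 \<le> m j"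
    by blast
  obtain \<delta> where \<delta>: "\<delta> > 0" "\<forall>u\<in>punct \<delta>. substitution \<beta> c u \<in> pole_free \<beta> S r"
    using substitution_pole_free[OF S germ_cong(2)] by blast
  have "lexp k (\<lambda>u. G (substitution \<beta> c u))"
    by (rule lexp_cong[OF k(1) \<delta>(1)]) (use \<delta>(2) germ_cong in auto)
  then show ?case using k(2) by blast
qed

end

section \<open>Residues of germs\<close>

text \<open>The coefficient of 1/(b_1...b_s), before the Jacobian is taken into account. As a
  relation it is linear by construction; uniqueness of the value enters only when it is matched with
  \<open>res\<close>.\<close>

definition has_res :: "('s::{finite,linorder} \<Rightarrow> 'v::real_vector) \<Rightarrow> ('s \<Rightarrow> 'v) \<Rightarrow>
    ((complex, 's) vec \<Rightarrow> complex) \<Rightarrow> complex \<Rightarrow> bool" where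
  "has_res \<beta> c F r \<longleftrightarrow> (\<exists>k. lexp k (\<lambda>u. F (substitution \<beta> c u)) \<and> k (\<lambda>_. -1) = r)"

lemma has_res_add: "has_res \<beta> c F r \<Longrightarrow> has_res \<beta> c G s \<Longrightarrow> has_res \<beta> c (\<lambda>z. F z + G z) (r + s)"
  unfolding has_res_def using lexp_add by fastforce

lemma has_res_cmult: "has_res \<beta> c F r \<Longrightarrow> has_res \<beta> c (\<lambda>z. x * F z) (x * r)"
  unfolding has_res_def using lexp_cmult by fastforce

lemma has_res_zero: "has_res \<beta> c (\<lambda>z. 0) 0"
  unfolding has_res_def using lexp_zero by (intro exI[of _ "\<lambda>_. 0"]) simp

lemma has_res_sum:
  "(\<And>x. x \<in> A \<Longrightarrow> has_res \<beta> c (F x) (r x)) \<Longrightarrow> has_res \<beta> c (\<lambda>z. \<Sum>x\<in>A. F x z) (\<Sum>x\<in>A. r x)"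
proof (induction A rule: infinite_finite_induct)
  case (insert x A)
  then show ?case using has_res_add[of \<beta> c "F x" "r x" "\<lambda>z. \<Sum>x\<in>A. F x z"] by simp
qed (simp_all add: has_res_zero)

lemma has_res_cong:
  assumes \<beta>: "family_basis \<beta>" and c: "family_basis c" and S: "finite S" "0 \<notin> S"
    and F: "has_res \<beta> c F x" and "r > 0" and eq: "\<And>z. z \<in> pole_free \<beta> S r \<Longrightarrow> F z = G z"
  shows "has_res \<beta> c G x"
proof -
  obtain \<delta> where \<delta>: "\<delta> > 0" "\<forall>u\<in>punct \<delta>. substitution \<beta> c u \<in> pole_free \<beta> S r"
    using substitution_pole_free[OF \<beta> c S \<open>r > 0\<close>] by blast
  obtain k where k: "lexp k (\<lambda>u. F (substitution \<beta> c u))" "k (\<lambda>_. -1) = x"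
    using F by (auto simp: has_res_def)
  have "lexp k (\<lambda>u. G (substitution \<beta> c u))"
    by (rule lexp_cong[OF k(1) \<delta>(1)]) (use \<delta>(2) eq in auto)
  with k(2) show ?thesis unfolding has_res_def by blast
qed

text \<open>Sums of germs whose poles omit some leading index \<open>j\<close>: no negative power of $b_j$ occurs in
  their expansions, which is why their residues vanish.\<close>

definition null :: "('s::{finite,linorder} \<Rightarrow> 'v::real_vector) \<Rightarrow> ('s \<Rightarrow> 'v) \<Rightarrow> 'v set \<Rightarrow>
    ((complex, 's) vec \<Rightarrow> complex) \<Rightarrow> bool" where
  "null \<beta> c T F \<longleftrightarrow> (\<exists>G r. (\<forall>j. germ \<beta> {a\<in>T. lead c a \<noteq> j} (G j)) \<and> 0 < r \<and>
     (\<forall>z\<in>pole_free \<beta> T r. F z = (\<Sum>j\<in>UNIV. G j z)))"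

lemma null_germ:
  assumes "germ \<beta> S F" and "S \<subseteq> T" and "\<And>a. a \<in> S \<Longrightarrow> lead c a \<noteq> j"
  shows "null \<beta> c T F"
  unfolding null_def
proof (intro exI[of _ "\<lambda>i. if i = j then F else (\<lambda>_. 0)"] exI[of _ 1] conjI allI ballI)
  show "germ \<beta> {a\<in>T. lead c a \<noteq> i} (if i = j then F else (\<lambda>_. 0))" for i
    using germ_mono[OF assms(1), of "{a\<in>T. lead c a \<noteq> j}"] assms(2,3) by (auto intro: germ_const)
  show "F z = (\<Sum>i\<in>UNIV. (if i = j then F else (\<lambda>_. 0)) z)" for z
    by (simp add: if_distrib if_distribR cong: if_cong)
qed auto

lemma null_cong:
  assumes "null \<beta> c T F" and "s > 0" and "\<And>z. z \<in> pole_free \<beta> T s \<Longrightarrow> F z = F' z"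
  shows "null \<beta> c T F'"
proof -
  obtain G r where *: "\<forall>j. germ \<beta> {a\<in>T. lead c a \<noteq> j} (G j)" "0 < r"
     "\<forall>z\<in>pole_free \<beta> T r. F z = (\<Sum>j\<in>UNIV. G j z)"
    using assms(1) by (auto simp: null_def)
  show ?thesis unfolding null_def
    by (intro exI[of _ G] exI[of _ "min r s"])
       (use * assms(2,3) in \<open>auto simp: pole_free_def\<close>)
qed

lemma null_imp_germ:
  assumes "null \<beta> c T F"
  shows "germ \<beta> T F"
proof -
  obtain G r where *: "\<forall>j. germ \<beta> {a\<in>T. lead c a \<noteq> j} (G j)" "0 < r"
     "\<forall>z\<in>pole_free \<beta> T r. F z = (\<Sum>j\<in>UNIV. G j z)"
    using assms by (auto simp: null_def)
  have "germ \<beta> T (\<lambda>z. \<Sum>j\<in>UNIV. G j z)"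
    by (intro germ_sum germ_mono[OF *(1)[rule_format]]) auto
  then show ?thesis
    by (rule germ_cong[OF _ *(2)]) (use * in auto)
qed

lemma null_zero: "null \<beta> c T (\<lambda>_. 0)"
  by (rule null_germ[of \<beta> "{}"]) (auto intro: germ_const)

lemma null_add:
  assumes "null \<beta> c T F" and "null \<beta> c T F'"
  shows "null \<beta> c T (\<lambda>z. F z + F' z)"
proof -
  obtain G r where *: "\<forall>j. germ \<beta> {a\<in>T. lead c a \<noteq> j} (G j)" "0 < r"
     "\<forall>z\<in>pole_free \<beta> T r. F z = (\<Sum>j\<in>UNIV. G j z)"
    using assms(1) by (auto simp: null_def)
  obtain G' r' where **: "\<forall>j. germ \<beta> {a\<in>T. lead c a \<noteq> j} (G' j)" "0 < r'"
     "\<forall>z\<in>pole_free \<beta> T r'. F' z = (\<Sum>j\<in>UNIV. G' j z)"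
    using assms(2) by (auto simp: null_def)
  show ?thesis unfolding null_def
    by (intro exI[of _ "\<lambda>j z. G j z + G' j z"] exI[of _ "min r r'"])
       (use * ** in \<open>auto simp: pole_free_def sum.distrib intro: germ_add\<close>)
qed

lemma null_mult:
  assumes "null \<beta> c T F" and "germ \<beta> {} P"
  shows "null \<beta> c T (\<lambda>z. P z * F z)"
proof -
  obtain G r where *: "\<forall>j. germ \<beta> {a\<in>T. lead c a \<noteq> j} (G j)" "0 < r"
     "\<forall>z\<in>pole_free \<beta> T r. F z = (\<Sum>j\<in>UNIV. G j z)"
    using assms(1) by (auto simp: null_def)
  have "germ \<beta> {a\<in>T. lead c a \<noteq> j} (\<lambda>z. P z * G j z)" for j
    by (intro germ_mult * germ_mono[OF assms(2)] *(1)[rule_format]) auto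
  then show ?thesis unfolding null_def
    by (intro exI[of _ "\<lambda>j z. P z * G j z"] exI[of _ r])
       (use * in \<open>simp add: sum_distrib_left\<close>)
qed

lemma null_cmult: "null \<beta> c T F \<Longrightarrow> null \<beta> c T (\<lambda>z. x * F z)"
  by (rule null_mult[OF _ germ_const])

lemma null_sum: "(\<And>x. x \<in> A \<Longrightarrow> null \<beta> c T (F x)) \<Longrightarrow> null \<beta> c T (\<lambda>z. \<Sum>x\<in>A. F x z)"
proof (induction A rule: infinite_finite_induct)
  case (insert x A)
  then show ?case using null_add[of \<beta> c T "F x" "\<lambda>z. \<Sum>x\<in>A. F x z"] by simp
qed (simp_all add: null_zero)

text \<open>In the summand indexed by \<open>j\<close> the exponent of b_j is never negative, so the
  exponent with all entries -1 does not occur.\<close>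

lemma null_has_res:
  fixes \<beta> c :: "'s::{finite,linorder} \<Rightarrow> 'v::real_vector"
  assumes \<beta>: "family_basis \<beta>" and c: "family_basis c" and T: "finite T" "0 \<notin> T" and "null \<beta> c T F"
  shows "has_res \<beta> c F 0"
proof -
  obtain G r where *: "\<forall>j. germ \<beta> {a\<in>T. lead c a \<noteq> j} (G j)" "0 < r"
     "\<forall>z\<in>pole_free \<beta> T r. F z = (\<Sum>j\<in>UNIV. G j z)"
    using assms(5) by (auto simp: null_def)
  have "has_res \<beta> c (G j) 0" for j
  proof -
    have "\<exists>k. lexp k (\<lambda>u. G j (substitution \<beta> c u)) \<and> (\<forall>m. k m \<noteq> 0 \<longrightarrow> 0 \<le> m j)"
      by (rule germ_lexp[OF \<beta> c _ _ _ *(1)[rule_format]]) (use T in auto)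
    then obtain k where k: "lexp k (\<lambda>u. G j (substitution \<beta> c u))" "\<forall>m. k m \<noteq> 0 \<longrightarrow> 0 \<le> m j"
      by blast
    have "k (\<lambda>_. -1) = 0" using k(2)[rule_format, of "\<lambda>_. -1"] by auto
    with k(1) show ?thesis unfolding has_res_def by (intro exI[of _ k]) simp
  qed
  then have "has_res \<beta> c (\<lambda>z. \<Sum>j\<in>UNIV. G j z) (\<Sum>j\<in>(UNIV::'s set). 0)"
    by (rule has_res_sum)
  then have "has_res \<beta> c (\<lambda>z. \<Sum>j\<in>UNIV. G j z) 0" by simp
  then show ?thesis
    by (rule has_res_cong[OF \<beta> c T _ *(2)]) (simp add: *(3))
qed

text \<open>Differentiation raises the order of poles but creates no new hyperplane, so each summand
  keeps its missing leading index.\<close>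

lemma null_partial:
  assumes "finite T" and "null \<beta> c T F"
  shows "null \<beta> c T (partial i F)"
proof -
  obtain G r where *: "\<forall>j. germ \<beta> {a\<in>T. lead c a \<noteq> j} (G j)" "0 < r"
     "\<forall>z\<in>pole_free \<beta> T r. F z = (\<Sum>j\<in>UNIV. G j z)"
    using assms(2) by (auto simp: null_def)
  have "\<forall>j. \<exists>s>0. \<forall>z\<in>pole_free \<beta> {a\<in>T. lead c a \<noteq> j} s.
      has_partial i (G j) (partial i (G j) z) z"
    using germ_partial_deriv[OF *(1)[rule_format]] assms(1) by simp
  from choice[OF this] obtain s where s0: "\<forall>j. s j > 0 \<and> (\<forall>z\<in>pole_free \<beta> {a\<in>T. lead c a \<noteq> j} (s j).
      has_partial i (G j) (partial i (G j) z) z)"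
    by blast
  then have s: "\<And>j. s j > 0"
    "\<And>j z. z \<in> pole_free \<beta> {a\<in>T. lead c a \<noteq> j} (s j) \<Longrightarrow>
      has_partial i (G j) (partial i (G j) z) z"
    by auto
  \<comment> \<open>A common radius on which the decomposition holds and all summands are
    differentiable, so that \<open>deriv\<close> is additive on them.\<close>
  define r' where "r' = min r (Min (range s))"
  have r': "r' > 0" using * s(1) by (simp add: r'_def)
  show ?thesis unfolding null_def
  proof (intro exI[of _ "\<lambda>j. partial i (G j)"] exI[of _ r'] conjI allI ballI r')
    show "germ \<beta> {a\<in>T. lead c a \<noteq> j} (partial i (G j))" for j
      using * assms(1) by (intro germ_partial) auto
    fix z assume z: "z \<in> pole_free \<beta> T r'"
    have "partial i F z = partial i (\<lambda>z. \<Sum>j\<in>UNIV. G j z) z"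
      by (rule partial_cong[OF assms(1) z]) (use * in \<open>auto simp: pole_free_def r'_def\<close>)
    also have "z \<in> pole_free \<beta> {a\<in>T. lead c a \<noteq> j} (s j)" for j
      using z Min_le[of "range s" "s j"] by (auto simp: pole_free_def r'_def)
    then have "((\<lambda>t. \<Sum>j\<in>UNIV. G j (z + axis i t)) has_field_derivative (\<Sum>j\<in>UNIV. partial i (G j) z)) (at 0)"
      by (intro DERIV_sum s)
    then have "partial i (\<lambda>z. \<Sum>j\<in>UNIV. G j z) z = (\<Sum>j\<in>UNIV. partial i (G j) z)"
      unfolding partial_def[of i "\<lambda>z. \<Sum>j\<in>UNIV. G j z"] by (rule DERIV_imp_deriv)
    finally show "partial i F z = (\<Sum>j\<in>UNIV. partial i (G j) z)" .
  qed
qed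

text \<open>Both functions are required to be germs so that \<open>partial\<close> is additive on
  their difference; for arbitrary functions the relation need not pass to derivatives.\<close>

definition null_equiv :: "('s::{finite,linorder} \<Rightarrow> 'v::real_vector) \<Rightarrow> ('s \<Rightarrow> 'v) \<Rightarrow> 'v set \<Rightarrow>
    ((complex, 's) vec \<Rightarrow> complex) \<Rightarrow> ((complex, 's) vec \<Rightarrow> complex) \<Rightarrow> bool" where
  "null_equiv \<beta> c T F G \<longleftrightarrow> germ \<beta> T F \<and> germ \<beta> T G \<and> null \<beta> c T (\<lambda>z. F z - G z)"

lemma null_equiv_partial:
  assumes "finite T" and "null_equiv \<beta> c T F G"
  shows "null_equiv \<beta> c T (partial i F) (partial i G)"
proof -
  have F: "germ \<beta> T F" and G: "germ \<beta> T G" and n: "null \<beta> c T (\<lambda>z. F z - G z)"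
    using assms(2) by (auto simp: null_equiv_def)
  obtain r s where r: "r > 0" "\<forall>z\<in>pole_free \<beta> T r. has_partial i F (partial i F z) z"
    and s: "s > 0" "\<forall>z\<in>pole_free \<beta> T s. has_partial i G (partial i G z) z"
    using germ_partial_deriv[OF F assms(1), of i] germ_partial_deriv[OF G assms(1), of i] by blast
  have "null \<beta> c T (\<lambda>z. partial i F z - partial i G z)"
  proof (rule null_cong[OF null_partial[OF assms(1) n]])
    show "min r s > 0" using r s by simp
    fix z assume z: "z \<in> pole_free \<beta> T (min r s)"
    have "((\<lambda>t. F (z + axis i t) - G (z + axis i t)) has_field_derivative
        (partial i F z - partial i G z)) (at 0)"
      using r(2) s(2) z by (intro DERIV_diff) (auto simp: pole_free_def)
    then show "partial i (\<lambda>z. F z - G z) z = partial i F z - partial i G z"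
      unfolding partial_def[of i "\<lambda>z. F z - G z"] by (rule DERIV_imp_deriv)
  qed
  then show ?thesis
    using F G assms(1) by (auto simp: null_equiv_def intro: germ_partial)
qed

text \<open>Stated for a binary relation so as to serve equivalence of functions and also, with the
  second argument ignored, vanishing.\<close>

lemma partials_induct2:
  assumes "R F G" and "\<And>i F G. R F G \<Longrightarrow> R (partial i F) (partial i G)"
  shows "R (partials \<gamma> F) (partials \<gamma> G)"
proof -
  have "R ((partial i ^^ n) F) ((partial i ^^ n) G)" if "R F G" for i n F G
    by (induction n) (auto intro: that assms(2))
  then have "R (fold (\<lambda>i. partial i ^^ \<gamma> i) xs F) (fold (\<lambda>i. partial i ^^ \<gamma> i) xs G)" for xs
    using assms(1) by (induction xs arbitrary: F G) auto
  then show ?thesis by (simp add: partials_def)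
qed

lemma null_equiv_partials:
  assumes "finite T" and "null_equiv \<beta> c T F G"
  shows "null_equiv \<beta> c T (partials \<gamma> F) (partials \<gamma> G)"
  by (rule partials_induct2[where R = "null_equiv \<beta> c T"]) (use assms null_equiv_partial in auto)

lemma lead_basis: "family_basis c \<Longrightarrow> lead c (c e) = e"
  by (simp add: lead_def coord_basis)

section \<open>No broken bases\<close>

lemma in_span_from_lead:
  fixes c :: "'s::{finite,linorder} \<Rightarrow> 'v::real_vector"
  assumes c: "family_basis c" and a: "a \<noteq> 0"
  shows "a \<in> span (c ` {lead c a..})"
proof -
  have "(\<Sum>i\<in>UNIV. coord c a i *\<^sub>R c i) = (\<Sum>i\<in>{lead c a..}. coord c a i *\<^sub>R c i)"
    by (rule sum.mono_neutral_right) (auto simp: coord_below_lead[OF c a] not_le)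
  then have "a = (\<Sum>i\<in>{lead c a..}. coord c a i *\<^sub>R c i)"
    by (simp add: family_basis_expand[OF c])
  moreover have "\<dots> \<in> span (c ` {lead c a..})"
    by (intro span_sum span_scale span_base) auto
  ultimately show ?thesis by metis
qed

text \<open>Exchange step: the expansion of \<open>a\<close> is solved for its leading term.\<close>

lemma lead_basis_in_span:
  fixes c :: "'s::{finite,linorder} \<Rightarrow> 'v::real_vector"
  assumes c: "family_basis c" and a: "a \<noteq> 0"
  shows "c (lead c a) \<in> span (insert a (c ` {lead c a<..}))"
proof -
  let ?e = "lead c a"
  have "(\<Sum>i\<in>UNIV. coord c a i *\<^sub>R c i) = (\<Sum>i\<in>insert ?e {?e<..}. coord c a i *\<^sub>R c i)"
    by (rule sum.mono_neutral_right) (auto simp: coord_below_lead[OF c a] not_less order.order_iff_strict)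
  then have "a = coord c a ?e *\<^sub>R c ?e + (\<Sum>i\<in>{?e<..}. coord c a i *\<^sub>R c i)"
    by (simp add: family_basis_expand[OF c])
  then have "coord c a ?e *\<^sub>R c ?e = a - (\<Sum>i\<in>{?e<..}. coord c a i *\<^sub>R c i)"
    by (metis add_diff_cancel_right')
  moreover have "a - (\<Sum>i\<in>{?e<..}. coord c a i *\<^sub>R c i) \<in> span (insert a (c ` {?e<..}))"
    by (intro span_diff span_sum span_scale span_base) auto
  ultimately have "coord c a ?e *\<^sub>R c ?e \<in> span (insert a (c ` {?e<..}))" by simp
  from span_scale[OF this, of "inverse (coord c a ?e)"] show ?thesis
    using coord_lead[OF c a] by simp
qed

lemma descending_induct:
  fixes e :: "'s::{finite,linorder}"
  assumes "\<And>e. (\<And>e'. e < e' \<Longrightarrow> P e') \<Longrightarrow> P e"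
  shows "P e"
proof (induction "card {e<..}" arbitrary: e rule: less_induct)
  case less
  have "P e'" if "e < e'" for e'
  proof (rule less)
    show "card {e'<..} < card {e<..}"
      by (rule psubset_card_mono) (use that in auto)
  qed
  then show ?case by (rule assms)
qed

text \<open>Triangularity: from the top index down, \<open>c e\<close> is recovered from a vector
  with leading index \<open>e\<close> and the later members of \<open>c\<close>. Contrapositively,
  poles that do not span miss some leading index.\<close>

lemma span_eq_UNIV_if_all_leads:
  fixes c :: "'s::{finite,linorder} \<Rightarrow> 'v::real_vector"
  assumes c: "family_basis c" and S: "0 \<notin> S" and leads: "\<And>j. \<exists>a\<in>S. lead c a = j"
  shows "span S = UNIV"
proof -
  have "c e \<in> span S" for e
  proof (induction e rule: descending_induct)
    case (1 e)
    obtain a where a: "a \<in> S" "lead c a = e" using leads by blast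
    have "insert a (c ` {e<..}) \<subseteq> span S" using 1 a by (auto intro: span_base)
    then have "span (insert a (c ` {e<..})) \<subseteq> span S" by (rule span_minimal) simp
    moreover have "c e \<in> span (insert a (c ` {e<..}))"
      using lead_basis_in_span[OF c, of a] a S by auto
    ultimately show ?case by blast
  qed
  then have "span (range c) \<subseteq> span S" by (intro span_minimal) auto
  then show ?thesis using c by (auto simp: family_basis_def)
qed

lemma family_basis_nonzero: "family_basis c \<Longrightarrow> c i \<noteq> 0"
  using dependent_zero[of "range c"] by (auto simp: family_basis_def)

text \<open>Every member of a basis breaks it, and these are already CARD('s) elements, so the
  cardinality condition leaves room for no other.\<close>

lemma no_broken_basis_broken_by:
  assumes "b \<in> no_broken_bases Z" and "i < length Z" and "broken_by Z b i"
  shows "i \<in> range b"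
proof -
  have b: "strict_mono b" "\<And>i. b i < length Z"
    and card: "card {i. i < length Z \<and> broken_by Z b i} = CARD('a)"
    using assms(1) by (auto simp: no_broken_bases_def bases_def)
  have "range b \<subseteq> {i. i < length Z \<and> broken_by Z b i}"
    using b by (auto simp: broken_by_def extracted_def intro!: span_base)
  moreover have "card (range b) = CARD('a)"
    by (rule card_image) (rule strict_mono_imp_inj_on[OF b(1)])
  ultimately have "range b = {i. i < length Z \<and> broken_by Z b i}"
    using card by (intro card_subset_eq) auto
  then show ?thesis using assms(2,3) by blast
qed

lemma strict_mono_finite_id:
  fixes f :: "'s::{finite,linorder} \<Rightarrow> 's"
  assumes "strict_mono f"
  shows "f x = x"
proof (induction x rule: descending_induct)
  case (1 x)
  have "surj f" using assms by (intro finite_UNIV_inj_surj strict_mono_imp_inj_on) auto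
  then obtain y where y: "f y = x" by (metis surjD)
  show ?case
  proof (rule linorder_cases[of "f x" x])
    assume "x < f x"
    from 1[OF this] show ?thesis using assms by (metis strict_mono_eq)
  next
    assume lt: "f x < x"
    then have "x < y" using y assms by (metis strict_mono_less)
    with 1[OF this] y show ?thesis by simp
  qed
qed

text \<open>The inclusion of ranges is a strictly increasing self-map of the finite index type,
  hence the identity.\<close>

lemma strict_mono_range_eqD:
  fixes b b' :: "'s::{finite,linorder} \<Rightarrow> nat"
  assumes "strict_mono b" "strict_mono b'" "range b \<subseteq> range b'"
  shows "b = b'"
proof -
  have "\<forall>i. \<exists>k. b i = b' k" using assms(3) by blast
  then obtain f where f: "\<And>i. b i = b' (f i)" by metis
  have "strict_mono f"
    using assms(1,2) unfolding strict_mono_def f by (metis assms(2) strict_mono_less)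
  then have "f x = x" for x by (rule strict_mono_finite_id)
  then show ?thesis by (simp add: fun_eq_iff f)
qed

text \<open>If the leading indices of \<open>b'\<close> exhaust the flag of \<open>b\<close>, then, going down the flag, each member of
  \<open>b\<close> either breaks \<open>b'\<close> or is already one of its members.\<close>

lemma no_broken_bases_leads:
  fixes b b' :: "'s::{finite,linorder} \<Rightarrow> nat" and Z :: "'v::real_vector list"
  assumes b: "b \<in> no_broken_bases Z" and b': "b' \<in> no_broken_bases Z"
    and leads: "\<And>j. \<exists>k. lead (extracted Z b) (extracted Z b' k) = j"
  shows "b' = b"
proof -
  let ?c = "extracted Z b" and ?c' = "extracted Z b'"
  have c: "family_basis ?c" "strict_mono b" "\<And>i. b i < length Z"
    and c': "family_basis ?c'" "strict_mono b'" "\<And>i. b' i < length Z"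
    using b b' by (auto simp: no_broken_bases_def bases_def)
  have nz: "?c' k \<noteq> 0" for k by (rule family_basis_nonzero[OF c'(1)])
  have "\<exists>k. b' k = b e" for e
  proof (induction e rule: descending_induct)
    case (1 e)
    obtain k where k: "lead ?c (?c' k) = e" using leads by blast
    show ?case
    proof (cases "b' k \<le> b e")
      \<comment> \<open>This member of \<open>b'\<close> is placed no later than \<open>b e\<close>
        and lies in the span of the flag from \<open>e\<close> on, so it breaks \<open>b\<close>. It
        is therefore a member of \<open>b\<close>, and its leading index tells which one.\<close>
      case True
      have "?c' k \<in> span (?c ` {e..})"
        using in_span_from_lead[OF c(1) nz, of k] k by simp
      then have "broken_by Z b (b' k)"
        using True by (auto simp: broken_by_def extracted_def[of Z b'])
      then obtain e' where e': "b' k = b e'"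
        using no_broken_basis_broken_by[OF b c'(3)] by blast
      then have "?c' k = ?c e'" by (simp add: extracted_def)
      then have "e' = e" using k lead_basis[OF c(1)] by simp
      then show ?thesis using e' by blast
    next
      case False
      \<comment> \<open>The least element \<open>m\<close> of \<open>M\<close> is the first member
        of \<open>b'\<close> placed after \<open>b e\<close>. By induction the members of
        \<open>b\<close> after \<open>e\<close> belong to \<open>b'\<close> from \<open>m\<close>
        on; together with \<open>?c' k\<close> their span contains \<open>?c e\<close>, so
        \<open>b e\<close> breaks \<open>b'\<close>.\<close>
      define M where "M = {l. b e < b' l}"
      have M: "k \<in> M" "finite M" using False by (auto simp: M_def)
      define m where "m = Min M"
      have m: "m \<in> M" "\<And>l. l \<in> M \<Longrightarrow> m \<le> l"
        using M unfolding m_def by (auto intro: Min_in Min_le)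
      have "insert (?c' k) (?c ` {e<..}) \<subseteq> ?c' ` {m..}"
      proof -
        have "?c e' \<in> ?c' ` {m..}" if "e < e'" for e'
        proof -
          obtain l where l: "b' l = b e'" using 1[OF \<open>e < e'\<close>] by blast
          have "b e < b e'" using c(2) \<open>e < e'\<close> by (simp add: strict_mono_less)
          then have "l \<in> M" using l by (simp add: M_def)
          moreover have "?c e' = ?c' l" using l by (simp add: extracted_def)
          ultimately show ?thesis using m(2) by auto
        qed
        then show ?thesis using m(2)[OF M(1)] by auto
      qed
      then have "?c e \<in> span (?c' ` {m..})"
        using lead_basis_in_span[OF c(1) nz, of k] k span_mono by blast
      moreover have "b e \<le> b' m" using m(1) by (simp add: M_def)
      ultimately have "broken_by Z b' (b e)"
        by (auto simp: broken_by_def extracted_def[of Z b])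
      then show ?thesis
        using no_broken_basis_broken_by[OF b' c(3)] by (metis rangeE)
    qed
  qed
  then have "range b \<subseteq> range b'" by (metis image_subsetI rangeI)
  then show ?thesis using strict_mono_range_eqD[OF c(2) c'(2)] by simp
qed

section \<open>Laurent polynomials and integration by parts\<close>

definition wmon :: "('s::finite \<Rightarrow> 'v::real_vector) \<Rightarrow> ('s \<Rightarrow> 'v) \<Rightarrow> ('s \<Rightarrow> int) \<Rightarrow> (complex, 's) vec \<Rightarrow> complex" where
  "wmon \<beta> c m z = (\<Prod>i\<in>UNIV. pairing \<beta> z (c i) powi m i)"

text \<open>A finite counterpart of expansions, on which derivatives are computed monomial by
  monomial. It contains the main term 1/(b_1...b_s) and is closed under
  \<open>partial\<close>.\<close>

inductive laurent :: "('s::finite \<Rightarrow> 'v::real_vector) \<Rightarrow> ('s \<Rightarrow> 'v) \<Rightarrow> ((complex, 's) vec \<Rightarrow> complex) \<Rightarrow> bool"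
  for \<beta> c where
  laurent_mon: "laurent \<beta> c (\<lambda>z. x * wmon \<beta> c m z)"
| laurent_add: "laurent \<beta> c F \<Longrightarrow> laurent \<beta> c G \<Longrightarrow> laurent \<beta> c (\<lambda>z. F z + G z)"
| laurent_cong: "laurent \<beta> c F \<Longrightarrow> (\<And>z. (\<And>i. pairing \<beta> z (c i) \<noteq> 0) \<Longrightarrow> F z = G z) \<Longrightarrow> laurent \<beta> c G"

lemma wmon_add:
  assumes "\<And>i. pairing \<beta> z (c i) \<noteq> 0"
  shows "wmon \<beta> c (\<lambda>i. m i + n i) z = wmon \<beta> c m z * wmon \<beta> c n z"
  using assms by (simp add: wmon_def power_int_add prod.distrib)

lemma laurent_const: "laurent \<beta> c (\<lambda>_. x)"
  using laurent_mon[of \<beta> c x "\<lambda>_. 0"] by (simp add: wmon_def)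

lemma laurent_sum:
  assumes "\<And>x. x \<in> A \<Longrightarrow> laurent \<beta> c (F x)"
  shows "laurent \<beta> c (\<lambda>z. \<Sum>x\<in>A. F x z)"
  using assms
proof (induction A rule: infinite_finite_induct)
  case (insert x A)
  then show ?case using laurent_add[of \<beta> c "F x" "\<lambda>z. \<Sum>x\<in>A. F x z"] by simp
qed (simp_all add: laurent_const)

lemma laurent_mult_mon:
  assumes "laurent \<beta> c F"
  shows "laurent \<beta> c (\<lambda>z. (x * wmon \<beta> c m z) * F z)"
  using assms
proof (induction rule: laurent.induct)
  case (laurent_mon y n)
  show ?case
    by (rule laurent_cong[OF laurent.laurent_mon[of \<beta> c "x * y" "\<lambda>i. m i + n i"]]) (simp add: wmon_add)
next
  case (laurent_add F G)
  then show ?case using laurent.laurent_add[OF laurent_add.IH] by (simp add: ring_distribs)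
next
  case (laurent_cong F G)
  show ?case by (rule laurent.laurent_cong[OF laurent_cong.IH]) (simp add: laurent_cong)
qed

lemma laurent_mult:
  assumes "laurent \<beta> c F" and G: "laurent \<beta> c G"
  shows "laurent \<beta> c (\<lambda>z. F z * G z)"
  using assms(1)
proof (induction rule: laurent.induct)
  case (laurent_mon x m)
  show ?case by (rule laurent_mult_mon[OF G])
next
  case (laurent_add F F')
  then show ?case using laurent.laurent_add[OF laurent_add.IH] by (simp add: ring_distribs)
next
  case (laurent_cong F F')
  show ?case by (rule laurent.laurent_cong[OF laurent_cong.IH]) (simp add: laurent_cong)
qed

lemma laurent_power: "laurent \<beta> c F \<Longrightarrow> laurent \<beta> c (\<lambda>z. F z ^ n)"
  by (induction n) (simp_all add: laurent_const laurent_mult)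

lemma laurent_prod:
  assumes "\<And>x. x \<in> A \<Longrightarrow> laurent \<beta> c (F x)"
  shows "laurent \<beta> c (\<lambda>z. \<Prod>x\<in>A. F x z)"
  using assms
proof (induction A rule: infinite_finite_induct)
  case (insert x A)
  then show ?case using laurent_mult[of \<beta> c "F x" "\<lambda>z. \<Prod>x\<in>A. F x z"] by simp
qed (simp_all add: laurent_const)

lemma laurent_pairing: "laurent \<beta> c (\<lambda>z. pairing \<beta> z (c k))"
proof -
  have "wmon \<beta> c (unit_exp k) z = pairing \<beta> z (c k)" for z
    unfolding wmon_def by (subst prod.remove[of _ k]) (auto simp: unit_exp_def)
  then show ?thesis using laurent_mon[of \<beta> c 1 "unit_exp k"] by simp
qed

lemma laurent_coordinate:
  assumes "family_basis \<beta>" and "family_basis c"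
  shows "laurent \<beta> c (\<lambda>z. z $ i)"
proof -
  have "laurent \<beta> c (\<lambda>z. \<Sum>k\<in>UNIV. of_real (coord c (\<beta> i) k) * pairing \<beta> z (c k))"
    by (intro laurent_sum laurent_mult laurent_const laurent_pairing)
  moreover have "z $ i = (\<Sum>k\<in>UNIV. of_real (coord c (\<beta> i) k) * pairing \<beta> z (c k))" for z
    using pairing_expand[OF assms, of z "\<beta> i"] by (simp add: pairing_basis[OF assms(1)])
  ultimately show ?thesis by simp
qed

lemma wmon_has_derivative:
  fixes \<beta> c :: "'s::finite \<Rightarrow> 'v::real_vector"
  assumes nz: "\<And>i. pairing \<beta> z (c i) \<noteq> 0"
  shows "((\<lambda>t. wmon \<beta> c m (z + axis i t)) has_field_derivative
    (\<Sum>k\<in>UNIV. of_int (m k) * of_real (coord \<beta> (c k) i) * wmon \<beta> c (\<lambda>l. m l + - unit_exp k l) z)) (at 0)"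
proof -
  have d: "((\<lambda>t. pairing \<beta> (z + axis i t) (c k) powi m k) has_field_derivative
      of_int (m k) * pairing \<beta> (z + axis i 0) (c k) powi (m k - 1) * of_real (coord \<beta> (c k) i)) (at 0)" for k
  proof (rule DERIV_power_int)
    show "((\<lambda>t. pairing \<beta> (z + axis i t) (c k)) has_field_derivative of_real (coord \<beta> (c k) i)) (at 0)"
      unfolding pairing_add_left pairing_axis by (auto intro!: derivative_eq_intros)
  qed (use nz in simp)
  have eq: "wmon \<beta> c (\<lambda>l. m l + - unit_exp k l) z =
      pairing \<beta> z (c k) powi (m k - 1) * (\<Prod>l\<in>UNIV-{k}. pairing \<beta> z (c l) powi m l)" for k
    unfolding wmon_def by (subst prod.remove[of _ k]) (auto simp: unit_exp_def)
  show ?thesis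
    unfolding wmon_def[of \<beta> c m]
    by (rule DERIV_cong[OF has_field_derivative_prod[OF d]]) (unfold eq, simp add: mult_ac)
qed

text \<open>The coefficient of y^\<delta> in e^<y|z>. With the factorials included, differentiation
  only shifts the index.\<close>

definition div_power :: "('s::finite \<Rightarrow> nat) \<Rightarrow> (complex, 's) vec \<Rightarrow> complex" where
  "div_power \<delta> z = (\<Prod>i\<in>UNIV. (z $ i) ^ \<delta> i / fact (\<delta> i))"

lemma germ_div_power: "germ \<beta> S (div_power \<delta>)"
  unfolding div_power_def[abs_def] divide_inverse
  by (intro germ_prod germ_mult germ_power germ_coordinate germ_const)

lemma div_power_remove:
  "div_power \<delta> z = (z $ i) ^ \<delta> i / fact (\<delta> i) * (\<Prod>j\<in>UNIV-{i}. (z $ j) ^ \<delta> j / fact (\<delta> j))"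
  unfolding div_power_def by (subst prod.remove[of _ i]) auto

lemma partial_div_power:
  "partial i (div_power \<delta>) z = (if \<delta> i = 0 then 0 else div_power (\<delta>(i := \<delta> i - 1)) z)"
proof -
  let ?C = "\<Prod>j\<in>UNIV-{i}. (z $ j) ^ \<delta> j / fact (\<delta> j)"
  have eq: "div_power \<delta> (z + axis i t) = (z $ i + t) ^ \<delta> i / fact (\<delta> i) * ?C" for t
    unfolding div_power_remove[of \<delta> _ i] by (simp add: axis_def)
  have "((\<lambda>t. (z $ i + t) ^ \<delta> i / fact (\<delta> i) * ?C) has_field_derivative
      of_nat (\<delta> i) * (z $ i) ^ (\<delta> i - 1) / fact (\<delta> i) * ?C) (at 0)"
    by (auto intro!: derivative_eq_intros)
  then have d: "partial i (div_power \<delta>) z = of_nat (\<delta> i) * (z $ i) ^ (\<delta> i - 1) / fact (\<delta> i) * ?C"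
    unfolding partial_def eq by (rule DERIV_imp_deriv)
  show ?thesis
  proof (cases "\<delta> i")
    case 0
    then show ?thesis by (simp add: d)
  next
    case (Suc n)
    have "of_nat (Suc n) * (z $ i) ^ n / fact (Suc n) = (z $ i) ^ n / fact n"
      by (simp add: field_simps del: of_nat_Suc)
    then show ?thesis
      by (simp add: d Suc div_power_remove[of "\<delta>(i := n)" z i] del: of_nat_Suc fact_Suc)
  qed
qed

text \<open>Repeated integration by parts only needs the residues against all divided powers at once.\<close>

definition moments :: "('s::{finite,linorder} \<Rightarrow> 'v::real_vector) \<Rightarrow> ('s \<Rightarrow> 'v) \<Rightarrow>
    ((complex, 's) vec \<Rightarrow> complex) \<Rightarrow> (('s \<Rightarrow> nat) \<Rightarrow> complex) \<Rightarrow> bool" where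
  "moments \<beta> c G \<rho> \<longleftrightarrow> laurent \<beta> c G \<and> (\<forall>\<delta>. has_res \<beta> c (\<lambda>z. div_power \<delta> z * G z) (\<rho> \<delta>))"

context
  fixes \<beta> c :: "'s::{finite,linorder} \<Rightarrow> 'v::real_vector"
  assumes \<beta>: "family_basis \<beta>" and c: "family_basis c"
begin

lemma has_res_wmon:
  shows "has_res \<beta> c (wmon \<beta> c m) (if m = (\<lambda>_. -1) then 1 else 0)"
  unfolding has_res_def
proof (intro exI[of _ "\<lambda>n. if n = m then 1 else 0"] conjI)
  define N where "N = (\<Sum>j\<in>UNIV. nat \<bar>tail m j\<bar>)"
  have N: "- int N \<le> tail m j" for j
  proof -
    have "nat \<bar>tail m j\<bar> \<le> N" unfolding N_def by (rule member_le_sum) auto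
    then show ?thesis by linarith
  qed
  show "lexp (\<lambda>n. if n = m then 1 else 0) (\<lambda>u. wmon \<beta> c m (substitution \<beta> c u))"
    unfolding lexp_def
  proof (intro exI[of _ "1::real"] exI[of _ N] conjI allI impI ballI)
    fix u :: "(complex, 's) vec"
    show "((\<lambda>n. (if n = m then 1 else 0) * lmon n u) has_sum wmon \<beta> c m (substitution \<beta> c u)) UNIV"
      by (rule has_sum_finite_neutralI[of "{m}"])
         (auto simp: wmon_def lmon_def pairing_substitution_basis[OF \<beta> c])
  qed (use N in \<open>auto split: if_splits\<close>)
qed auto

text \<open>A derivative has no residue: the monomial with all exponents -1 can only arise from
  exponent 0 in the variable that was lowered, and then it carries the factor 0.\<close>

lemma laurent_derivative:
  assumes "laurent \<beta> c F"
  shows "\<exists>F'. laurent \<beta> c F' \<and> has_res \<beta> c F' 0 \<and>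
    (\<forall>z. (\<forall>i. pairing \<beta> z (c i) \<noteq> 0) \<longrightarrow> has_partial i F (F' z) z)"
  using assms
proof (induction rule: laurent.induct)
  case (laurent_mon x m)
  let ?c = "\<lambda>k. of_int (m k) * of_real (coord \<beta> (c k) i)"
  let ?F' = "\<lambda>z. x * (\<Sum>k\<in>UNIV. ?c k * wmon \<beta> c (\<lambda>l. m l + - unit_exp k l) z)"
  have "has_res \<beta> c (\<lambda>z. ?c k * wmon \<beta> c (\<lambda>l. m l + - unit_exp k l) z) 0" for k
  proof -
    let ?n = "\<lambda>l. m l + - unit_exp k l"
    have "?c k * (if ?n = (\<lambda>_. -1) then 1 else 0) = (0 :: complex)"
    proof (cases "?n = (\<lambda>_. -1)")
      case True
      then have "?n k = -1" by (rule fun_cong)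
      then show ?thesis by (simp add: unit_exp_def)
    qed simp
    then show ?thesis
      using has_res_cmult[OF has_res_wmon[of ?n], of "?c k"] by (simp only:)
  qed
  then have "has_res \<beta> c (\<lambda>z. \<Sum>k\<in>UNIV. ?c k * wmon \<beta> c (\<lambda>l. m l + - unit_exp k l) z) (\<Sum>k\<in>(UNIV::'s set). 0)"
    by (rule has_res_sum)
  then have "has_res \<beta> c ?F' (x * (\<Sum>k\<in>(UNIV::'s set). 0))" by (rule has_res_cmult)
  then have "has_res \<beta> c ?F' 0" by simp
  moreover have "laurent \<beta> c ?F'"
    by (intro laurent_mult[OF laurent_const] laurent_sum laurent.laurent_mon)
  moreover have "((\<lambda>t. x * wmon \<beta> c m (z + axis i t)) has_field_derivative ?F' z) (at 0)"
    if "\<forall>i. pairing \<beta> z (c i) \<noteq> 0" for z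
    using that by (intro DERIV_cmult wmon_has_derivative) auto
  ultimately show ?case by blast
next
  case (laurent_add F G)
  then obtain F' G' where F': "laurent \<beta> c F'" "has_res \<beta> c F' 0"
    "\<forall>z. (\<forall>i. pairing \<beta> z (c i) \<noteq> 0) \<longrightarrow> has_partial i F (F' z) z"
    and G': "laurent \<beta> c G'" "has_res \<beta> c G' 0"
    "\<forall>z. (\<forall>i. pairing \<beta> z (c i) \<noteq> 0) \<longrightarrow> has_partial i G (G' z) z"
    by blast
  have "has_res \<beta> c (\<lambda>z. F' z + G' z) 0"
    using has_res_add[OF F'(2) G'(2)] by simp
  then show ?case
    using F'(3) G'(3) laurent.laurent_add[OF F'(1) G'(1)]
    by (intro exI[of _ "\<lambda>z. F' z + G' z"]) (simp add: DERIV_add)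
next
  case (laurent_cong F G)
  then obtain F' where F': "laurent \<beta> c F'" "has_res \<beta> c F' 0"
    "\<forall>z. (\<forall>i. pairing \<beta> z (c i) \<noteq> 0) \<longrightarrow> has_partial i F (F' z) z"
    by blast
  have "has_partial i G (F' z) z" if z: "\<forall>i. pairing \<beta> z (c i) \<noteq> 0" for z
  proof -
    have "z \<in> pole_free \<beta> (range c) (norm z + 1)" using z by (auto simp: pole_free_def)
    from eventually_pole_free[OF _ this, of i]
    have "eventually (\<lambda>t. F (z + axis i t) = G (z + axis i t)) (nhds 0)"
      by (auto simp: pole_free_def laurent_cong elim!: eventually_mono)
    moreover have "has_partial i F (F' z) z"
      using F'(3) z by blast
    ultimately show ?thesis
      by (subst (asm) DERIV_cong_ev[OF refl _ refl]) auto
  qed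
  then show ?case using F' by blast
qed

lemma laurent_partial_deriv:
  assumes F: "laurent \<beta> c F"
    and z: "\<And>i. pairing \<beta> z (c i) \<noteq> 0"
  shows "has_partial i F (partial i F z) z"
  using laurent_derivative[OF F, of i] z DERIV_imp_deriv unfolding partial_def by metis

lemma laurent_partial:
  assumes F: "laurent \<beta> c F"
  shows "laurent \<beta> c (partial i F)" and "has_res \<beta> c (partial i F) 0"
proof -
  obtain F' where F': "laurent \<beta> c F'" "has_res \<beta> c F' 0"
    "\<forall>z. (\<forall>i. pairing \<beta> z (c i) \<noteq> 0) \<longrightarrow> has_partial i F (F' z) z"
    using laurent_derivative[OF F, of i] by blast
  have eq: "F' z = partial i F z" if "\<And>i. pairing \<beta> z (c i) \<noteq> 0" for z
    using DERIV_imp_deriv[OF F'(3)[rule_format, of z]] that by (simp add: partial_def)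
  show "laurent \<beta> c (partial i F)"
    by (rule laurent_cong[OF F'(1)]) (rule eq)
  have "0 \<notin> range c" using family_basis_nonzero[OF c] by (metis rangeE)
  then show "has_res \<beta> c (partial i F) 0"
    by (intro has_res_cong[OF \<beta> c _ _ F'(2), of "range c" 1] eq) (auto simp: pole_free_def)
qed

text \<open>The product rule, combined with the vanishing residue of a derivative.\<close>

lemma laurent_by_parts:
  assumes F: "laurent \<beta> c F" and G: "laurent \<beta> c G"
    and r: "has_res \<beta> c (\<lambda>z. partial i F z * G z) r"
  shows "has_res \<beta> c (\<lambda>z. F z * partial i G z) (- r)"
proof -
  have "has_res \<beta> c (\<lambda>z. partial i (\<lambda>z. F z * G z) z + (-1) * (partial i F z * G z)) (0 + (-1) * r)"
    by (intro has_res_add has_res_cmult laurent_partial(2) laurent_mult F G r)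
  moreover have "partial i (\<lambda>z. F z * G z) z + (-1) * (partial i F z * G z) = F z * partial i G z"
    if z: "z \<in> pole_free \<beta> (range c) 1" for z
  proof -
    have nz: "\<And>i. pairing \<beta> z (c i) \<noteq> 0" using z by (auto simp: pole_free_def)
    from DERIV_mult[OF laurent_partial_deriv[OF F nz, of i] laurent_partial_deriv[OF G nz, of i]]
    have "((\<lambda>t. F (z + axis i t) * G (z + axis i t)) has_field_derivative
        partial i F z * G z + partial i G z * F z) (at 0)" by simp
    then have "partial i (\<lambda>z. F z * G z) z = partial i F z * G z + partial i G z * F z"
      unfolding partial_def[of i "\<lambda>z. F z * G z"] by (rule DERIV_imp_deriv)
    then show ?thesis by simp
  qed
  moreover have "0 \<notin> range c" using family_basis_nonzero[OF c] by (metis rangeE)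
  ultimately show ?thesis
    using has_res_cong[OF \<beta> c, of "range c" _ "0 + (-1) * r" 1] by simp
qed

lemma laurent_div_power:
  shows "laurent \<beta> c (div_power \<delta>)"
  unfolding div_power_def[abs_def] divide_inverse
  by (intro laurent_prod laurent_mult laurent_power laurent_coordinate laurent_const \<beta> c)

text \<open>Integration by parts moves the derivative onto the divided power and lowers one index;
  at index 0 that derivative is 0.\<close>

lemma moments_partial:
  assumes G: "moments \<beta> c G \<rho>"
  shows "moments \<beta> c (partial i G) (\<lambda>\<delta>. if \<delta> i = 0 then 0 else - \<rho> (\<delta>(i := \<delta> i - 1)))"
  unfolding moments_def
proof (intro conjI allI)
  have lG: "laurent \<beta> c G" using G by (simp add: moments_def)
  show "laurent \<beta> c (partial i G)" by (rule laurent_partial(1)[OF lG])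
  fix \<delta> :: "'s \<Rightarrow> nat"
  let ?r = "if \<delta> i = 0 then 0 else \<rho> (\<delta>(i := \<delta> i - 1))"
  have "has_res \<beta> c (\<lambda>z. partial i (div_power \<delta>) z * G z) ?r"
    using G has_res_zero[of \<beta> c] by (simp add: partial_div_power moments_def)
  from laurent_by_parts[OF laurent_div_power lG this]
  show "has_res \<beta> c (\<lambda>z. div_power \<delta> z * partial i G z) (if \<delta> i = 0 then 0 else - \<rho> (\<delta>(i := \<delta> i - 1)))"
    by (cases "\<delta> i = 0") simp_all
qed

lemma moments_partial_power:
  assumes G: "moments \<beta> c G \<rho>"
  shows "moments \<beta> c ((partial i ^^ n) G) (\<lambda>\<delta>. if \<delta> i < n then 0 else (-1) ^ n * \<rho> (\<delta>(i := \<delta> i - n)))"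
proof (induction n)
  case 0
  then show ?case using G by simp
next
  case (Suc n)
  have eq: "(\<lambda>\<delta>. if \<delta> i = 0 then 0 else - (if (\<delta>(i := \<delta> i - 1)) i < n then 0
        else (- 1) ^ n * \<rho> ((\<delta>(i := \<delta> i - 1))(i := (\<delta>(i := \<delta> i - 1)) i - n)))) =
      (\<lambda>\<delta>. if \<delta> i < Suc n then 0 else (- 1) ^ Suc n * \<rho> (\<delta>(i := \<delta> i - Suc n)))"
    by (auto simp: fun_eq_iff)
  show ?case
    using moments_partial[OF Suc, of i] unfolding eq by simp
qed

lemma moments_partials:
  assumes G: "moments \<beta> c G \<rho>"
  shows "moments \<beta> c (partials \<gamma> G) (\<lambda>\<delta>. if \<exists>i. \<delta> i < \<gamma> i then 0
    else (-1) ^ (\<Sum>i\<in>UNIV. \<gamma> i) * \<rho> (\<lambda>i. \<delta> i - \<gamma> i))"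
proof -
  \<comment> \<open>Generalised to lists of distinct indices, where indices outside the list are not
    yet shifted. Appending at the end matches the order in which \<open>fold\<close> applies the
    operators, and distinctness keeps the shifts independent.\<close>
  have "moments \<beta> c (fold (\<lambda>i. partial i ^^ \<gamma> i) xs G) (\<lambda>\<delta>. if \<exists>i\<in>set xs. \<delta> i < \<gamma> i then 0
    else (-1) ^ (\<Sum>i\<in>set xs. \<gamma> i) * \<rho> (\<lambda>i. if i \<in> set xs then \<delta> i - \<gamma> i else \<delta> i))"
    if "distinct xs" for xs
    using that
  proof (induction xs rule: rev_induct)
    case Nil
    then show ?case using G by simp
  next
    case (snoc x xs)
    then have IH: "moments \<beta> c (fold (\<lambda>i. partial i ^^ \<gamma> i) xs G) (\<lambda>\<delta>. if \<exists>i\<in>set xs. \<delta> i < \<gamma> i then 0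
      else (-1) ^ (\<Sum>i\<in>set xs. \<gamma> i) * \<rho> (\<lambda>i. if i \<in> set xs then \<delta> i - \<gamma> i else \<delta> i))"
      and x: "x \<notin> set xs" by auto
    let ?u = "\<lambda>\<delta>. \<delta>(x := \<delta> x - \<gamma> x)"
    have eq: "(if \<delta> x < \<gamma> x then 0 else (-1) ^ \<gamma> x *
        (if \<exists>i\<in>set xs. ?u \<delta> i < \<gamma> i then 0
         else (-1) ^ (\<Sum>i\<in>set xs. \<gamma> i) * \<rho> (\<lambda>i. if i \<in> set xs then ?u \<delta> i - \<gamma> i
           else ?u \<delta> i))) =
      (if \<exists>i\<in>set (xs @ [x]). \<delta> i < \<gamma> i then 0
       else (-1) ^ (\<Sum>i\<in>set (xs @ [x]). \<gamma> i) *
         \<rho> (\<lambda>i. if i \<in> set (xs @ [x]) then \<delta> i - \<gamma> i else \<delta> i))" for \<delta> :: "'s \<Rightarrow> nat"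
    proof -
      have "(\<lambda>i. if i \<in> set xs then ?u \<delta> i - \<gamma> i else ?u \<delta> i) =
          (\<lambda>i. if i \<in> set (xs @ [x]) then \<delta> i - \<gamma> i else \<delta> i)"
        using x by (auto simp: fun_eq_iff)
      moreover have "(\<exists>i\<in>set xs. ?u \<delta> i < \<gamma> i) \<longleftrightarrow> (\<exists>i\<in>set xs. \<delta> i < \<gamma> i)"
        using x by (metis fun_upd_other)
      ultimately show ?thesis using x by (simp add: power_add mult_ac)
    qed
    show ?case
      using moments_partial_power[OF IH, where i = x and n = "\<gamma> x"] unfolding eq by simp
  qed
  from this[of "sorted_list_of_set UNIV", OF distinct_sorted_list_of_set] show ?thesis
    unfolding partials_def set_sorted_list_of_set[OF finite_class.finite_UNIV] by (simp cong: if_cong)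
qed

text \<open>If \<delta> is not 0, some factor z_i splits off; it is a linear combination of the
  b_k(z), and each b_k cancels one pole, so that leading index k is missing. Only \<delta> = 0
  leaves the full pole.\<close>

lemma moments_basis:
  shows "moments \<beta> c (\<lambda>z. \<Prod>i\<in>UNIV. inverse (pairing \<beta> z (c i))) (\<lambda>\<delta>. if \<delta> = (\<lambda>_. 0) then 1 else 0)"
  unfolding moments_def
proof (intro conjI allI)
  let ?G = "\<lambda>z. \<Prod>i\<in>UNIV. inverse (pairing \<beta> z (c i))"
  have G: "?G = wmon \<beta> c (\<lambda>_. -1)"
    by (simp add: wmon_def fun_eq_iff)
  show "laurent \<beta> c ?G"
    unfolding G using laurent_mon[of \<beta> c 1 "\<lambda>_. -1"] by simp
  fix \<delta> :: "'s \<Rightarrow> nat"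
  have nz: "0 \<notin> range c" using family_basis_nonzero[OF c] by (metis rangeE)
  show "has_res \<beta> c (\<lambda>z. div_power \<delta> z * ?G z) (if \<delta> = (\<lambda>_. 0) then 1 else 0)"
  proof (cases "\<delta> = (\<lambda>_. 0)")
    case True
    then show ?thesis
      using has_res_wmon[of "\<lambda>_. -1"] by (simp add: G div_power_def)
  next
    case False
    then obtain i where i: "\<delta> i > 0" by auto
    \<comment> \<open>The divided power with one factor z_i removed; the denominator stays fact
      (\<delta> i).\<close>
    let ?Q = "\<lambda>z. (z $ i) ^ (\<delta> i - 1) / fact (\<delta> i) * (\<Prod>j\<in>UNIV-{i}. (z $ j) ^ \<delta> j / fact (\<delta> j))"
    let ?H = "\<lambda>k z. of_real (coord c (\<beta> i) k) * (\<Prod>l\<in>UNIV-{k}. inverse (pairing \<beta> z (c l)))"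
    have "null \<beta> c (range c) (\<lambda>z. \<Sum>k\<in>UNIV. ?H k z)"
    proof (rule null_sum)
      fix k
      show "null \<beta> c (range c) (?H k)"
      proof (rule null_germ[of _ "c ` (UNIV - {k})" _ _ _ k])
        show "germ \<beta> (c ` (UNIV - {k})) (?H k)"
          by (intro germ_cmult germ_prod germ_inverse) auto
      qed (auto simp: lead_basis[OF c])
    qed
    moreover have "germ \<beta> {} ?Q"
      unfolding divide_inverse
      by (intro germ_mult germ_prod germ_power germ_coordinate germ_const)
    ultimately have "null \<beta> c (range c) (\<lambda>z. ?Q z * (\<Sum>k\<in>UNIV. ?H k z))"
      by (rule null_mult)
    then have "null \<beta> c (range c) (\<lambda>z. div_power \<delta> z * ?G z)"
    proof (rule null_cong[where s = 1])
      fix z assume z: "z \<in> pole_free \<beta> (range c) 1"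
      have "?H k z = of_real (coord c (\<beta> i) k) * pairing \<beta> z (c k) * ?G z" for k
        using z by (subst (2) prod.remove[of _ k]) (auto simp: pole_free_def)
      then have "(\<Sum>k\<in>UNIV. ?H k z) = (\<Sum>k\<in>UNIV. of_real (coord c (\<beta> i) k) * pairing \<beta> z (c k)) * ?G z"
        unfolding sum_distrib_right by (intro sum.cong refl)
      also have "\<dots> = z $ i * ?G z"
        using pairing_expand[OF \<beta> c, of z "\<beta> i"] by (simp add: pairing_basis[OF \<beta>])
      finally have "(\<Sum>k\<in>UNIV. ?H k z) = z $ i * ?G z" .
      moreover have "div_power \<delta> z = ?Q z * z $ i"
        unfolding div_power_remove[of \<delta> z i] using i by (cases "\<delta> i") auto
      ultimately show "?Q z * (\<Sum>k\<in>UNIV. ?H k z) = div_power \<delta> z * ?G z"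
        by simp
    qed simp
    then show ?thesis
      using null_has_res[OF \<beta> c _ nz] False by simp
  qed
qed

text \<open>Up to sign, the derivatives of 1/(b_1...b_s) are dual to the divided powers. This is
  what isolates a single coefficient of q.\<close>

lemma has_res_main_term:
  shows "has_res \<beta> c (\<lambda>z. div_power \<alpha> z * partials \<gamma> (\<lambda>z. \<Prod>i\<in>UNIV. inverse (pairing \<beta> z (c i))) z)
    (if \<gamma> = \<alpha> then (-1) ^ (\<Sum>i\<in>UNIV. \<alpha> i) else 0)"
proof -
  have eq: "(if \<exists>i. \<alpha> i < \<gamma> i then 0 else (-1) ^ (\<Sum>i\<in>UNIV. \<gamma> i) *
      (if (\<lambda>i. \<alpha> i - \<gamma> i) = (\<lambda>_. 0) then 1 else 0)) =
      (if \<gamma> = \<alpha> then (-1) ^ (\<Sum>i\<in>UNIV. \<alpha> i) else 0 :: complex)"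
  proof (cases "\<gamma> = \<alpha>")
    case False
    then obtain i where "\<gamma> i \<noteq> \<alpha> i" by auto
    then have "\<alpha> i < \<gamma> i \<or> \<alpha> i - \<gamma> i \<noteq> 0" by auto
    then show ?thesis using False by (auto simp: fun_eq_iff)
  qed simp
  have "moments \<beta> c (partials \<gamma> (\<lambda>z. \<Prod>i\<in>UNIV. inverse (pairing \<beta> z (c i))))
      (\<lambda>\<delta>. if \<exists>i. \<delta> i < \<gamma> i then 0 else (-1) ^ (\<Sum>i\<in>UNIV. \<gamma> i) *
        (if (\<lambda>i. \<delta> i - \<gamma> i) = (\<lambda>_. 0) then 1 else 0))"
    by (rule moments_partials[OF moments_basis])
  then show ?thesis unfolding moments_def eq[symmetric] by (rule conjunct2[THEN spec])
qed

end

section \<open>From expansions to the iterated residue\<close>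

text \<open>The least moved point would have a smaller image, which is then fixed, contradicting
  injectivity.\<close>

lemma permutes_le_imp_id:
  fixes p :: "'s::{finite,linorder} \<Rightarrow> 's"
  assumes p: "p permutes UNIV" and le: "\<And>i. p i \<le> i"
  shows "p = id"
proof (rule ccontr)
  assume "p \<noteq> id"
  then have ne: "{i. p i \<noteq> i} \<noteq> {}" by (auto simp: fun_eq_iff)
  define m where "m = Min {i. p i \<noteq> i}"
  have m: "p m \<noteq> m" using Min_in[OF _ ne] by (simp add: m_def)
  then have "p m < m" using le[of m] by simp
  have "p (p m) = p m"
  proof (rule ccontr)
    assume "p (p m) \<noteq> p m"
    then have "m \<le> p m" unfolding m_def by (intro Min_le) auto
    then show False using \<open>p m < m\<close> by simp
  qed
  then show False using m permutes_inj[OF p] by (auto dest: injD)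
qed

text \<open>The library version requires an index type of class wellorder.\<close>

lemma det_lower_triangular:
  fixes A :: "(('a::comm_ring_1, 's::{finite,linorder}) vec, 's) vec"
  assumes ld: "\<And>i j. i < j \<Longrightarrow> A $ i $ j = 0"
  shows "det A = (\<Prod>i\<in>UNIV. A $ i $ i)"
proof -
  have "(\<Prod>i\<in>UNIV. A $ i $ p i) = 0" if p: "p permutes UNIV" "p \<noteq> id" for p
  proof -
    obtain i where "i < p i" using permutes_le_imp_id[OF p(1)] p(2) by (meson not_le)
    then show ?thesis using ld by (intro prod_zero) auto
  qed
  then have "det A = (\<Sum>p\<in>{id}. of_int (sign p) * (\<Prod>i\<in>UNIV. A $ i $ p i))"
    unfolding det_def by (intro sum.mono_neutral_right) (auto simp: permutes_id finite_permutations)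
  then show ?thesis by (simp add: sign_id)
qed

lemma det_of_real:
  fixes A :: "real ^ 'n ^ 'n"
  shows "det (\<chi> i j. complex_of_real (A $ i $ j)) = of_real (det A)"
  by (simp add: det_def)

text \<open>The Jacobian of the substitution contributes \<open>basis_det c \<beta>\<close>; this
  relation cancels it against the determinant in the theorem.\<close>

lemma basis_change_det:
  fixes \<beta> c :: "'s::finite \<Rightarrow> 'v::real_vector"
  assumes \<beta>: "family_basis \<beta>" and c: "family_basis c"
  shows "basis_det c \<beta> * basis_det \<beta> c = 1"
proof -
  have "(\<chi> k l. coord c (\<beta> k) l) ** (\<chi> i j. coord \<beta> (c i) j) = (mat 1 :: real ^ 's ^ 's)"
  proof -
    have "(\<Sum>l\<in>UNIV. coord c (\<beta> k) l * coord \<beta> (c l) m) = coord \<beta> (\<beta> k) m" for k m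
    proof -
      have "coord \<beta> (\<beta> k) m = coord \<beta> (\<Sum>l\<in>UNIV. coord c (\<beta> k) l *\<^sub>R c l) m"
        by (simp add: family_basis_expand[OF c])
      then show ?thesis by (simp add: coord_sum[OF \<beta>] coord_scale[OF \<beta>])
    qed
    then show ?thesis
      by (simp add: matrix_matrix_mult_def mat_def vec_eq_iff coord_basis[OF \<beta>])
  qed
  then show ?thesis
    unfolding basis_det_def by (metis det_I det_mul)
qed

text \<open>Multiplication by (u_1...u_s)^M, which brings expansions with different pole orders to a
  common one.\<close>

lemma has_sum_shift:
  fixes k :: "('s::finite \<Rightarrow> nat) \<Rightarrow> complex"
  assumes "((\<lambda>\<alpha>. k \<alpha> * umon \<alpha> u) has_sum S) UNIV"
  shows "((\<lambda>\<gamma>. (if \<forall>i. M \<le> \<gamma> i then k (\<lambda>i. \<gamma> i - M) else 0) * umon \<gamma> u) has_sum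
    (\<Prod>i\<in>UNIV. u $ i) ^ M * S) UNIV" (is "(?F has_sum _) UNIV")
proof -
  have "((\<lambda>\<alpha>. (\<Prod>i\<in>UNIV. u $ i) ^ M * (k \<alpha> * umon \<alpha> u)) has_sum
      (\<Prod>i\<in>UNIV. u $ i) ^ M * S) UNIV"
    by (rule has_sum_cmult_right[OF assms])
  then have *: "((\<lambda>\<alpha>. ?F (\<lambda>i. \<alpha> i + M)) has_sum (\<Prod>i\<in>UNIV. u $ i) ^ M * S) UNIV"
    by (simp add: power_add prod.distrib prod_power_distrib mult_ac)
  have "bij_betw (\<lambda>\<alpha> i. \<alpha> i + M) UNIV {\<gamma>. \<forall>i. M \<le> \<gamma> i}"
    by (rule bij_betwI[where g = "\<lambda>\<gamma> i. \<gamma> i - M"]) auto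
  from has_sum_reindex_bij_betw[OF this, of ?F] *
  have "(?F has_sum (\<Prod>i\<in>UNIV. u $ i) ^ M * S) {\<gamma>. \<forall>i. M \<le> \<gamma> i}" by blast
  then show ?thesis
    by (rule has_sum_cong_neutral[THEN iffD1, rotated -1]) auto
qed

text \<open>This gives the \<open>THE\<close> in \<open>res\<close> its value. Both expansions are
  brought to pole order Suc N + Suc N'; there the exponent N + Suc N' in every variable corresponds
  to N in the first and to N' in the second.\<close>

lemma has_expansion_unique:
  assumes "has_expansion G (Suc N) k" and "has_expansion G (Suc N') k'"
  shows "k (\<lambda>_. N) = k' (\<lambda>_. N')"
proof -
  obtain \<epsilon> where e: "\<epsilon> > 0" "\<And>u. u \<in> punct \<epsilon> \<Longrightarrow>
    ((\<lambda>\<alpha>. k \<alpha> * umon \<alpha> u) has_sum (\<Prod>i\<in>UNIV. u $ i) ^ Suc N * G u) UNIV"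
    using assms(1) by (auto simp: has_expansion_def punct_def)
  obtain \<delta> where d: "\<delta> > 0" "\<And>u. u \<in> punct \<delta> \<Longrightarrow>
    ((\<lambda>\<alpha>. k' \<alpha> * umon \<alpha> u) has_sum (\<Prod>i\<in>UNIV. u $ i) ^ Suc N' * G u) UNIV"
    using assms(2) by (auto simp: has_expansion_def punct_def)
  let ?K = "\<lambda>\<gamma>. if \<forall>i. Suc N' \<le> \<gamma> i then k (\<lambda>i. \<gamma> i - Suc N') else 0"
  let ?K' = "\<lambda>\<gamma>. if \<forall>i. Suc N \<le> \<gamma> i then k' (\<lambda>i. \<gamma> i - Suc N) else 0"
  have "((\<lambda>\<gamma>. (?K \<gamma> - ?K' \<gamma>) * umon \<gamma> u) has_sum 0) UNIV"
    if "u \<in> punct (min \<epsilon> \<delta>)" for u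
  proof -
    have u: "u \<in> punct \<epsilon>" "u \<in> punct \<delta>"
      using that punct_mono[of "min \<epsilon> \<delta>" \<epsilon>] punct_mono[of "min \<epsilon> \<delta>" \<delta>] by auto
    let ?p = "\<Prod>i\<in>UNIV. u $ i"
    have "((\<lambda>\<gamma>. ?K \<gamma> * umon \<gamma> u + (-1) * (?K' \<gamma> * umon \<gamma> u)) has_sum
       (?p ^ Suc N' * (?p ^ Suc N * G u) + (-1) * (?p ^ Suc N * (?p ^ Suc N' * G u)))) UNIV"
      by (intro has_sum_add has_sum_cmult_right has_sum_shift e d u)
    moreover have "?p ^ Suc N' * (?p ^ Suc N * G u) + (-1) * (?p ^ Suc N * (?p ^ Suc N' * G u)) = 0"
      by simp
    moreover have "?K \<gamma> * x + (-1) * (?K' \<gamma> * x) = (?K \<gamma> - ?K' \<gamma>) * x" for \<gamma> x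
      by (simp only: ring_distribs) simp
    ultimately show ?thesis by simp
  qed
  moreover have "min \<epsilon> \<delta> > 0" using e d by simp
  ultimately have "?K (\<lambda>_. N + Suc N') - ?K' (\<lambda>_. N + Suc N') = 0"
    by (rule multi_power_series_zero[rotated])
  then show ?thesis by simp
qed

lemma tail_zero_imp_zero:
  assumes "\<And>j. tail n j = 0"
  shows "n e = 0"
proof (induction e rule: descending_induct)
  case (1 e)
  have "tail n e = n e + (\<Sum>i\<in>{e<..}. n i)"
  proof -
    have "{e..} = insert e {e<..}" by auto
    then show ?thesis by (simp add: tail_def)
  qed
  then show ?case using assms[of e] 1 by simp
qed

lemma tail_one: "tail (\<lambda>_. 1) j = int (card {j..})"
  by (simp add: tail_def)

context
  fixes \<beta> c :: "'s::{finite,linorder} \<Rightarrow> 'v::real_vector"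
  assumes \<beta>: "family_basis \<beta>" and c: "family_basis c"
begin

text \<open>Chain rule: dz/du is the product of dz/db, with determinant
  \<open>basis_det c \<beta>\<close>, and db/du, which is lower triangular with diagonal entries
  b_i/u_i.\<close>

lemma pullback_eq:
  assumes u: "u \<in> punct \<epsilon>"
  shows "pullback \<beta> c f u =
    f (substitution \<beta> c u) * (of_real (basis_det c \<beta>) * (\<Prod>i\<in>UNIV. wcoord u i / u $ i))"
proof -
  \<comment> \<open>The partial derivative of b_l = u_1...u_l with respect to u_j.\<close>
  define D where "D l j = (if j \<le> l then \<Prod>i\<in>{..l}-{j}. u $ i else 0)" for l j
  have dw: "((\<lambda>t. wcoord (u + axis j t) l) has_field_derivative D l j) (at 0)" for l j
  proof (cases "j \<le> l")
    case True
    have eq: "wcoord (u + axis j t) l = (u $ j + t) * D l j" for t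
    proof -
      have "wcoord (u + axis j t) l = (u + axis j t) $ j * (\<Prod>i\<in>{..l}-{j}. (u + axis j t) $ i)"
        unfolding wcoord_def by (rule prod.remove) (use True in auto)
      also have "(\<Prod>i\<in>{..l}-{j}. (u + axis j t) $ i) = D l j"
        using True unfolding D_def by (auto simp: axis_def intro!: prod.cong)
      finally show ?thesis by (simp add: axis_def)
    qed
    show ?thesis unfolding eq by (auto intro!: derivative_eq_intros)
  next
    case False
    have eq: "wcoord (u + axis j t) l = wcoord u l" for t
      unfolding wcoord_def using False by (intro prod.cong) (auto simp: axis_def)
    show ?thesis unfolding eq using False by (simp add: D_def)
  qed
  have J: "partial j (\<lambda>w. substitution \<beta> c w $ k) u = (\<Sum>l\<in>UNIV. of_real (coord c (\<beta> k) l) * D l j)" for j k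
    unfolding partial_def
    by (rule DERIV_imp_deriv) (auto simp: substitution_eq[OF \<beta> c] intro!: DERIV_sum DERIV_cmult dw)
  let ?C = "\<chi> k l. complex_of_real ((\<chi> k l. coord c (\<beta> k) l) $ k $ l)"
  let ?D = "\<chi> l j. D l j"
  have "(\<chi> i j. partial j (\<lambda>w. substitution \<beta> c w $ i) u) = ?C ** ?D"
    by (simp add: J matrix_matrix_mult_def)
  moreover have "det ?C = of_real (basis_det c \<beta>)"
    unfolding det_of_real basis_det_def ..
  moreover have "det ?D = (\<Prod>i\<in>UNIV. wcoord u i / u $ i)"
  proof -
    have "det ?D = (\<Prod>i\<in>UNIV. D i i)"
      by (subst det_lower_triangular) (auto simp: D_def)
    moreover have "D i i = wcoord u i / u $ i" for i
      unfolding D_def wcoord_def using punct_nonzero[OF u, of i]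
      by (subst (2) prod.remove[of _ i]) auto
    ultimately show ?thesis by simp
  qed
  ultimately show ?thesis
    unfolding pullback_def by (simp add: det_mul)
qed

lemma res_eq:
  assumes f: "has_res \<beta> c f r"
  shows "res \<beta> c f = of_real (basis_det c \<beta>) * r"
proof -
  obtain k where "lexp k (\<lambda>u. f (substitution \<beta> c u))" and r: "k (\<lambda>_. -1) = r"
    using f by (auto simp: has_res_def)
  then obtain \<epsilon> N where e: "\<epsilon> > 0" and N: "\<And>m j. k m \<noteq> 0 \<Longrightarrow> - int N \<le> tail m j"
    and h: "\<And>u. u\<in>punct \<epsilon> \<Longrightarrow> ((\<lambda>m. k m * lmon m u) has_sum f (substitution \<beta> c u)) UNIV"
    unfolding lexp_def by blast
  define d :: complex where "d = of_real (basis_det c \<beta>)"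
  define I where "I = {m::'s \<Rightarrow> int. \<forall>j. - int N \<le> tail m j}"
  \<comment> \<open>The exponent of u_j after clearing poles: \<open>tail m j\<close> from the
    monomial, \<open>card {j..}\<close> from the product of all b_i, and N from (u_1...u_s)^(Suc N)
    together with the factor 1/u_j of the Jacobian. On \<open>I\<close> the argument of
    \<open>nat\<close> is nonnegative.\<close>
  define \<mu> where "\<mu> m j = nat (tail m j + int (card {j..}) + int N)" for m :: "'s \<Rightarrow> int" and j
  have main: "((\<lambda>m. d * k m * (\<Prod>j\<in>UNIV. (u $ j) ^ \<mu> m j)) has_sum
      (\<Prod>i\<in>UNIV. u $ i) ^ Suc N * pullback \<beta> c f u) I" if u: "u \<in> punct \<epsilon>" for u
  proof -
    let ?w = "\<Prod>i\<in>UNIV. wcoord u i" and ?p = "\<Prod>i\<in>UNIV. u $ i"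
    have nz: "u $ j \<noteq> 0" for j using punct_nonzero[OF u] .
    have "((\<lambda>m. (d * ?w * ?p ^ N) * (k m * lmon m u)) has_sum
        (d * ?w * ?p ^ N) * f (substitution \<beta> c u)) UNIV"
      by (rule has_sum_cmult_right[OF h[OF u]])
    moreover have "(d * ?w * ?p ^ N) * f (substitution \<beta> c u) = ?p ^ Suc N * pullback \<beta> c f u"
    proof -
      have "?p * (\<Prod>i\<in>UNIV. wcoord u i / u $ i) = ?w"
        by (simp add: prod_dividef nz)
      then show ?thesis
        unfolding pullback_eq[OF u] d_def by (simp add: mult_ac)
    qed
    moreover have "d * ?w * ?p ^ N * (k m * lmon m u) = d * k m * (\<Prod>j\<in>UNIV. (u $ j) ^ \<mu> m j)"
      if "m \<in> I" for m
    proof -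
      have "?w = lmon (\<lambda>_. 1) u" by (simp add: lmon_def)
      then have "?w * ?p ^ N * lmon m u =
          (\<Prod>j\<in>UNIV. u $ j powi (tail m j + int (card {j..}) + int N))"
        by (simp add: lmon_tail nz tail_one power_int_add prod.distrib prod_power_distrib mult_ac)
      also have "\<dots> = (\<Prod>j\<in>UNIV. (u $ j) ^ \<mu> m j)"
      proof (intro prod.cong refl)
        fix j
        have "- int N \<le> tail m j" using that by (simp add: I_def)
        then have "0 \<le> tail m j + int (card {j..}) + int N" by linarith
        then show "u $ j powi (tail m j + int (card {j..}) + int N) = (u $ j) ^ \<mu> m j"
          by (simp add: \<mu>_def power_int_def)
      qed
      finally show ?thesis by (simp add: mult_ac)
    qed
    moreover have "k m = 0" if "m \<notin> I" for m using that N by (auto simp: I_def)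
    ultimately have s: "((\<lambda>m. (d * ?w * ?p ^ N) * (k m * lmon m u)) has_sum
        ?p ^ Suc N * pullback \<beta> c f u) UNIV"
      and t: "\<And>m. m \<in> I \<Longrightarrow> d * ?w * ?p ^ N * (k m * lmon m u) = d * k m * (\<Prod>j\<in>UNIV. (u $ j) ^ \<mu> m j)"
      and k: "\<And>m. m \<notin> I \<Longrightarrow> k m = 0" by simp_all
    show ?thesis
      by (rule has_sum_cong_neutral[THEN iffD1, OF _ _ _ s])
         (simp, simp add: k, simp only: t Int_iff UNIV_I)
  qed
  define K where "K \<alpha> = infsum (\<lambda>m. d * k m) {m\<in>I. \<mu> m = \<alpha>}" for \<alpha>
  have "((\<lambda>\<alpha>. K \<alpha> * umon \<alpha> u) has_sum
      (\<Prod>i\<in>UNIV. u $ i) ^ Suc N * pullback \<beta> c f u) UNIV" if u: "u \<in> punct \<epsilon>" for u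
    unfolding K_def
    by (rule has_sum_regroup[where P = "punct \<epsilon>" and M = "\<lambda>\<alpha> (u :: (complex, 's) vec). \<Prod>j\<in>UNIV. (u $ j) ^ \<alpha> j", OF main])
       (use u punct_nonzero in auto)
  then have ex: "has_expansion (pullback \<beta> c f) (Suc N) K"
    using e by (auto simp: has_expansion_def punct_def)
  have "K (\<lambda>_. N) = d * r"
  proof -
    \<comment> \<open>Exponent N in every u_j means that all tails of m + 1 vanish, so the residue
      term comes from m = -1 alone.\<close>
    have "m = (\<lambda>_. -1)" if "m \<in> I" "\<mu> m = (\<lambda>_. N)" for m
    proof -
      have "tail (\<lambda>i. m i + 1) j = 0" for j
      proof -
        have "\<mu> m j = N" using that(2) by simp
        moreover have "- int N \<le> tail m j" using that(1) by (simp add: I_def)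
        ultimately show ?thesis unfolding tail_add tail_one \<mu>_def by linarith
      qed
      then have "m i + 1 = 0" for i by (rule tail_zero_imp_zero)
      then show ?thesis by (auto simp: fun_eq_iff eq_neg_iff_add_eq_0)
    qed
    then have sub: "{m\<in>I. \<mu> m = (\<lambda>_. N)} \<subseteq> {\<lambda>_. -1}" by blast
    have "\<mu> (\<lambda>_. -1) = (\<lambda>_. N)"
      by (simp add: \<mu>_def tail_def fun_eq_iff)
    then have "d * k m = 0" if "m \<in> {\<lambda>_. -1} - {m\<in>I. \<mu> m = (\<lambda>_. N)}" for m
      using that N[of m] by (auto simp: I_def)
    then have "infsum (\<lambda>m. d * k m) {m\<in>I. \<mu> m = (\<lambda>_. N)} = (\<Sum>\<^sub>\<infinity>m\<in>{\<lambda>_. -1}. d * k m)"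
      using sub by (intro infsum_cong_neutral) auto
    then show ?thesis unfolding K_def by (simp add: r)
  qed
  then show ?thesis
    unfolding res_def d_def[symmetric]
  proof (intro the_equality)
    show "\<exists>N k. has_expansion (pullback \<beta> c f) (Suc N) k \<and> d * r = k (\<lambda>_. N)"
      using ex \<open>K (\<lambda>_. N) = d * r\<close> by (intro exI[of _ N] exI[of _ K]) simp
    fix x assume "\<exists>N k. has_expansion (pullback \<beta> c f) (Suc N) k \<and> x = k (\<lambda>_. N)"
    then obtain N' k' where k': "has_expansion (pullback \<beta> c f) (Suc N') k'" "x = k' (\<lambda>_. N')"
      by blast
    then show "x = d * r"
      using has_expansion_unique[OF k'(1) ex] \<open>K (\<lambda>_. N) = d * r\<close> by simp
  qed
qed

end

section \<open>Sublattices and characters\<close>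

lemma int_span_iff:
  assumes "family_basis c"
  shows "v \<in> int_span c \<longleftrightarrow> (\<forall>i. coord c v i \<in> \<int>)"
proof
  assume "v \<in> int_span c"
  then show "\<forall>i. coord c v i \<in> \<int>"
    by (auto simp: int_span_def coord_combination[OF assms])
next
  assume int: "\<forall>i. coord c v i \<in> \<int>"
  have "v = (\<Sum>i\<in>UNIV. real_of_int \<lfloor>coord c v i\<rfloor> *\<^sub>R c i)"
    using family_basis_expand[OF assms, of v] int by simp
  then show "v \<in> int_span c"
    unfolding int_span_def by (rule range_eqI[of _ _ "\<lambda>i. \<lfloor>coord c v i\<rfloor>"])
qed

lemma coord_diff: "family_basis c \<Longrightarrow> coord c (v - w) i = coord c v i - coord c w i"
  using coord_add[of c v "- w" i] by (simp add: coord_minus)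

lemma
  assumes "family_basis c" and "v \<in> int_span c" and "w \<in> int_span c"
  shows int_span_add: "v + w \<in> int_span c" and int_span_diff: "v - w \<in> int_span c"
  using assms by (simp_all add: int_span_iff coord_add coord_diff)

lemma zero_in_int_span: "family_basis c \<Longrightarrow> 0 \<in> int_span c"
  by (simp add: int_span_iff)

lemma finite_functions: "finite B \<Longrightarrow> finite {f :: 's::finite \<Rightarrow> 'b. \<forall>i. f i \<in> B}"
  using finite_PiE[of "UNIV :: 's set" "\<lambda>_. B"] by (simp add: PiE_def Pi_def)

locale sublattice =
  fixes \<beta> c :: "'s::finite \<Rightarrow> 'v::real_vector"
  assumes \<beta>: "family_basis \<beta>" and c: "family_basis c" and sub: "\<And>i. c i \<in> int_span \<beta>"
begin

abbreviation cell :: "'v set" where "cell \<equiv> box_points (int_span \<beta>) c"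

lemma int_span_subset: "v \<in> int_span c \<Longrightarrow> v \<in> int_span \<beta>"
proof -
  assume v: "v \<in> int_span c"
  have "coord \<beta> v j = (\<Sum>i\<in>UNIV. coord c v i * coord \<beta> (c i) j)" for j
  proof -
    have "coord \<beta> v j = coord \<beta> (\<Sum>i\<in>UNIV. coord c v i *\<^sub>R c i) j"
      by (simp add: family_basis_expand[OF c])
    then show ?thesis by (simp add: coord_sum[OF \<beta>] coord_scale[OF \<beta>])
  qed
  then show ?thesis
    using v sub by (simp add: int_span_iff[OF \<beta>] int_span_iff[OF c] Ints_sum Ints_mult)
qed

lemma box_iff: "l \<in> cell \<longleftrightarrow>
    l \<in> int_span \<beta> \<and> (\<forall>i. 0 \<le> coord c l i \<and> coord c l i < 1)"
proof -
  have "(\<exists>p. (\<forall>i. 0 \<le> p i \<and> p i < 1) \<and> l = (\<Sum>i\<in>UNIV. p i *\<^sub>R c i)) \<longleftrightarrow>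
      (\<forall>i. 0 \<le> coord c l i \<and> coord c l i < 1)"
  proof
    assume "\<forall>i. 0 \<le> coord c l i \<and> coord c l i < 1"
    then show "\<exists>p. (\<forall>i. 0 \<le> p i \<and> p i < 1) \<and> l = (\<Sum>i\<in>UNIV. p i *\<^sub>R c i)"
      by (intro exI[of _ "coord c l"]) (simp add: family_basis_expand[OF c])
  qed (auto simp: coord_combination[OF c])
  then show ?thesis by (simp add: box_points_def)
qed

text \<open>Takes fractional parts of the coordinates in \<open>c\<close>: the representative of a
  coset in the fundamental box.\<close>

definition reduce :: "'v \<Rightarrow> 'v" where
  "reduce v = v - (\<Sum>i\<in>UNIV. real_of_int \<lfloor>coord c v i\<rfloor> *\<^sub>R c i)"

lemma reduce_diff: "v - reduce v \<in> int_span c"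
  by (simp add: reduce_def int_span_def)

lemma reduce_in_box: "v \<in> int_span \<beta> \<Longrightarrow> reduce v \<in> cell"
proof -
  assume v: "v \<in> int_span \<beta>"
  have "coord c (reduce v) i = frac (coord c v i)" for i
    by (simp add: reduce_def coord_diff[OF c] coord_combination[OF c] frac_def)
  moreover have "reduce v \<in> int_span \<beta>"
    using int_span_diff[OF \<beta> v int_span_subset[OF reduce_diff[of v]]] by simp
  ultimately show ?thesis unfolding box_iff by (simp only: frac_ge_0 frac_lt_1 simp_thms)
qed

lemma box_eqI:
  assumes "l \<in> cell" "l' \<in> cell" "l - l' \<in> int_span c"
  shows "l = l'"
proof -
  have "coord c l i = coord c l' i" for i
  proof -
    obtain n where n: "coord c l i - coord c l' i = of_int n"
      using assms(3) by (auto simp: int_span_iff[OF c] coord_diff[OF c] Ints_def)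
    have "0 \<le> coord c l i" "coord c l i < 1" "0 \<le> coord c l' i" "coord c l' i < 1"
      using assms(1,2) by (auto simp: box_iff)
    then have "real_of_int n < 1" "-1 < real_of_int n" using n by linarith+
    then have "n = 0" by linarith
    then show ?thesis using n by simp
  qed
  then have "(\<Sum>i\<in>UNIV. coord c l i *\<^sub>R c i) = (\<Sum>i\<in>UNIV. coord c l' i *\<^sub>R c i)" by simp
  then show ?thesis unfolding family_basis_expand[OF c] .
qed

text \<open>Box points have integral coordinates in \<open>\<beta>\<close>, and these are bounded by
  \<open>M\<close> because their coordinates in \<open>c\<close> lie between 0 and 1.\<close>

lemma finite_box: "finite cell"
proof -
  define M where "M = (\<Sum>i\<in>UNIV. \<Sum>j\<in>UNIV. \<bar>coord \<beta> (c i) j\<bar>)"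
  let ?F = "{f :: 's \<Rightarrow> int. \<forall>i. f i \<in> {- \<lceil>M\<rceil>..\<lceil>M\<rceil>}}"
  have "cell \<subseteq> (\<lambda>n. \<Sum>i\<in>UNIV. real_of_int (n i) *\<^sub>R \<beta> i) ` ?F"
  proof
    fix l assume l: "l \<in> cell"
    then obtain n where n: "l = (\<Sum>i\<in>UNIV. real_of_int (n i) *\<^sub>R \<beta> i)"
      using box_iff[THEN iffD1, OF l] unfolding int_span_def by blast
    have "\<bar>real_of_int (n j)\<bar> \<le> M" for j
    proof -
      have "real_of_int (n j) = coord \<beta> (\<Sum>i\<in>UNIV. coord c l i *\<^sub>R c i) j"
        unfolding family_basis_expand[OF c] n by (simp add: coord_combination[OF \<beta>])
      then have "\<bar>real_of_int (n j)\<bar> = \<bar>\<Sum>i\<in>UNIV. coord c l i * coord \<beta> (c i) j\<bar>"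
        by (simp add: coord_sum[OF \<beta>] coord_scale[OF \<beta>])
      also have "\<dots> \<le> (\<Sum>i\<in>UNIV. \<bar>coord c l i * coord \<beta> (c i) j\<bar>)" by (rule sum_abs)
      also have "\<dots> \<le> (\<Sum>i\<in>UNIV. \<Sum>j\<in>UNIV. \<bar>coord \<beta> (c i) j\<bar>)"
      proof (rule sum_mono)
        fix i
        have "\<bar>coord c l i * coord \<beta> (c i) j\<bar> \<le> 1 * \<bar>coord \<beta> (c i) j\<bar>"
          using l unfolding abs_mult by (intro mult_right_mono) (simp_all add: box_iff less_imp_le)
        also have "\<dots> \<le> (\<Sum>j\<in>UNIV. \<bar>coord \<beta> (c i) j\<bar>)"
          by simp (rule member_le_sum, auto)
        finally show "\<bar>coord c l i * coord \<beta> (c i) j\<bar> \<le> (\<Sum>j\<in>UNIV. \<bar>coord \<beta> (c i) j\<bar>)" .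
      qed
      finally show ?thesis by (simp add: M_def)
    qed
    then have "n j \<in> {- \<lceil>M\<rceil>..\<lceil>M\<rceil>}" for j
      using order_trans[OF _ le_of_int_ceiling[of M], of "\<bar>real_of_int (n j)\<bar>"]
      by (simp add: abs_le_iff)
    then show "l \<in> (\<lambda>n. \<Sum>i\<in>UNIV. real_of_int (n i) *\<^sub>R \<beta> i) ` ?F" using n by blast
  qed
  then show ?thesis by (rule finite_subset) (intro finite_imageI finite_functions, simp)
qed

lemma coset_eq_iff:
  "(\<lambda>m. l + m) ` int_span c = (\<lambda>m. l' + m) ` int_span c \<longleftrightarrow> l - l' \<in> int_span c"
proof
  assume eq: "(\<lambda>m. l + m) ` int_span c = (\<lambda>m. l' + m) ` int_span c"
  have "0 \<in> int_span c" by (rule zero_in_int_span[OF c])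
  then have "l \<in> (\<lambda>m. l' + m) ` int_span c" using eq by force
  then show "l - l' \<in> int_span c" by auto
next
  have sub: "(\<lambda>m. l + m) ` int_span c \<subseteq> (\<lambda>m. l' + m) ` int_span c"
    if "l - l' \<in> int_span c" for l l'
  proof
    fix x assume "x \<in> (\<lambda>m. l + m) ` int_span c"
    then have "x - l' \<in> int_span c"
      using int_span_add[OF c that] by (auto simp: algebra_simps)
    then show "x \<in> (\<lambda>m. l' + m) ` int_span c" by (rule rev_image_eqI) simp
  qed
  assume "l - l' \<in> int_span c"
  moreover from this have "l' - l \<in> int_span c"
    using int_span_diff[OF c zero_in_int_span[OF c]] by force
  ultimately show "(\<lambda>m. l + m) ` int_span c = (\<lambda>m. l' + m) ` int_span c"
    using sub by blast
qed

text \<open>The box is a system of representatives for the cosets of the sublattice.\<close>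

lemma lattice_index_eq: "lattice_index (int_span \<beta>) c = card cell"
proof -
  let ?C = "\<lambda>l. (\<lambda>m. l + m) ` int_span c"
  have "?C ` int_span \<beta> = ?C ` cell"
  proof
    show "?C ` int_span \<beta> \<subseteq> ?C ` cell"
    proof
      fix x assume "x \<in> ?C ` int_span \<beta>"
      then obtain l where l: "l \<in> int_span \<beta>" "x = ?C l" by blast
      then have "x = ?C (reduce l)" using coset_eq_iff[of l "reduce l"] reduce_diff by simp
      then show "x \<in> ?C ` cell" using reduce_in_box[OF l(1)] by blast
    qed
  qed (auto simp: box_points_def)
  moreover have "inj_on ?C cell"
    by (rule inj_onI) (simp add: coset_eq_iff box_eqI)
  ultimately show ?thesis by (simp add: lattice_index_def card_image)
qed

lemma card_box_pos: "card cell > 0"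
proof -
  have "0 \<in> cell" by (simp add: box_iff int_span_iff[OF \<beta>])
  then show ?thesis using finite_box by (auto simp: card_gt_0_iff)
qed

text \<open>Translation by \<open>m\<close> followed by reduction permutes the box and multiplies
  the sum by \<open>ch m\<close>, which is not 1.\<close>

lemma character_sum:
  fixes ch :: "'v \<Rightarrow> complex"
  assumes add: "\<And>v w. ch (v + w) = ch v * ch w" and triv: "\<And>v. v \<in> int_span c \<Longrightarrow> ch v = 1"
    and m: "m \<in> int_span \<beta>" "ch m \<noteq> 1"
  shows "(\<Sum>l\<in>cell. ch l) = 0"
proof -
  let ?R = "cell"
  define T where "T l = reduce (l + m)" for l
  have "T ` ?R \<subseteq> ?R"
    using m by (auto simp: T_def box_points_def intro!: reduce_in_box[unfolded box_points_def] int_span_add[OF \<beta>])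
  moreover have inj: "inj_on T ?R"
  proof (rule inj_onI)
    fix l l' assume l: "l \<in> ?R" "l' \<in> ?R" "T l = T l'"
    have "(l + m - T l) - (l' + m - T l') \<in> int_span c"
      unfolding T_def by (intro int_span_diff[OF c] reduce_diff)
    then show "l = l'" using l by (intro box_eqI) simp_all
  qed
  ultimately have bij: "T ` ?R = ?R" by (rule endo_inj_surj[OF finite_box])
  have "ch (T l) = ch m * ch l" for l
  proof -
    have "ch (l + m) = ch (T l) * ch (l + m - T l)"
      using add[of "T l" "l + m - T l"] by simp
    moreover have "ch (l + m - T l) = 1" by (intro triv) (simp add: T_def reduce_diff)
    ultimately show ?thesis by (simp add: add mult.commute)
  qed
  then have "(\<Sum>l\<in>?R. ch l) = ch m * (\<Sum>l\<in>?R. ch l)"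
    using sum.reindex[OF inj, of ch] by (simp add: bij flip: sum_distrib_left)
  then have "(1 - ch m) * (\<Sum>l\<in>?R. ch l) = 0" by (simp add: ring_distribs)
  then show ?thesis using m by auto
qed

text \<open>Pigeonhole: among card cell + 1 reduced multiples of \<open>v\<close> two
  coincide.\<close>

lemma multiple_in_sublattice:
  assumes v: "v \<in> int_span \<beta>"
  shows "\<exists>n>0. n \<le> card cell \<and> real n *\<^sub>R v \<in> int_span c"
proof -
  let ?R = "cell"
  let ?f = "\<lambda>n::nat. reduce (real n *\<^sub>R v)"
  have nv: "real n *\<^sub>R v \<in> int_span \<beta>" for n
    using v by (auto simp: int_span_iff[OF \<beta>] coord_scale[OF \<beta>])
  have "\<not> inj_on ?f {0..card ?R}"
  proof
    assume inj: "inj_on ?f {0..card ?R}"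
    have "card (?f ` {0..card ?R}) \<le> card ?R"
      by (rule card_mono[OF finite_box]) (auto intro: reduce_in_box nv)
    then show False by (simp add: card_image[OF inj])
  qed
  then obtain a b where ab: "a < b" "b \<le> card ?R" "?f a = ?f b"
    unfolding inj_on_def by (metis atLeastAtMost_iff linorder_neqE_nat)
  have "(real b *\<^sub>R v - ?f b) - (real a *\<^sub>R v - ?f a) \<in> int_span c"
    by (intro int_span_diff[OF c] reduce_diff)
  moreover have "(real b *\<^sub>R v - ?f b) - (real a *\<^sub>R v - ?f a) = real (b - a) *\<^sub>R v"
    using ab by (simp add: of_nat_diff scaleR_left_diff_distrib)
  ultimately show ?thesis using ab by (intro exI[of _ "b - a"]) auto
qed

lemma exp_pairing_int_span:
  assumes "\<And>i. exp (pairing \<beta> \<phi> (c i)) = 1" and v: "v \<in> int_span c"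
  shows "exp (pairing \<beta> \<phi> v) = 1"
proof -
  obtain n :: "'s \<Rightarrow> int" where "v = (\<Sum>i\<in>UNIV. real_of_int (n i) *\<^sub>R c i)"
    using v by (auto simp: int_span_def)
  then have "exp (pairing \<beta> \<phi> v) = (\<Prod>i\<in>UNIV. exp (of_int (n i) * pairing \<beta> \<phi> (c i)))"
    by (simp add: pairing_sum[OF \<beta>] pairing_scale[OF \<beta>] exp_sum)
  also have "\<dots> = 1" by (simp add: exp_power_int[symmetric] assms(1))
  finally show ?thesis .
qed

text \<open>A point is determined by its values on the lattice basis, and each value is a root of
  unity. The factorial is a common exponent, as for each basis vector one only knows that some
  exponent up to \<open>card cell\<close> works.\<close>

lemma finite_torus_points:
  "finite {torus_point (int_span \<beta>) \<beta> \<phi> | \<phi>. \<forall>i. exp (pairing \<beta> \<phi> (c i)) = 1}"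
proof -
  define K where "K = (fact (card cell) :: nat)"
  define G where "G f = restrict (\<lambda>l. \<Prod>i\<in>UNIV. (f i :: complex) powi \<lfloor>coord \<beta> l i\<rfloor>) (int_span \<beta>)" for f
  have "torus_point (int_span \<beta>) \<beta> \<phi> \<in> G ` {f. \<forall>i. f i \<in> {z. z ^ K = 1}}"
    if \<phi>: "\<forall>i. exp (pairing \<beta> \<phi> (c i)) = 1" for \<phi>
  proof (rule image_eqI)
    show "(\<lambda>i. exp (pairing \<beta> \<phi> (\<beta> i))) \<in> {f. \<forall>i. f i \<in> {z. z ^ K = 1}}"
    proof safe
      fix i
      have "\<beta> i \<in> int_span \<beta>" by (simp add: int_span_iff[OF \<beta>] coord_basis[OF \<beta>])
      from multiple_in_sublattice[OF this] obtain n where n: "n > 0"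
        "n \<le> card cell" "real n *\<^sub>R \<beta> i \<in> int_span c" by blast
      have "exp (pairing \<beta> \<phi> (\<beta> i)) ^ n = exp (pairing \<beta> \<phi> (real n *\<^sub>R \<beta> i))"
        by (simp add: pairing_scale[OF \<beta>] exp_of_nat_mult)
      also have "\<dots> = 1" by (rule exp_pairing_int_span[OF \<phi>[rule_format] n(3)])
      finally have 1: "exp (pairing \<beta> \<phi> (\<beta> i)) ^ n = 1" .
      have "n dvd K" unfolding K_def using n by (intro dvd_fact) auto
      then obtain k where "K = n * k" by auto
      then show "exp (pairing \<beta> \<phi> (\<beta> i)) ^ K = 1" using 1 by (simp add: power_mult)
    qed
    show "torus_point (int_span \<beta>) \<beta> \<phi> = G (\<lambda>i. exp (pairing \<beta> \<phi> (\<beta> i)))"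
    proof -
      have "exp (pairing \<beta> \<phi> l) = (\<Prod>i\<in>UNIV. exp (pairing \<beta> \<phi> (\<beta> i)) powi \<lfloor>coord \<beta> l i\<rfloor>)"
        if "l \<in> int_span \<beta>" for l
      proof -
        have "of_int \<lfloor>coord \<beta> l i\<rfloor> = coord \<beta> l i" for i
          using that by (simp add: int_span_iff[OF \<beta>])
        then have "(of_int \<lfloor>coord \<beta> l i\<rfloor> :: complex) = of_real (coord \<beta> l i)" for i
          by (metis of_real_of_int_eq)
        then have "(\<Prod>i\<in>UNIV. exp (pairing \<beta> \<phi> (\<beta> i)) powi \<lfloor>coord \<beta> l i\<rfloor>) =
            exp (\<Sum>i\<in>UNIV. of_real (coord \<beta> l i) * pairing \<beta> \<phi> (\<beta> i))"
          by (simp add: exp_power_int exp_sum)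
        also have "(\<Sum>i\<in>UNIV. of_real (coord \<beta> l i) * pairing \<beta> \<phi> (\<beta> i)) = pairing \<beta> \<phi> l"
          using pairing_expand[OF \<beta> \<beta>, of \<phi> l] by simp
        finally show ?thesis by simp
      qed
      then show ?thesis by (auto simp: torus_point_def G_def fun_eq_iff)
    qed
  qed
  then have "{torus_point (int_span \<beta>) \<beta> \<phi> | \<phi>. \<forall>i. exp (pairing \<beta> \<phi> (c i)) = 1} \<subseteq>
      G ` {f. \<forall>i. f i \<in> {z. z ^ K = 1}}"
    by clarify
  moreover have "finite {z::complex. z ^ K = 1}"
    by (rule finite_roots_unity) (simp add: K_def Suc_leI)
  ultimately show ?thesis
    by (rule finite_subset[OF _ finite_imageI[OF finite_functions]])
qed

end

lemma finite_bases: "finite (bases Z :: ('s::{finite,linorder} \<Rightarrow> nat) set)"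
proof (rule finite_subset)
  show "bases Z \<subseteq> {b :: 's \<Rightarrow> nat. \<forall>i. b i \<in> {..<length Z}}" by (auto simp: bases_def)
qed (rule finite_functions, simp)

lemma finite_no_broken_bases: "finite (no_broken_bases Z :: ('s::{finite,linorder} \<Rightarrow> nat) set)"
  by (rule finite_subset[OF _ finite_bases[of Z]]) (auto simp: no_broken_bases_def)

lemma finite_arrangement_points:
  fixes \<beta> :: "'s::{finite,linorder} \<Rightarrow> 'v::real_vector"
  assumes \<beta>: "family_basis \<beta>" and X: "set X \<subseteq> int_span \<beta>"
  shows "finite (arrangement_points (int_span \<beta>) \<beta> X)"
proof -
  have "arrangement_points (int_span \<beta>) \<beta> X \<subseteq> (\<Union>b\<in>(bases X :: ('s \<Rightarrow> nat) set). {torus_point (int_span \<beta>) \<beta> \<phi> | \<phi>.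
      \<forall>i. exp (pairing \<beta> \<phi> (extracted X b i)) = 1})"
  proof
    fix p assume "p \<in> arrangement_points (int_span \<beta>) \<beta> X"
    then obtain \<phi> and b :: "'s \<Rightarrow> nat" where "p = torus_point (int_span \<beta>) \<beta> \<phi>" "b \<in> bases X"
      "\<forall>i. exp (pairing \<beta> \<phi> (extracted X b i)) = 1"
      by (auto simp: arrangement_points_def)
    then show "p \<in> (\<Union>b\<in>(bases X :: ('s \<Rightarrow> nat) set). {torus_point (int_span \<beta>) \<beta> \<phi> | \<phi>.
        \<forall>i. exp (pairing \<beta> \<phi> (extracted X b i)) = 1})"
      by (intro UN_I[of b] CollectI exI[of _ \<phi>] conjI)
  qed
  moreover have "finite {torus_point (int_span \<beta>) \<beta> \<phi> | \<phi>. \<forall>i. exp (pairing \<beta> \<phi> (extracted X b i)) = 1}"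
    if "b \<in> bases X" for b :: "'s \<Rightarrow> nat"
  proof -
    have "sublattice \<beta> (extracted X b)"
      using that \<beta> X by unfold_locales (auto simp: bases_def extracted_def)
    then show ?thesis by (rule sublattice.finite_torus_points)
  qed
  ultimately show ?thesis
    using finite_bases[of X] by (rule_tac finite_subset[OF _ finite_UN_I])
qed

section \<open>Taylor coefficients\<close>

lemma partial_shift: "partial i F (\<phi> + z) = partial i (\<lambda>x. F (\<phi> + x)) z"
  by (simp add: partial_def add.assoc)

lemma partials_shift: "partials \<gamma> F (\<phi> + z) = partials \<gamma> (\<lambda>x. F (\<phi> + x)) z"
proof -
  have 1: "(\<lambda>z. (partial i ^^ n) F (\<phi> + z)) = (partial i ^^ n) (\<lambda>z. F (\<phi> + z))" for i n F
    by (induction n) (simp_all add: partial_shift)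
  have "(\<lambda>z. fold (\<lambda>i. partial i ^^ \<gamma> i) xs F (\<phi> + z)) = fold (\<lambda>i. partial i ^^ \<gamma> i) xs (\<lambda>z. F (\<phi> + z))" for xs
    by (induction xs arbitrary: F) (simp_all add: 1)
  from fun_cong[OF this] show ?thesis by (simp add: partials_def)
qed

text \<open>Sums of products of entire functions of one variable each cover both Taylor coefficients
  that occur: one product for the exponential, a sum of monomials for a polynomial. Partial
  derivatives act on them factor by factor.\<close>

lemma partial_separable:
  fixes p :: "'x \<Rightarrow> 's::finite \<Rightarrow> complex \<Rightarrow> complex"
  assumes "\<And>x j. x \<in> A \<Longrightarrow> p x j holomorphic_on UNIV"
  shows "partial i (\<lambda>z. \<Sum>x\<in>A. k x * (\<Prod>j\<in>UNIV. p x j (z $ j))) =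
    (\<lambda>z. \<Sum>x\<in>A. k x * (\<Prod>j\<in>UNIV. (if j = i then deriv (p x j) else p x j) (z $ j)))"
proof
  fix z
  have eq: "(\<Prod>j\<in>UNIV. p x j ((z + axis i t) $ j)) = p x i (z $ i + t) * (\<Prod>j\<in>UNIV-{i}. p x j (z $ j))" for x t
    by (subst prod.remove[of _ i]) (auto simp: axis_def intro!: prod.cong)
  have d: "((\<lambda>t. k x * (p x i (z $ i + t) * (\<Prod>j\<in>UNIV-{i}. p x j (z $ j)))) has_field_derivative
      k x * (deriv (p x i) (z $ i) * (\<Prod>j\<in>UNIV-{i}. p x j (z $ j)))) (at 0)" if "x \<in> A" for x
  proof -
    have "(p x i has_field_derivative deriv (p x i) (z $ i)) (at (z $ i + 0))"
      using holomorphic_derivI[OF assms[OF that] open_UNIV UNIV_I] by simp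
    moreover have "((\<lambda>t. z $ i + t) has_field_derivative 1) (at 0)"
      by (auto intro!: derivative_eq_intros)
    ultimately have "((\<lambda>t. p x i (z $ i + t)) has_field_derivative deriv (p x i) (z $ i) * 1) (at 0)"
      by (rule DERIV_chain'[rotated])
    then have "((\<lambda>t. p x i (z $ i + t)) has_field_derivative deriv (p x i) (z $ i)) (at 0)"
      by simp
    then show ?thesis by (intro DERIV_cmult DERIV_cmult_right)
  qed
  have "partial i (\<lambda>z. \<Sum>x\<in>A. k x * (\<Prod>j\<in>UNIV. p x j (z $ j))) z =
      (\<Sum>x\<in>A. k x * (deriv (p x i) (z $ i) * (\<Prod>j\<in>UNIV-{i}. p x j (z $ j))))"
    unfolding partial_def eq by (intro DERIV_imp_deriv DERIV_sum d)
  also have "\<dots> = (\<Sum>x\<in>A. k x * (\<Prod>j\<in>UNIV. (if j = i then deriv (p x j) else p x j) (z $ j)))"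
    by (intro sum.cong refl, subst (2) prod.remove[of _ i]) (auto intro!: prod.cong)
  finally show "partial i (\<lambda>z. \<Sum>x\<in>A. k x * (\<Prod>j\<in>UNIV. p x j (z $ j))) z =
      (\<Sum>x\<in>A. k x * (\<Prod>j\<in>UNIV. (if j = i then deriv (p x j) else p x j) (z $ j)))" .
qed

lemma partial_power_separable:
  fixes p :: "'x \<Rightarrow> 's::finite \<Rightarrow> complex \<Rightarrow> complex"
  assumes "\<And>x j. x \<in> A \<Longrightarrow> p x j holomorphic_on UNIV"
  shows "(partial i ^^ n) (\<lambda>z. \<Sum>x\<in>A. k x * (\<Prod>j\<in>UNIV. p x j (z $ j))) =
    (\<lambda>z. \<Sum>x\<in>A. k x * (\<Prod>j\<in>UNIV. (if j = i then (deriv ^^ n) (p x j) else p x j) (z $ j)))"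
proof (induction n)
  case 0
  show ?case by (simp only: funpow_0 if_cancel)
next
  case (Suc n)
  let ?p = "\<lambda>x j. if j = i then (deriv ^^ n) (p x j) else p x j"
  have "(partial i ^^ Suc n) (\<lambda>z. \<Sum>x\<in>A. k x * (\<Prod>j\<in>UNIV. p x j (z $ j))) =
      partial i (\<lambda>z. \<Sum>x\<in>A. k x * (\<Prod>j\<in>UNIV. ?p x j (z $ j)))"
    by (simp add: Suc)
  also have "\<dots> = (\<lambda>z. \<Sum>x\<in>A. k x * (\<Prod>j\<in>UNIV. (if j = i then deriv (?p x j) else ?p x j) (z $ j)))"
    by (rule partial_separable) (auto intro: assms holomorphic_higher_deriv)
  also have "\<dots> = (\<lambda>z. \<Sum>x\<in>A. k x * (\<Prod>j\<in>UNIV. (if j = i then (deriv ^^ Suc n) (p x j) else p x j) (z $ j)))"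
    by (intro ext sum.cong arg_cong2[where f = "(*)"] prod.cong refl) auto
  finally show ?case .
qed

lemma partials_separable:
  fixes p :: "'x \<Rightarrow> 's::{finite,linorder} \<Rightarrow> complex \<Rightarrow> complex"
  assumes hol: "\<And>x j. x \<in> A \<Longrightarrow> p x j holomorphic_on UNIV"
  shows "partials \<alpha> (\<lambda>z. \<Sum>x\<in>A. k x * (\<Prod>j\<in>UNIV. p x j (z $ j))) =
    (\<lambda>z. \<Sum>x\<in>A. k x * (\<Prod>j\<in>UNIV. (deriv ^^ \<alpha> j) (p x j) (z $ j)))"
proof -
  have "fold (\<lambda>i. partial i ^^ \<alpha> i) xs (\<lambda>z. \<Sum>x\<in>A. k x * (\<Prod>j\<in>UNIV. p x j (z $ j))) =
      (\<lambda>z. \<Sum>x\<in>A. k x * (\<Prod>j\<in>UNIV. (if j \<in> set xs then (deriv ^^ \<alpha> j) (p x j) else p x j) (z $ j)))"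
    if "distinct xs" for xs
    using that
  proof (induction xs rule: rev_induct)
    case Nil
    then show ?case by simp
  next
    case (snoc i xs)
    let ?p = "\<lambda>x j. if j \<in> set xs then (deriv ^^ \<alpha> j) (p x j) else p x j"
    have "fold (\<lambda>i. partial i ^^ \<alpha> i) (xs @ [i]) (\<lambda>z. \<Sum>x\<in>A. k x * (\<Prod>j\<in>UNIV. p x j (z $ j))) =
        (partial i ^^ \<alpha> i) (\<lambda>z. \<Sum>x\<in>A. k x * (\<Prod>j\<in>UNIV. ?p x j (z $ j)))"
      using snoc by simp
    also have "\<dots> = (\<lambda>z. \<Sum>x\<in>A. k x * (\<Prod>j\<in>UNIV. (if j = i then (deriv ^^ \<alpha> i) (?p x j) else ?p x j) (z $ j)))"
      by (rule partial_power_separable) (auto intro: hol holomorphic_higher_deriv)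
    also have "\<dots> = (\<lambda>z. \<Sum>x\<in>A. k x * (\<Prod>j\<in>UNIV. (if j \<in> set (xs @ [i]) then (deriv ^^ \<alpha> j) (p x j) else p x j) (z $ j)))"
      using snoc.prems
      by (intro ext sum.cong arg_cong2[where f = "(*)"] prod.cong refl) auto
    finally show ?case .
  qed
  from this[of "sorted_list_of_set UNIV", OF distinct_sorted_list_of_set] show ?thesis
    unfolding partials_def set_sorted_list_of_set[OF finite_class.finite_UNIV] by simp
qed

lemma higher_deriv_exp_scale: "(deriv ^^ n) (\<lambda>t. exp (t * a)) = (\<lambda>t. a ^ n * exp (t * a :: complex))"
proof (induction n)
  case (Suc n)
  have "deriv (\<lambda>t. a ^ n * exp (t * a)) t = a ^ Suc n * exp (t * a)" for t
    by (rule DERIV_imp_deriv) (auto intro!: derivative_eq_intros)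
  then show ?case by (simp add: Suc fun_eq_iff)
qed simp

lemma higher_deriv_monomial_0: "(deriv ^^ n) (\<lambda>t::complex. t ^ m) 0 = (if n = m then fact n else 0)"
proof -
  \<comment> \<open>The quotient of factorials is the falling factorial; a formula valid at every
    \<open>t\<close> is needed to iterate the derivative.\<close>
  have "(deriv ^^ n) (\<lambda>t::complex. t ^ m) =
      (\<lambda>t. if n \<le> m then of_nat (fact m div fact (m - n)) * t ^ (m - n) else 0)"
  proof (induction n)
    case (Suc n)
    have "deriv (\<lambda>t::complex. if n \<le> m then of_nat (fact m div fact (m - n)) * t ^ (m - n) else 0) t =
        (if Suc n \<le> m then of_nat (fact m div fact (m - Suc n)) * t ^ (m - Suc n) else 0)" for t
    proof (cases "Suc n \<le> m")
      case True
      then obtain l where l: "m - n = Suc l" "m - Suc n = l"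
        by (metis Suc_diff_Suc Suc_le_lessD)
      have "fact (Suc l) dvd (fact m :: nat)" using l True by (intro fact_dvd) simp
      then obtain x :: nat where x: "fact m = fact (Suc l) * x" by auto
      have "fact m div fact (Suc l) * Suc l = (fact m div fact l :: nat)"
      proof -
        have "fact (Suc l) * x = fact l * (x * Suc l)" by (simp add: algebra_simps)
        then show ?thesis unfolding x by (metis fact_nonzero nonzero_mult_div_cancel_left)
      qed
      moreover have "deriv (\<lambda>t::complex. of_nat (fact m div fact (Suc l)) * t ^ Suc l) t =
          of_nat (fact m div fact (Suc l)) * (of_nat (Suc l) * t ^ l)"
        using DERIV_cmult[OF DERIV_power_Suc[OF DERIV_ident, of l t], of "of_nat (fact m div fact (Suc l))"]
        by (intro DERIV_imp_deriv) simp
      ultimately show ?thesis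
        using True l by (simp only: l Suc_leD if_True of_nat_mult[symmetric] mult.assoc[symmetric])
    next
      case False
      then have "n = m \<or> \<not> n \<le> m" by linarith
      then show ?thesis using False by auto
    qed
    then show ?case by (simp add: Suc fun_eq_iff)
  qed simp
  then show ?thesis by auto
qed

text \<open>In y the function is a constant times a product of exponentials, so this holds at every
  z; for \<open>D = 0\<close> both sides are 0 by the convention on division.\<close>

lemma taylor_coeff_exp:
  fixes z :: "(complex, 's::{finite,linorder}) vec"
  shows "taylor_coeff \<alpha> (\<lambda>y. exp (\<Sum>i\<in>UNIV. y $ i * z $ i) / D) = div_power \<alpha> z * inverse D"
proof -
  have "(\<lambda>y. exp (\<Sum>i\<in>UNIV. y $ i * z $ i) / D) =
      (\<lambda>y. \<Sum>x\<in>{()}. inverse D * (\<Prod>i\<in>UNIV. (\<lambda>t. exp (t * z $ i)) (y $ i)))"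
    by (simp add: exp_sum divide_inverse mult.commute)
  moreover have "partials \<alpha> (\<lambda>y. \<Sum>x\<in>{()}. inverse D * (\<Prod>i\<in>UNIV. (\<lambda>t. exp (t * z $ i)) (y $ i))) =
      (\<lambda>y. \<Sum>x\<in>{()}. inverse D * (\<Prod>i\<in>UNIV. (deriv ^^ \<alpha> i) (\<lambda>t. exp (t * z $ i)) (y $ i)))"
    by (rule partials_separable) (intro holomorphic_intros)
  ultimately show ?thesis
    by (simp add: taylor_coeff_def higher_deriv_exp_scale div_power_def prod_dividef)
qed

text \<open>At 0 only the monomial y^\<alpha> survives, and the argument -y gives the sign that
  integration by parts will produce on the other side.\<close>

lemma taylor_coeff_eval_polynomial:
  "taylor_coeff \<alpha> (\<lambda>y. eval_polynomial q (- y)) =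
    (-1) ^ (\<Sum>i\<in>UNIV. \<alpha> i) * Poly_Mapping.lookup q \<alpha>"
proof -
  let ?K = "Poly_Mapping.keys q" and ?c = "Poly_Mapping.lookup q"
  let ?k = "\<lambda>\<gamma>. ?c \<gamma> * (-1) ^ (\<Sum>i\<in>UNIV. \<gamma> i)"
  have "(\<lambda>y. eval_polynomial q (- y)) = (\<lambda>y. \<Sum>\<gamma>\<in>?K. ?k \<gamma> * (\<Prod>j\<in>UNIV. (\<lambda>t. t ^ \<gamma> j) (y $ j)))"
  proof
    fix y :: "(complex, 'a) vec"
    have "(\<Prod>i\<in>UNIV. ((- y) $ i) ^ \<gamma> i) = (-1) ^ (\<Sum>i\<in>UNIV. \<gamma> i) * (\<Prod>i\<in>UNIV. (y $ i) ^ \<gamma> i)"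
      for \<gamma> :: "'a \<Rightarrow> nat"
      by (simp add: power_minus[of "y $ _"] prod.distrib power_sum)
    then show "eval_polynomial q (- y) = (\<Sum>\<gamma>\<in>?K. ?k \<gamma> * (\<Prod>j\<in>UNIV. (\<lambda>t. t ^ \<gamma> j) (y $ j)))"
      by (simp add: eval_polynomial_def mult.assoc)
  qed
  moreover have "partials \<alpha> (\<lambda>y. \<Sum>\<gamma>\<in>?K. ?k \<gamma> * (\<Prod>j\<in>UNIV. (\<lambda>t. t ^ \<gamma> j) (y $ j))) =
      (\<lambda>y. \<Sum>\<gamma>\<in>?K. ?k \<gamma> * (\<Prod>j\<in>UNIV. (deriv ^^ \<alpha> j) (\<lambda>t. t ^ \<gamma> j) (y $ j)))"
    by (rule partials_separable) (intro holomorphic_intros)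
  ultimately have "partials \<alpha> (\<lambda>y. eval_polynomial q (- y)) 0 =
      (\<Sum>\<gamma>\<in>?K. ?k \<gamma> * (\<Prod>j\<in>UNIV. if \<alpha> j = \<gamma> j then fact (\<alpha> j) else 0))"
    by (simp add: higher_deriv_monomial_0)
  also have "\<dots> = (\<Sum>\<gamma>\<in>?K. if \<gamma> = \<alpha> then ?k \<alpha> * (\<Prod>j\<in>UNIV. fact (\<alpha> j)) else 0)"
  proof (intro sum.cong refl)
    fix \<gamma>
    show "?k \<gamma> * (\<Prod>j\<in>UNIV. if \<alpha> j = \<gamma> j then fact (\<alpha> j) else 0) =
        (if \<gamma> = \<alpha> then ?k \<alpha> * (\<Prod>j\<in>UNIV. fact (\<alpha> j)) else 0)"
    proof (cases "\<gamma> = \<alpha>")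
      case False
      then obtain j where "\<alpha> j \<noteq> \<gamma> j" by (metis ext)
      then have "(\<Prod>j\<in>UNIV. if \<alpha> j = \<gamma> j then fact (\<alpha> j) else (0::complex)) = 0"
        by (intro prod_zero) auto
      then show ?thesis using False by simp
    qed simp
  qed
  also have "\<dots> = ?k \<alpha> * (\<Prod>j\<in>UNIV. fact (\<alpha> j))"
    by (simp add: in_keys_iff)
  finally show ?thesis
    by (simp add: taylor_coeff_def)
qed

section \<open>Polar parts of the generators\<close>

text \<open>The solutions of e^(-t) = 1 are the multiples of 2 \<pi> i, and the nonzero ones lie
  outside the unit disc.\<close>

lemma exp_minus_neq_1:
  assumes "norm (t::complex) < 1" and "t \<noteq> 0"
  shows "exp (- t) \<noteq> 1"
proof
  assume "exp (- t) = 1"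
  then obtain n :: int where n: "Re t = 0" "- Im t = of_int (2 * n) * pi"
    by (auto simp: exp_eq_1)
  have "\<bar>Im t\<bar> < 1" using abs_Im_le_cmod[of t] assms by simp
  then have "\<bar>real_of_int n\<bar> * (2 * pi) < 1"
    using n(2) by (simp add: abs_mult mult_ac flip: abs_minus_cancel[of "Im t"])
  moreover have "1 \<le> \<bar>real_of_int n\<bar> * (2 * pi)" if "n \<noteq> 0"
  proof -
    have "1 * 1 \<le> \<bar>real_of_int n\<bar> * (2 * pi)"
      by (intro mult_mono) (use that pi_ge_two in auto)
    then show ?thesis by simp
  qed
  ultimately have "n = 0" by force
  then have "t = 0" using n by (simp add: complex_eq_iff)
  then show False using assms by simp
qed

text \<open>Removable singularities are filled in twice: \<open>h\<close> extends (1 - e^(-t))/t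
  with value 1 at 0, and \<open>?g\<close> extends the quotient minus its pole. The parameter
  \<open>p\<close> allows the numerator of omega to be absorbed factor by factor.\<close>

lemma exp_quotient_polar_part:
  fixes p :: complex
  shows "\<exists>g. g holomorphic_on ball 0 1 \<and> (\<forall>t. norm t < 1 \<longrightarrow> t \<noteq> 0 \<longrightarrow>
    exp (p * t) * inverse (1 - exp (- t)) = inverse t + g t)"
proof -
  define f where "f = (\<lambda>t::complex. 1 - exp (- t))"
  define h where "h = (\<lambda>t. if t = 0 then deriv f 0 else (f t - f 0) / (t - 0))"
  have f': "deriv f 0 = 1"
    unfolding f_def by (rule DERIV_imp_deriv) (auto intro!: derivative_eq_intros)
  have "h holomorphic_on ball 0 1"
    unfolding h_def by (rule pole_lemma) (auto simp: f_def intro!: holomorphic_intros)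
  moreover have h0: "h t \<noteq> 0" if "t \<in> ball 0 1" for t
  proof (cases "t = 0")
    case False
    then show ?thesis using that exp_minus_neq_1[of t] by (simp add: h_def f_def)
  qed (simp add: h_def f')
  ultimately have E: "(\<lambda>t. exp (p * t) / h t) holomorphic_on ball 0 1" (is "?E holomorphic_on _")
    by (intro holomorphic_intros) auto
  let ?g = "\<lambda>t. if t = 0 then deriv ?E 0 else (?E t - ?E 0) / (t - 0)"
  have "?g holomorphic_on ball 0 1"
    by (rule pole_lemma[OF E]) auto
  moreover have "exp (p * t) * inverse (1 - exp (- t)) = inverse t + ?g t" if "norm t < 1" "t \<noteq> 0" for t
  proof -
    have "h t = (1 - exp (- t)) / t" using that by (simp add: h_def f_def)
    moreover have "h 0 = 1" by (simp add: h_def f')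
    ultimately
    show ?thesis
      using that exp_minus_neq_1[OF that] by (simp add: field_simps)
  qed
  ultimately show ?thesis by blast
qed

lemma pairing_small:
  assumes "\<epsilon> > 0"
  shows "\<exists>r>0. \<forall>z. norm z < r \<longrightarrow> norm (pairing \<beta> z a) < \<epsilon>"
proof -
  define C where "C = (\<Sum>i\<in>UNIV. \<bar>coord \<beta> a i\<bar>) + 1"
  have C: "C > 0" by (simp add: C_def add_nonneg_pos sum_nonneg)
  have "norm (pairing \<beta> z a) < \<epsilon>" if "norm z < \<epsilon> / C" for z
  proof -
    have "norm (pairing \<beta> z a) \<le> (\<Sum>i\<in>UNIV. \<bar>coord \<beta> a i\<bar> * norm z)"
      unfolding pairing_def
      by (rule order_trans[OF norm_sum])
         (auto simp: norm_mult intro!: sum_mono mult_left_mono Finite_Cartesian_Product.norm_nth_le)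
    also have "\<dots> \<le> C * norm z"
      by (simp add: C_def sum_distrib_right[symmetric] mult_right_mono)
    also have "\<dots> < \<epsilon>" using that C by (simp add: field_simps)
    finally show ?thesis .
  qed
  then show ?thesis using C assms by (intro exI[of _ "\<epsilon> / C"]) auto
qed

lemma finite_radius:
  assumes "finite A" and "\<And>a. a \<in> A \<Longrightarrow> \<exists>r>0. \<forall>z. norm z < r \<longrightarrow> P a z"
  shows "\<exists>r>(0::real). \<forall>z. norm z < r \<longrightarrow> (\<forall>a\<in>A. P a z)"
  using assms
proof (induction A rule: finite_induct)
  case empty
  then show ?case by (auto intro: exI[of _ 1])
next
  case (insert a A)
  then have "\<exists>r>0. \<forall>z. norm z < r \<longrightarrow> (\<forall>a\<in>A. P a z)" and "\<exists>r>0. \<forall>z. norm z < r \<longrightarrow> P a z"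
    by simp_all
  then obtain r r' where "r > 0" "\<forall>z. norm z < r \<longrightarrow> P a z" "r' > 0" "\<forall>z. norm z < r' \<longrightarrow> (\<forall>a\<in>A. P a z)"
    by blast
  then show ?case by (intro exI[of _ "min r r'"]) auto
qed

lemma germ_exp_pairing: "germ \<beta> S (\<lambda>z. exp (pairing \<beta> (\<phi> + z) l))"
proof -
  have "germ \<beta> S (\<lambda>z. (\<lambda>t. exp (pairing \<beta> \<phi> l + t)) (pairing \<beta> z l))"
    by (rule germ_pairing_comp[of 1]) (auto intro!: holomorphic_intros)
  then show ?thesis by (simp add: pairing_add_left)
qed

lemma nonresonant_radius:
  assumes "exp (x::complex) \<noteq> 1"
  shows "\<exists>\<epsilon>>0. \<forall>t. norm t < \<epsilon> \<longrightarrow> exp (- (x + t)) \<noteq> 1"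
proof -
  have "open {t. exp (- (x + t)) \<noteq> 1}"
    by (intro open_Collect_neq continuous_intros)
  moreover have "0 \<in> {t. exp (- (x + t)) \<noteq> 1}" using assms by (simp add: exp_minus)
  ultimately obtain \<epsilon> where "\<epsilon> > 0" "ball 0 \<epsilon> \<subseteq> {t. exp (- (x + t)) \<noteq> 1}"
    using open_contains_ball by blast
  then show ?thesis by (intro exI[of _ \<epsilon>]) auto
qed

text \<open>If e^<\<phi>|a> = 1, the factor is 1/a(z) plus a holomorphic function of a(z); otherwise
  it is holomorphic in a(z) near 0.\<close>

lemma germ_factor:
  assumes "exp (pairing \<beta> \<phi> a) = 1 \<Longrightarrow> a \<in> S"
  shows "germ \<beta> S (\<lambda>z. inverse (1 - exp (- pairing \<beta> (\<phi> + z) a)))"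
proof (cases "exp (pairing \<beta> \<phi> a) = 1")
  case True
  then have eq: "exp (- pairing \<beta> (\<phi> + z) a) = exp (- pairing \<beta> z a)" for z
    by (simp add: pairing_add_left exp_diff exp_minus divide_inverse)
  obtain g where g: "g holomorphic_on ball 0 1"
    "\<And>t. norm t < 1 \<Longrightarrow> t \<noteq> 0 \<Longrightarrow> exp (0 * t) * inverse (1 - exp (- t)) = inverse t + g t"
    using exp_quotient_polar_part[of 0] by blast
  obtain r where r: "r > 0" "\<And>z. norm z < r \<Longrightarrow> norm (pairing \<beta> z a) < 1"
    using pairing_small[of 1 \<beta> a] by auto
  have "germ \<beta> S (\<lambda>z. inverse (pairing \<beta> z a) + g (pairing \<beta> z a))"
    by (intro germ_add germ_inverse germ_pairing_comp[OF _ g(1)] assms True) simp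
  then show ?thesis
  proof (rule germ_cong[OF _ r(1)])
    fix z assume "z \<in> pole_free \<beta> S r"
    then have "norm (pairing \<beta> z a) < 1" "pairing \<beta> z a \<noteq> 0"
      using assms[OF True] r by (auto simp: pole_free_def)
    from g(2)[OF this]
    show "inverse (pairing \<beta> z a) + g (pairing \<beta> z a) = inverse (1 - exp (- pairing \<beta> (\<phi> + z) a))"
      by (simp add: eq)
  qed
next
  case False
  obtain \<epsilon> where e: "\<epsilon> > 0" "\<And>t. norm t < \<epsilon> \<Longrightarrow> exp (- (pairing \<beta> \<phi> a + t)) \<noteq> 1"
    using nonresonant_radius[OF False] by blast
  have "germ \<beta> S (\<lambda>z. (\<lambda>t. inverse (1 - exp (- (pairing \<beta> \<phi> a + t)))) (pairing \<beta> z a))"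
    by (rule germ_pairing_comp[OF e(1)]) (use e(2) in \<open>auto intro!: holomorphic_intros\<close>)
  then show ?thesis by (simp add: pairing_add_left)
qed

section \<open>The forms omega modulo null functions\<close>

lemma proper_subset_not_spanning:
  fixes c :: "'s::finite \<Rightarrow> 'v::real_vector"
  assumes c: "family_basis c" and S: "S \<subseteq> range c" "c i \<notin> S"
  shows "span S \<noteq> UNIV"
proof
  assume "span S = UNIV"
  then have "c i \<in> span (range c - {c i})"
    using span_mono[of S "range c - {c i}"] S by auto
  then show False using c unfolding family_basis_def dependent_def by blast
qed

text \<open>If every leading index occurred among the poles, they would span by
  triangularity.\<close>

lemma null_not_spanning:
  fixes e :: "'s::{finite,linorder} \<Rightarrow> 'v::real_vector"
  assumes "family_basis e" and "germ \<beta> S F" and "S \<subseteq> T" and "0 \<notin> T" and "span S \<noteq> UNIV"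
  shows "null \<beta> e T F"
proof -
  obtain j where "\<And>a. a \<in> S \<Longrightarrow> lead e a \<noteq> j"
    using span_eq_UNIV_if_all_leads[OF assms(1), of S] assms(3-5) by blast
  then show ?thesis using null_germ[OF assms(2,3)] by blast
qed

lemma null_partials:
  assumes "finite T" and "null \<beta> e T F"
  shows "null \<beta> e T (partials \<gamma> F)"
  using partials_induct2[of "\<lambda>F G. null \<beta> e T F" F F] null_partial[OF assms(1)] assms(2) by blast

lemma (in sublattice) omega_shift:
  "omega (int_span \<beta>) \<beta> c \<phi>' (\<phi> + z) =
    inverse (of_nat (card cell)) *
    (\<Sum>l\<in>cell. exp (- pairing \<beta> \<phi>' l) * exp (pairing \<beta> (\<phi> + z) l)) *
    (\<Prod>i\<in>UNIV. inverse (1 - exp (- pairing \<beta> (\<phi> + z) (c i))))"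
  by (simp add: omega_def e_phi_def lattice_index_eq divide_inverse prod_inversef[symmetric])

text \<open>The form omega belongs to the basis \<open>c\<close> and the point \<phi>' but is
  examined at \<phi>. There \<open>e\<close> is the basis that defines the residue, and
  \<open>T\<close> stands for the vectors of X_\<phi>.\<close>

locale pole_basis = sublattice \<beta> c
  for \<beta> c :: "'s::{finite,linorder} \<Rightarrow> 'v::real_vector" +
  fixes e :: "'s \<Rightarrow> 'v" and T :: "'v set" and \<phi> \<phi>' :: "(complex, 's) vec"
  assumes e: "family_basis e" and T: "finite T" "0 \<notin> T"
    and c_trivial: "\<And>i. exp (pairing \<beta> \<phi>' (c i)) = 1"
    and T_iff: "\<And>i. c i \<in> T \<longleftrightarrow> exp (pairing \<beta> \<phi> (c i)) = 1"
begin

text \<open>The pole of \<open>c i\<close> does not pass through \<phi>, and the other members of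
  \<open>c\<close> do not span.\<close>

lemma omega_null_if_off:
  assumes "c i \<notin> T"
  shows "null \<beta> e T (\<lambda>z. omega (int_span \<beta>) \<beta> c \<phi>' (\<phi> + z))"
proof (rule null_not_spanning[OF e])
  show "germ \<beta> (range c \<inter> T) (\<lambda>z. omega (int_span \<beta>) \<beta> c \<phi>' (\<phi> + z))"
    unfolding omega_shift
    by (intro germ_mult germ_const germ_sum germ_prod germ_exp_pairing germ_factor) (auto simp: T_iff)
  show "span (range c \<inter> T) \<noteq> UNIV"
    by (rule proper_subset_not_spanning[OF c, of _ i]) (use assms in auto)
qed (use T in auto)

text \<open>The value of e(\<phi>') at \<phi>, which is the mean over the box of the character l ->
  e^<\<phi>-\<phi>'|l>.\<close>

definition char_mean :: complex where
  "char_mean = inverse (of_nat (card cell)) *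
    (\<Sum>l\<in>cell. exp (- pairing \<beta> \<phi>' l) * exp (pairing \<beta> \<phi> l))"

text \<open>With t_i = c_i(z), the exponential e^<z|l> splits into factors e^(p_i t_i), and each of
  them divided by 1 - e^(-t_i) is 1/t_i plus a holomorphic function. When this is multiplied out
  over the set \<open>B\<close> of factors that keep their pole, only \<open>B = UNIV\<close> has
  spanning poles.\<close>

lemma omega_null_equiv:
  assumes on: "\<And>i. c i \<in> T"
  shows "null_equiv \<beta> e T (\<lambda>z. omega (int_span \<beta>) \<beta> c \<phi>' (\<phi> + z))
    (\<lambda>z. char_mean * (\<Prod>i\<in>UNIV. inverse (pairing \<beta> z (c i))))"
proof -
  let ?R = "cell"
  let ?ch = "\<lambda>l. exp (- pairing \<beta> \<phi>' l) * exp (pairing \<beta> \<phi> l)"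
  let ?N = "inverse (of_nat (card ?R)) :: complex"
  have "\<forall>p. \<exists>g. g holomorphic_on ball 0 1 \<and> (\<forall>t. norm t < 1 \<longrightarrow> t \<noteq> 0 \<longrightarrow>
    exp (p * t) * inverse (1 - exp (- t)) = inverse t + g t)" for p :: complex
    using exp_quotient_polar_part by blast
  from choice[OF this] obtain g where g0: "\<forall>p. g p holomorphic_on ball 0 1 \<and> (\<forall>t. norm t < 1 \<longrightarrow> t \<noteq> 0 \<longrightarrow>
    exp (p * t) * inverse (1 - exp (- t)) = inverse t + g p t)" by blast
  have g: "g p holomorphic_on ball 0 1" for p using g0 by blast
  have g_eq: "exp (p * t) * inverse (1 - exp (- t)) = inverse t + g p t" if "norm t < 1" "t \<noteq> 0" for p t
    using g0 that by blast
  let ?P = "\<lambda>l B z. (\<Prod>i\<in>B. inverse (pairing \<beta> z (c i))) *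
    (\<Prod>i\<in>UNIV-B. g (of_real (coord c l i)) (pairing \<beta> z (c i)))"
  define D where "D z = ?N * (\<Sum>l\<in>?R. ?ch l * (\<Sum>B\<in>Pow UNIV - {UNIV}.
      ?P l B z))" for z
  have D: "null \<beta> e T D"
    unfolding D_def[abs_def]
  proof (intro null_cmult null_sum)
    fix l and B :: "'s set" assume B: "B \<in> Pow UNIV - {UNIV}"
    then obtain i where i: "i \<notin> B" by auto
    show "null \<beta> e T (\<lambda>z. ?P l B z)"
    proof (rule null_not_spanning[OF e _ _ T(2)])
      show "germ \<beta> (c ` B) (\<lambda>z. ?P l B z)"
        by (intro germ_mult germ_prod germ_inverse germ_pairing_comp[OF _ g]) auto
      have "inj c" using c by (simp add: family_basis_def)
      then show "span (c ` B) \<noteq> UNIV"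
        by (intro proper_subset_not_spanning[OF c, of _ i]) (use i in \<open>auto dest: injD\<close>)
    qed (use on in auto)
  qed
  have G: "germ \<beta> T (\<lambda>z. char_mean * (\<Prod>i\<in>UNIV. inverse (pairing \<beta> z (c i))))"
    by (intro germ_cmult germ_prod germ_inverse on)
  obtain r where r: "r > 0" "\<And>z i. norm z < r \<Longrightarrow> norm (pairing \<beta> z (c i)) < 1"
    using finite_radius[of UNIV "\<lambda>i z. norm (pairing \<beta> z (c i)) < 1"] pairing_small[of 1 \<beta>] by auto
  have eq: "char_mean * (\<Prod>i\<in>UNIV. inverse (pairing \<beta> z (c i))) + D z =
      omega (int_span \<beta>) \<beta> c \<phi>' (\<phi> + z)" if z: "z \<in> pole_free \<beta> T r" for z
  proof -
    let ?t = "\<lambda>i. pairing \<beta> z (c i)"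
    have t: "norm (?t i) < 1" "?t i \<noteq> 0" for i
      using z r(2) on by (auto simp: pole_free_def)
    have fac: "exp (- pairing \<beta> (\<phi> + z) (c i)) = exp (- ?t i)" for i
      using T_iff[of i] on[of i] by (simp add: pairing_add_left exp_diff exp_minus divide_inverse)
    have summand: "exp (- pairing \<beta> \<phi>' l) * exp (pairing \<beta> (\<phi> + z) l) *
        (\<Prod>i\<in>UNIV. inverse (1 - exp (- ?t i))) =
      ?ch l * (\<Prod>i\<in>UNIV. inverse (?t i)) +
      ?ch l * (\<Sum>B\<in>Pow UNIV - {UNIV}. ?P l B z)" for l
    proof -
      have "exp (pairing \<beta> (\<phi> + z) l) = exp (pairing \<beta> \<phi> l) * (\<Prod>i\<in>UNIV. exp (of_real (coord c l i) * ?t i))"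
        by (simp add: pairing_add_left exp_add pairing_expand[OF \<beta> c, of z l] exp_sum)
      then have "exp (- pairing \<beta> \<phi>' l) * exp (pairing \<beta> (\<phi> + z) l) *
          (\<Prod>i\<in>UNIV. inverse (1 - exp (- ?t i))) =
        ?ch l * (\<Prod>i\<in>UNIV. exp (of_real (coord c l i) * ?t i) * inverse (1 - exp (- ?t i)))"
        by (simp add: prod.distrib mult_ac)
      also have "(\<Prod>i\<in>UNIV. exp (of_real (coord c l i) * ?t i) * inverse (1 - exp (- ?t i))) =
          (\<Prod>i\<in>UNIV. inverse (?t i) + g (of_real (coord c l i)) (?t i))"
        by (intro prod.cong refl g_eq t)
      also have "\<dots> = (\<Sum>B\<in>Pow UNIV. ?P l B z)"
        by (rule prod_add) simp
      also have "\<dots> = (\<Prod>i\<in>UNIV. inverse (?t i)) + (\<Sum>B\<in>Pow UNIV - {UNIV}. ?P l B z)"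
        by (subst sum.remove[of _ UNIV]) auto
      finally show ?thesis by (simp add: ring_distribs)
    qed
    have "omega (int_span \<beta>) \<beta> c \<phi>' (\<phi> + z) = ?N * (\<Sum>l\<in>?R. exp (- pairing \<beta> \<phi>' l) *
        exp (pairing \<beta> (\<phi> + z) l) * (\<Prod>i\<in>UNIV. inverse (1 - exp (- ?t i))))"
      unfolding omega_shift fac by (simp only: sum_distrib_right mult.assoc)
    also have "\<dots> = char_mean * (\<Prod>i\<in>UNIV. inverse (?t i)) + D z"
      unfolding summand sum.distrib D_def char_mean_def
      by (simp only: ring_distribs sum_distrib_right mult.assoc)
    finally show ?thesis ..
  qed
  have "germ \<beta> T (\<lambda>z. omega (int_span \<beta>) \<beta> c \<phi>' (\<phi> + z))"
    by (rule germ_cong[OF germ_add[OF G null_imp_germ[OF D]] r(1)]) (rule eq)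
  moreover have "null \<beta> e T (\<lambda>z. omega (int_span \<beta>) \<beta> c \<phi>' (\<phi> + z) -
      char_mean * (\<Prod>i\<in>UNIV. inverse (pairing \<beta> z (c i))))"
    by (rule null_cong[OF D r(1)]) (simp add: eq[symmetric])
  ultimately show ?thesis using G by (simp add: null_equiv_def)
qed

lemma char_mean_eq_1: "\<phi>' = \<phi> \<Longrightarrow> char_mean = 1"
  using card_box_pos unfolding char_mean_def by (simp add: exp_minus)

text \<open>Both points are trivial on the sublattice spanned by \<open>c\<close>, so their quotient
  is a character modulo that sublattice, and \<open>m\<close> shows that it is nontrivial.\<close>

lemma char_mean_eq_0:
  assumes on: "\<And>i. c i \<in> T" and m: "m \<in> int_span \<beta>" "exp (pairing \<beta> \<phi>' m) \<noteq> exp (pairing \<beta> \<phi> m)"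
  shows "char_mean = 0"
proof -
  have "(\<Sum>l\<in>cell. exp (- pairing \<beta> \<phi>' l) * exp (pairing \<beta> \<phi> l)) = 0"
  proof (rule character_sum[OF _ _ m(1)])
    show "exp (- pairing \<beta> \<phi>' (v + w)) * exp (pairing \<beta> \<phi> (v + w)) =
        exp (- pairing \<beta> \<phi>' v) * exp (pairing \<beta> \<phi> v) * (exp (- pairing \<beta> \<phi>' w) * exp (pairing \<beta> \<phi> w))" for v w
      by (simp add: pairing_add[OF \<beta>] exp_add exp_diff exp_minus field_simps)
    show "exp (- pairing \<beta> \<phi>' v) * exp (pairing \<beta> \<phi> v) = 1" if "v \<in> int_span c" for v
      using exp_pairing_int_span[OF c_trivial that] exp_pairing_int_span[OF T_iff[THEN iffD1, OF on] that]
      by (simp add: exp_minus)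
    show "exp (- pairing \<beta> \<phi>' m) * exp (pairing \<beta> \<phi> m) \<noteq> 1"
      using m(2) by (simp add: exp_minus field_simps)
  qed
  then show ?thesis by (simp add: char_mean_def)
qed

end

lemma null_equiv_zero: "null_equiv \<beta> e T F (\<lambda>z. 0 * G z) \<Longrightarrow> null \<beta> e T F"
  by (simp add: null_equiv_def)

lemma null_equiv_null:
  assumes "null_equiv \<beta> e T F G" and "null \<beta> e T G"
  shows "null \<beta> e T F"
  using null_add[of \<beta> e T "\<lambda>z. F z - G z" G] assms by (simp add: null_equiv_def)

lemma extracted_in_set:
  assumes "b \<in> bases Z"
  shows "extracted Z b i \<in> set Z"
  using assms by (auto simp: bases_def extracted_def)

text \<open>An identity in \<Pi>_X is available only at regular points; this guarantees that points
  close to \<phi> and off the hyperplanes through it are regular.\<close>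

lemma regular_near:
  assumes "finite A"
  shows "\<exists>r>0. \<forall>z\<in>pole_free \<beta> {a\<in>A. exp (pairing \<beta> \<phi> a) = 1} r. \<forall>a\<in>A. exp (- pairing \<beta> (\<phi> + z) a) \<noteq> 1"
proof -
  have "\<exists>r>0. \<forall>z. norm z < r \<longrightarrow>
      (exp (pairing \<beta> \<phi> a) = 1 \<longrightarrow> pairing \<beta> z a \<noteq> 0) \<longrightarrow> exp (- pairing \<beta> (\<phi> + z) a) \<noteq> 1" for a
  proof (cases "exp (pairing \<beta> \<phi> a) = 1")
    case True
    obtain r where r: "r > 0" "\<And>z. norm z < r \<Longrightarrow> norm (pairing \<beta> z a) < 1"
      using pairing_small[of 1 \<beta> a] by auto
    have "exp (- pairing \<beta> (\<phi> + z) a) = exp (- pairing \<beta> z a)" for z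
      using True by (simp add: pairing_add_left exp_diff exp_minus divide_inverse)
    then show ?thesis using r exp_minus_neq_1 True by (intro exI[of _ r]) simp
  next
    case False
    obtain \<epsilon> where e: "\<epsilon> > 0" "\<And>t. norm t < \<epsilon> \<Longrightarrow> exp (- (pairing \<beta> \<phi> a + t)) \<noteq> 1"
      using nonresonant_radius[OF False] by blast
    obtain r where r: "r > 0" "\<And>z. norm z < r \<Longrightarrow> norm (pairing \<beta> z a) < \<epsilon>"
      using pairing_small[OF e(1), of \<beta> a] by auto
    show ?thesis using r e(2) by (intro exI[of _ r]) (simp add: pairing_add_left)
  qed
  then obtain r where "r > 0" "\<forall>z. norm z < r \<longrightarrow> (\<forall>a\<in>A.
      (exp (pairing \<beta> \<phi> a) = 1 \<longrightarrow> pairing \<beta> z a \<noteq> 0) \<longrightarrow> exp (- pairing \<beta> (\<phi> + z) a) \<noteq> 1)"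
    using finite_radius[OF assms, of "\<lambda>a z. (exp (pairing \<beta> \<phi> a) = 1 \<longrightarrow> pairing \<beta> z a \<noteq> 0) \<longrightarrow>
      exp (- pairing \<beta> (\<phi> + z) a) \<noteq> 1"] by blast
  then show ?thesis by (intro exI[of _ r]) (auto simp: pole_free_def)
qed

section \<open>Residues at one point of the arrangement\<close>

locale toric_point =
  fixes \<beta> :: "'s::{finite,linorder} \<Rightarrow> 'v::real_vector" and X :: "'v list"
    and \<phi> :: "(complex, 's) vec" and b :: "'s \<Rightarrow> nat"
  assumes \<beta>: "family_basis \<beta>" and X: "set X \<subseteq> int_span \<beta>" "0 \<notin> set X"
    and b: "b \<in> no_broken_bases (sublist_at \<beta> X \<phi>)"
begin

abbreviation "e \<equiv> extracted (sublist_at \<beta> X \<phi>) b"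
abbreviation "T \<equiv> {a\<in>set X. exp (pairing \<beta> \<phi> a) = 1}"

lemma e: "family_basis e"
  using b by (simp add: no_broken_bases_def bases_def)

lemma pole_basis:
  assumes b': "b' \<in> no_broken_bases (sublist_at \<beta> X \<phi>')"
  shows "pole_basis \<beta> (extracted (sublist_at \<beta> X \<phi>') b') e T \<phi> \<phi>'"
proof -
  let ?c = "extracted (sublist_at \<beta> X \<phi>') b'"
  have bb: "b' \<in> bases (sublist_at \<beta> X \<phi>')"
    using b' by (simp add: no_broken_bases_def)
  have mem: "?c i \<in> set X" "exp (pairing \<beta> \<phi>' (?c i)) = 1" for i
    using extracted_in_set[OF bb, of i] by (auto simp: sublist_at_def)
  show ?thesis
  proof unfold_locales
    show "family_basis ?c" using bb by (simp add: bases_def)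
    show "?c i \<in> int_span \<beta>" for i using mem(1) X by blast
  qed (use \<beta> e X mem in auto)
qed

lemma omega_null:
  assumes b': "b' \<in> no_broken_bases (sublist_at \<beta> X \<phi>')"
    and diff: "\<phi>' = \<phi> \<Longrightarrow> b' \<noteq> b"
    and torus: "\<phi>' \<noteq> \<phi> \<Longrightarrow> torus_point (int_span \<beta>) \<beta> \<phi>' \<noteq> torus_point (int_span \<beta>) \<beta> \<phi>"
  shows "null \<beta> e T (\<lambda>z. omega (int_span \<beta>) \<beta> (extracted (sublist_at \<beta> X \<phi>') b') \<phi>' (\<phi> + z))"
proof -
  let ?c = "extracted (sublist_at \<beta> X \<phi>') b'"
  interpret pole_basis \<beta> ?c e T \<phi> \<phi>' by (rule pole_basis[OF b'])
  show ?thesis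
  proof (cases "\<forall>i. ?c i \<in> T")
    case False
    then show ?thesis using omega_null_if_off by blast
  next
    case True
    then have on: "\<And>i. ?c i \<in> T" by blast
    show ?thesis
    proof (cases "\<phi>' = \<phi>")
      \<comment> \<open>All poles pass through \<phi>, but the points differ: a lattice vector
        separates them and makes the character nontrivial.\<close>
      case False
      then obtain m where "torus_point (int_span \<beta>) \<beta> \<phi>' m \<noteq> torus_point (int_span \<beta>) \<beta> \<phi> m"
        using torus by (meson ext)
      then have "m \<in> int_span \<beta>" "exp (pairing \<beta> \<phi>' m) \<noteq> exp (pairing \<beta> \<phi> m)"
        by (auto simp: torus_point_def restrict_def split: if_splits)
      then have 0: "char_mean = 0" by (rule char_mean_eq_0[OF on])
      show ?thesis by (rule null_equiv_zero[OF omega_null_equiv[OF on, unfolded 0]])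
    next
      case same: True
      obtain j where j: "\<And>k. lead e (?c k) \<noteq> j"
        using no_broken_bases_leads[OF b b'[unfolded same]] diff[OF same] same by metis
      have "null \<beta> e T (\<lambda>z. \<Prod>i\<in>UNIV. inverse (pairing \<beta> z (?c i)))"
        by (rule null_germ[of _ "range ?c" _ _ _ j]) (use on j in \<open>auto intro!: germ_prod germ_inverse\<close>)
      then show ?thesis
        by (intro null_equiv_null[OF omega_null_equiv[OF on]] null_cmult)
    qed
  qed
qed

text \<open>For the pair (\<phi>, b) the mean of the character is 1, so omega may be replaced by the
  inverse product of the b_i(z), and duality with the divided powers applies. For every other pair
  omega and its derivatives are null.\<close>

lemma has_res_omega:
  assumes b': "b' \<in> no_broken_bases (sublist_at \<beta> X \<phi>')"
    and torus: "\<phi>' \<noteq> \<phi> \<Longrightarrow> torus_point (int_span \<beta>) \<beta> \<phi>' \<noteq> torus_point (int_span \<beta>) \<beta> \<phi>"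
  shows "has_res \<beta> e (\<lambda>z. div_power \<alpha> z *
      partials \<gamma> (omega (int_span \<beta>) \<beta> (extracted (sublist_at \<beta> X \<phi>') b') \<phi>') (\<phi> + z))
    (if \<phi>' = \<phi> \<and> b' = b \<and> \<gamma> = \<alpha> then (-1) ^ (\<Sum>i\<in>UNIV. \<alpha> i) else 0)"
proof -
  let ?c = "extracted (sublist_at \<beta> X \<phi>') b'"
  let ?\<omega> = "\<lambda>z. omega (int_span \<beta>) \<beta> ?c \<phi>' (\<phi> + z)"
  have T: "finite T" "0 \<notin> T" using X by auto
  show ?thesis
  proof (cases "\<phi>' = \<phi> \<and> b' = b")
    case False
    then have "null \<beta> e T ?\<omega>" using omega_null[OF b' _ torus] by blast
    then have "null \<beta> e T (\<lambda>z. div_power \<alpha> z * partials \<gamma> ?\<omega> z)"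
      by (intro null_mult null_partials germ_div_power T)
    from null_has_res[OF \<beta> e T this] show ?thesis
      using False by (auto simp: partials_shift)
  next
    case True
    then have c: "?c = e" by simp
    interpret pole_basis \<beta> e e T \<phi> \<phi>
      using pole_basis[OF b] .
    have on: "e i \<in> T" for i using T_iff[of i] c_trivial[of i] by simp
    let ?G = "\<lambda>z. \<Prod>i\<in>UNIV. inverse (pairing \<beta> z (e i))"
    have "null_equiv \<beta> e T ?\<omega> ?G"
      using omega_null_equiv[OF on] True by (simp add: char_mean_eq_1)
    then have "null_equiv \<beta> e T (partials \<gamma> ?\<omega>) (partials \<gamma> ?G)"
      by (rule null_equiv_partials[OF T(1)])
    then have "null \<beta> e T (\<lambda>z. div_power \<alpha> z * (partials \<gamma> ?\<omega> z - partials \<gamma> ?G z))"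
      by (intro null_mult germ_div_power) (simp add: null_equiv_def)
    from has_res_add[OF null_has_res[OF \<beta> e T this] has_res_main_term[OF \<beta> e, of \<alpha> \<gamma>]]
    show ?thesis
      using True by (simp add: partials_shift right_diff_distrib)
  qed
qed

text \<open>The poles through \<phi> are among the vectors with positive exponent, and these do not
  span.\<close>

lemma lower_null:
  assumes g: "g \<in> group_algebra (int_span \<beta>) \<beta>"
    and h: "span {X ! i | i. i < length X \<and> 0 < h i} \<noteq> UNIV"
  shows "null \<beta> e T (\<lambda>z. g (\<phi> + z) / (\<Prod>i<length X. (1 - exp (- pairing \<beta> (\<phi> + z) (X ! i))) ^ h i))"
proof -
  let ?S = "{X ! i | i. i < length X \<and> 0 < h i} \<inter> T"
  obtain A k where "g = (\<lambda>z. \<Sum>l\<in>A. k l * exp (pairing \<beta> z l))"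
    using g by (auto simp: group_algebra_def)
  then have "germ \<beta> ?S (\<lambda>z. g (\<phi> + z))"
    by (auto intro!: germ_sum germ_cmult germ_exp_pairing)
  moreover have "germ \<beta> ?S (\<lambda>z. \<Prod>i<length X. inverse (1 - exp (- pairing \<beta> (\<phi> + z) (X ! i))) ^ h i)"
  proof (rule germ_prod)
    fix i assume i: "i \<in> {..<length X}"
    show "germ \<beta> ?S (\<lambda>z. inverse (1 - exp (- pairing \<beta> (\<phi> + z) (X ! i))) ^ h i)"
    proof (cases "h i = 0")
      case True
      then show ?thesis by (simp add: germ_const)
    next
      case False
      then show ?thesis using i by (intro germ_power germ_factor) auto
    qed
  qed
  ultimately have "germ \<beta> ?S (\<lambda>z. g (\<phi> + z) / (\<Prod>i<length X. (1 - exp (- pairing \<beta> (\<phi> + z) (X ! i))) ^ h i))"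
    by (simp add: divide_inverse power_inverse prod_inversef[symmetric] germ_mult)
  then show ?thesis
  proof (rule null_not_spanning[OF e])
    show "span ?S \<noteq> UNIV" using h span_mono[of ?S "{X ! i | i. i < length X \<and> 0 < h i}"] by auto
  qed (use X in auto)
qed

end

theorem mainTheorem10:
  fixes \<Lambda> :: "'v::real_vector set"
    and \<beta> :: "'s::{finite,linorder} \<Rightarrow> 'v"
    and X :: "'v list"
    and \<Phi> :: "(complex, 's) vec set"
    and q :: "('s \<Rightarrow> nat) \<Rightarrow> (complex, 's) vec \<Rightarrow> 's polynomial"
    and \<phi> :: "(complex, 's) vec"
    and b :: "'s \<Rightarrow> nat"
    and \<alpha> :: "'s \<Rightarrow> nat"
  assumes "lattice_basis \<Lambda> \<beta>"
    and "set X \<subseteq> \<Lambda>" and "0 \<notin> set X" and "span (set X) = UNIV"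
    and "bij_betw (torus_point \<Lambda> \<beta>) \<Phi> (arrangement_points \<Lambda> \<beta> X)"
    and "is_q_family \<Lambda> \<beta> X \<Phi> q"
    and "\<phi> \<in> \<Phi>"
    and "b \<in> no_broken_bases (sublist_at \<beta> X \<phi>)"
  shows "taylor_coeff \<alpha> (\<lambda>y. eval_polynomial (q b \<phi>) (- y)) =
    of_real (basis_det \<beta> (extracted (sublist_at \<beta> X \<phi>) b)) *
    res \<beta> (extracted (sublist_at \<beta> X \<phi>) b)
      (\<lambda>z. taylor_coeff \<alpha> (\<lambda>y. exp (\<Sum>i\<in>UNIV. y $ i * z $ i) /
              (\<Prod>a\<leftarrow>X. 1 - exp (- pairing \<beta> z a - pairing \<beta> \<phi> a))))"
proof -
  let ?Z = "sublist_at \<beta> X"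
  let ?\<omega> = "\<lambda>\<psi> d. omega \<Lambda> \<beta> (extracted (?Z \<psi>) d) \<psi>"
  let ?N = "\<lambda>\<psi>. no_broken_bases (?Z \<psi>) :: ('s \<Rightarrow> nat) set"
  let ?K = "\<lambda>d \<psi>. Poly_Mapping.keys (q d \<psi>)" and ?k = "\<lambda>d \<psi>. Poly_Mapping.lookup (q d \<psi>)"
  let ?s = "(-1) ^ (\<Sum>i\<in>UNIV. \<alpha> i) :: complex"
  let ?v = "?k b \<phi> \<alpha> * ?s"
  have \<beta>: "family_basis \<beta>" and \<Lambda>: "\<Lambda> = int_span \<beta>"
    using assms(1) by (auto simp: lattice_basis_def)
  interpret toric_point \<beta> X \<phi> b
    using \<beta> \<Lambda> assms by unfold_locales auto
  \<comment> \<open>\<open>sum\<close> over an infinite set is 0, so finiteness of \<Phi> is what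
    allows the term at \<phi> to be singled out.\<close>
  have "finite \<Phi>"
    using finite_arrangement_points[OF \<beta> X(1)] assms(5) bij_betw_finite \<Lambda> by metis
  have torus: "torus_point (int_span \<beta>) \<beta> \<psi> \<noteq> torus_point (int_span \<beta>) \<beta> \<phi>" if "\<psi> \<in> \<Phi>" "\<psi> \<noteq> \<phi>" for \<psi>
    using bij_betw_imp_inj_on[OF assms(5)] that assms(7) \<Lambda> by (auto dest: inj_onD)
  obtain n g h where gh: "\<And>k. k < (n::nat) \<Longrightarrow> g k \<in> group_algebra \<Lambda> \<beta>"
      "\<And>k. k < n \<Longrightarrow> span {X ! i | i. i < length X \<and> 0 < h k i} \<noteq> UNIV"
    and id: "\<And>z. z \<in> regular_points \<beta> X \<Longrightarrow>
      inverse (\<Prod>a\<leftarrow>X. 1 - exp (- pairing \<beta> z a)) -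
        (\<Sum>\<psi>\<in>\<Phi>. \<Sum>d\<in>?N \<psi>. diff_op (q d \<psi>) (?\<omega> \<psi> d) z) =
      (\<Sum>k<n. g k z / (\<Prod>i<length X. (1 - exp (- pairing \<beta> z (X ! i))) ^ h k i))"
    using assms(6) unfolding is_q_family_def equal_in_Pi_def S_lower_def by blast
  have T: "finite T" "0 \<notin> T" using X by auto
  let ?L = "\<lambda>z. \<Sum>k<n. g k (\<phi> + z) / (\<Prod>i<length X. (1 - exp (- pairing \<beta> (\<phi> + z) (X ! i))) ^ h k i)"
  have "null \<beta> e T (\<lambda>z. div_power \<alpha> z * ?L z)"
    by (intro null_mult null_sum lower_null germ_div_power) (use gh \<Lambda> in auto)
  then have L: "has_res \<beta> e (\<lambda>z. div_power \<alpha> z * ?L z) 0"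
    by (rule null_has_res[OF \<beta> e T])
  \<comment> \<open>The right-hand side of the defining identity, with the operators written out,
    times the divided power. Its residue receives a contribution only from \<psi> = \<phi>, d = b,
    \<gamma> = \<alpha>.\<close>
  let ?Q = "\<lambda>z. \<Sum>\<psi>\<in>\<Phi>. \<Sum>d\<in>?N \<psi>. \<Sum>\<gamma>\<in>?K d \<psi>.
    ?k d \<psi> \<gamma> * (div_power \<alpha> z * partials \<gamma> (?\<omega> \<psi> d) (\<phi> + z))"
  have Q: "has_res \<beta> e ?Q (\<Sum>\<psi>\<in>\<Phi>. \<Sum>d\<in>?N \<psi>. \<Sum>\<gamma>\<in>?K d \<psi>.
    ?k d \<psi> \<gamma> * (if \<psi> = \<phi> \<and> d = b \<and> \<gamma> = \<alpha> then ?s else 0))"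
    unfolding \<Lambda> by (intro has_res_sum has_res_cmult has_res_omega torus)
  have "(\<Sum>\<psi>\<in>\<Phi>. \<Sum>d\<in>?N \<psi>. \<Sum>\<gamma>\<in>?K d \<psi>.
      ?k d \<psi> \<gamma> * (if \<psi> = \<phi> \<and> d = b \<and> \<gamma> = \<alpha> then ?s else 0)) =
    (\<Sum>\<psi>\<in>\<Phi>. \<Sum>d\<in>?N \<psi>. if d = b then
      (if \<psi> = \<phi> then ?v else 0) else 0)"
  proof (intro sum.cong refl)
    fix \<psi> and d :: "'s \<Rightarrow> nat"
    have "(\<Sum>\<gamma>\<in>?K d \<psi>. ?k d \<psi> \<gamma> *
        (if \<psi> = \<phi> \<and> d = b \<and> \<gamma> = \<alpha> then ?s else 0)) =
      (\<Sum>\<gamma>\<in>?K d \<psi>. if \<gamma> = \<alpha> then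
        (if \<psi> = \<phi> \<and> d = b then ?k d \<psi> \<alpha> * ?s else 0) else 0)"
      by (intro sum.cong refl) auto
    \<comment> \<open>If \<alpha> is not a key, its coefficient is 0 and both sides still
      agree.\<close>
    also have "\<dots> = (if \<psi> = \<phi> \<and> d = b then ?k d \<psi> \<alpha> * ?s else 0)"
      by (simp add: in_keys_iff)
    finally show "(\<Sum>\<gamma>\<in>?K d \<psi>. ?k d \<psi> \<gamma> *
        (if \<psi> = \<phi> \<and> d = b \<and> \<gamma> = \<alpha> then ?s else 0)) =
      (if d = b then (if \<psi> = \<phi> then ?v else 0) else 0)"
      by auto
  qed
  also have "\<dots> = (\<Sum>\<psi>\<in>\<Phi>. if \<psi> = \<phi> then ?v else 0)"
  proof (intro sum.cong refl)
    fix \<psi>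
    show "(\<Sum>d\<in>?N \<psi>. if d = b then
        (if \<psi> = \<phi> then ?v else 0) else 0) =
      (if \<psi> = \<phi> then ?v else 0)"
      using b by (auto simp: sum.delta[OF finite_no_broken_bases])
  qed
  also have "\<dots> = ?v"
    using \<open>finite \<Phi>\<close> assms(7) by (simp add: sum.delta)
  finally have QL: "has_res \<beta> e (\<lambda>z. ?Q z + div_power \<alpha> z * ?L z) ?v"
    using has_res_add[OF Q L] by (simp only: add_0_right)
  obtain r where r: "r > 0" "\<forall>z\<in>pole_free \<beta> T r. \<forall>a\<in>set X. exp (- pairing \<beta> (\<phi> + z) a) \<noteq> 1"
    using regular_near[of "set X" \<beta> \<phi>] by auto
  let ?f = "\<lambda>z. taylor_coeff \<alpha> (\<lambda>y. exp (\<Sum>i\<in>UNIV. y $ i * z $ i) /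
              (\<Prod>a\<leftarrow>X. 1 - exp (- pairing \<beta> z a - pairing \<beta> \<phi> a)))"
  \<comment> \<open>The Taylor coefficient in y is the divided power times the fraction at \<phi> +
    z, a regular point, where the identity in \<Pi>_X can be inserted.\<close>
  have "?Q z + div_power \<alpha> z * ?L z = ?f z" if z: "z \<in> pole_free \<beta> T r" for z
  proof -
    have "\<phi> + z \<in> regular_points \<beta> X" using r(2) z by (auto simp: regular_points_def)
    from id[OF this] have "inverse (\<Prod>a\<leftarrow>X. 1 - exp (- pairing \<beta> (\<phi> + z) a)) =
        (\<Sum>\<psi>\<in>\<Phi>. \<Sum>d\<in>?N \<psi>. diff_op (q d \<psi>) (?\<omega> \<psi> d) (\<phi> + z)) + ?L z"
      by (simp add: diff_eq_eq add.commute)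
    moreover have "?f z = div_power \<alpha> z * inverse (\<Prod>a\<leftarrow>X. 1 - exp (- pairing \<beta> (\<phi> + z) a))"
    proof -
      have "- pairing \<beta> (\<phi> + z) a = - pairing \<beta> z a - pairing \<beta> \<phi> a" for a
        by (simp add: pairing_add_left)
      then show ?thesis by (simp only: taylor_coeff_exp)
    qed
    moreover have "div_power \<alpha> z * (\<Sum>\<psi>\<in>\<Phi>. \<Sum>d\<in>?N \<psi>.
        diff_op (q d \<psi>) (?\<omega> \<psi> d) (\<phi> + z)) = ?Q z"
      by (simp add: diff_op_def sum_distrib_left mult.left_commute)
    ultimately show ?thesis by (simp add: ring_distribs)
  qed
  then have "has_res \<beta> e ?f ?v"
    by (rule has_res_cong[OF \<beta> e T QL r(1)])
  then have "res \<beta> e ?f = of_real (basis_det e \<beta>) * ?v"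
    by (rule res_eq[OF \<beta> e])
  moreover have "of_real (basis_det \<beta> e) * of_real (basis_det e \<beta>) = (1 :: complex)"
    using basis_change_det[OF \<beta> e] by (metis mult.commute of_real_1 of_real_mult)
  ultimately have "of_real (basis_det \<beta> e) * res \<beta> e ?f = ?v"
    by (simp add: mult.assoc[symmetric])
  then show ?thesis by (simp add: taylor_coeff_eval_polynomial mult.commute)
qed

end
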